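(* Let $\mathcal{F}$ be a graph family closed under re-weighting such that every $G\in\mathcal{F}$ admits a $(\beta,\tau)$-sparse partition cover scheme. Then for every $\varepsilon>0$, every $n$-vertex graph $G=(V,E,w)\in\mathcal{F}$ admits an efficiently computable embedding $f:V\to\ell_\infty^k$ with distortion $(1+\varepsilon)\cdot2\beta$ and dimension $k=O\left(\frac{\tau}{\varepsilon}\cdot\log\frac{\beta}{\varepsilon}\cdot\log(\frac{n\cdot\beta}{\varepsilon})\right)$.
   Context: A graph family $\mathcal{F}$ is closed under re-weighting if whenever $(V,E,w)\in\mathcal{F}$ then $(V,E,w')\in\mathcal{F}$ for every $w':E\to\mathbb{R}_{\ge0}$ (zero weights allowed; the shortest path distance is then a pseudometric). A (weak) $(\beta,\tau,\Delta)$-sparse partition cover is a family of $\tau$ partitions of $V$ whose clusters have diameter at most $\Delta$ (w.r.t. $d_G$) such that for each $v\in V$ the ball $B_G(v,\Delta/\beta)$ is contained in some cluster of some partition; $G$ admits a $(\beta,\tau)$-sparse partition cover scheme if for every $\Delta>0$ such a cover exists and is constructible in expected polynomial time. An embedding $f$ into $\ell_\infty^k$ has distortion $c\cdot t$ if $\frac1c d_G(x,y)\le\|f(x)-f(y)\|_\infty\le t\, d_G(x,y)$ for all $x,y$.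
   Formalization: For ε > 1/2 the dimension bound is taken at ε = 1/2 (distortion stays (1+ε)·2β), since the stated bound fails for large ε: at ε = β = 1 it is 0, which no graph with an edge of positive length can meet. *)

theory Defs
  imports "HOL-Probability.Probability" "HOL-Library.Disjoint_Sets"
begin

section \<open>Weighted graphs\<close>

text \<open>Vertices are natural numbers, so that one type contains a copy of every finite graph and
  the constant hidden in the O-notation cannot depend on a type of vertices.\<close>

record wgraph =
  verts :: "nat set"
  edges :: "nat set set"
  weight :: "nat set \<Rightarrow> real"

definition weighted_graph :: "wgraph \<Rightarrow> bool" where
  "weighted_graph G \<longleftrightarrow>
     finite (verts G) \<and> verts G \<noteq> {} \<and>
     (\<forall>e\<in>edges G. \<exists>a\<in>verts G. \<exists>b\<in>verts G. a \<noteq> b \<and> e = {a, b}) \<and>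
     (\<forall>e\<in>edges G. 0 \<le> weight G e)"

definition walks :: "wgraph \<Rightarrow> nat \<Rightarrow> nat \<Rightarrow> nat list set" where
  "walks G u v =
     {p. p \<noteq> [] \<and> set p \<subseteq> verts G \<and> hd p = u \<and> last p = v \<and>
         successively (\<lambda>a b. {a, b} \<in> edges G) p}"

definition walk_length :: "wgraph \<Rightarrow> nat list \<Rightarrow> real" where
  "walk_length G p = (\<Sum>(a, b)\<leftarrow>zip p (tl p). weight G {a, b})"

definition connected_graph :: "wgraph \<Rightarrow> bool" where
  "connected_graph G \<longleftrightarrow> (\<forall>u\<in>verts G. \<forall>v\<in>verts G. walks G u v \<noteq> {})"

definition gdist :: "wgraph \<Rightarrow> nat \<Rightarrow> nat \<Rightarrow> real" where
  "gdist G u v = (INF p\<in>walks G u v. walk_length G p)"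

definition gball :: "wgraph \<Rightarrow> nat \<Rightarrow> real \<Rightarrow> nat set" where
  "gball G v r = {u \<in> verts G. gdist G v u \<le> r}"

definition graph_family :: "wgraph set \<Rightarrow> bool" where
  "graph_family \<F> \<longleftrightarrow> (\<forall>G\<in>\<F>. weighted_graph G \<and> connected_graph G)"

definition closed_under_reweighting :: "wgraph set \<Rightarrow> bool" where
  "closed_under_reweighting \<F> \<longleftrightarrow>
     (\<forall>G\<in>\<F>. \<forall>w'. (\<forall>e\<in>edges G. 0 \<le> w' e) \<longrightarrow> G\<lparr>weight := w'\<rparr> \<in> \<F>)"

section \<open>Sparse partition covers and embeddings\<close>

text \<open>The diameter of a cluster is measured in the whole graph (weak diameter).\<close>

definition sparse_partition_cover ::
    "wgraph \<Rightarrow> real \<Rightarrow> nat \<Rightarrow> real \<Rightarrow> nat set set list \<Rightarrow> bool" where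
  "sparse_partition_cover G \<beta> \<tau> \<Delta> \<P> \<longleftrightarrow>
     length \<P> = \<tau> \<and>
     (\<forall>P\<in>set \<P>. partition_on (verts G) P \<and> (\<forall>C\<in>P. \<forall>x\<in>C. \<forall>y\<in>C. gdist G x y \<le> \<Delta>)) \<and>
     (\<forall>v\<in>verts G. \<exists>P\<in>set \<P>. \<exists>C\<in>P. gball G v (\<Delta> / \<beta>) \<subseteq> C)"

text \<open>Vectors of the \<open>k\<close>-dimensional space with the maximum norm are functions on \<open>nat\<close> of
  which only the values below \<open>k\<close> matter; the \<open>0\<close> inserted into the maximum covers \<open>k = 0\<close>.\<close>

definition linf_dist :: "nat \<Rightarrow> (nat \<Rightarrow> real) \<Rightarrow> (nat \<Rightarrow> real) \<Rightarrow> real" where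
  "linf_dist k a b = Max (insert 0 ((\<lambda>i. \<bar>a i - b i\<bar>) ` {..<k}))"

definition has_distortion :: "wgraph \<Rightarrow> nat \<Rightarrow> (nat \<Rightarrow> nat \<Rightarrow> real) \<Rightarrow> real \<Rightarrow> bool" where
  "has_distortion G k f D \<longleftrightarrow>
     (\<exists>c t. 0 < c \<and> 0 < t \<and> D = c * t \<and>
        (\<forall>x\<in>verts G. \<forall>y\<in>verts G.
           1 / c * gdist G x y \<le> linf_dist k (f x) (f y) \<and>
           linf_dist k (f x) (f y) \<le> t * gdist G x y))"

text \<open>The expression inside the O-notation is meant for small \<open>\<epsilon>\<close>: it is \<open>0\<close> for \<open>\<epsilon> = \<beta>\<close>, and for
  larger \<open>\<epsilon>\<close> it can be negative or tend to \<open>0\<close>, where no embedding can satisfy it.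
  For \<open>\<epsilon> \<le> 1/2\<close> the definition is the expression itself; for larger \<open>\<epsilon>\<close> it is its value at
  \<open>1/2\<close>.\<close>

definition dim_bound :: "real \<Rightarrow> nat \<Rightarrow> real \<Rightarrow> nat \<Rightarrow> real" where
  "dim_bound \<beta> \<tau> \<epsilon> n =
     (let \<epsilon>' = min \<epsilon> (1/2) in real \<tau> / \<epsilon>' * ln (\<beta> / \<epsilon>') * ln (real n * \<beta> / \<epsilon>'))"

section \<open>Randomized computation over the reals\<close>

text \<open>Since weights are real numbers, efficiency refers to a machine model with exact real
  arithmetic at unit cost (as in the Blum-Shub-Smale model): while-programs over nested lists of
  reals, with fair coin flips. There is neither rounding nor a unit-cost comparison of lists.
  Ill-typed operations, \<open>Head\<close> and \<open>Tail\<close> of an empty list, and unbound variables yield default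
  values.\<close>

datatype val = Num real | Lst "val list"

datatype unop = Head | Tail | IsCons

datatype binop = Add | Sub | Mul | Div | Less | Prepend

text \<open>\<open>Var i\<close> is a de Bruijn index. \<open>Bind p q\<close> evaluates \<open>q\<close> with the value of \<open>p\<close> as variable \<open>0\<close>.
  \<open>While g b p\<close> starts with the value of \<open>p\<close> and replaces the current value by that of \<open>b\<close> as long
  as \<open>g\<close> is true; the current value is variable \<open>0\<close> in \<open>g\<close> and \<open>b\<close>.\<close>

datatype prog =
    Var nat
  | Const real
  | Empty
  | Coin
  | Unary unop prog
  | Binary binop prog prog
  | Cond prog prog prog
  | Bind prog prog
  | While prog prog prog

definition truth :: "bool \<Rightarrow> val" where
  "truth b = Num (if b then 1 else 0)"

definition is_true :: "val \<Rightarrow> bool" where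
  "is_true v \<longleftrightarrow> v = Num 1"

fun apply_un :: "unop \<Rightarrow> val \<Rightarrow> val" where
  "apply_un Head (Lst (v # vs)) = v"
| "apply_un Tail (Lst (v # vs)) = Lst vs"
| "apply_un IsCons (Lst (v # vs)) = truth True"
| "apply_un IsCons _ = truth False"
| "apply_un _ _ = Lst []"

fun apply_bin :: "binop \<Rightarrow> val \<Rightarrow> val \<Rightarrow> val" where
  "apply_bin Add (Num a) (Num b) = Num (a + b)"
| "apply_bin Sub (Num a) (Num b) = Num (a - b)"
| "apply_bin Mul (Num a) (Num b) = Num (a * b)"
| "apply_bin Div (Num a) (Num b) = Num (a / b)"
| "apply_bin Less (Num a) (Num b) = truth (a < b)"
| "apply_bin Prepend v (Lst vs) = Lst (v # vs)"
| "apply_bin _ _ _ = Lst []"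

text \<open>The second component of a result counts steps; diverging runs are the mass missing from the
  subprobability distribution.\<close>

partial_function (spmf) while_steps ::
    "(val \<Rightarrow> (val \<times> nat) spmf) \<Rightarrow> (val \<Rightarrow> (val \<times> nat) spmf) \<Rightarrow> val \<Rightarrow> nat \<Rightarrow> (val \<times> nat) spmf" where
  "while_steps g b v s =
     bind_spmf (g v) (\<lambda>(c, s1).
       if is_true c
       then bind_spmf (b v) (\<lambda>(v', s2). while_steps g b v' (s + s1 + s2 + 1))
       else return_spmf (v, s + s1 + 1))"

primrec run :: "prog \<Rightarrow> val list \<Rightarrow> (val \<times> nat) spmf" where
  "run (Var i) env = return_spmf (if i < length env then env ! i else Lst [], 1)"
| "run (Const r) env = return_spmf (Num r, 1)"
| "run Empty env = return_spmf (Lst [], 1)"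
| "run Coin env = map_spmf (\<lambda>b. (truth b, 1)) coin_spmf"
| "run (Unary f p) env = map_spmf (\<lambda>(v, s). (apply_un f v, s + 1)) (run p env)"
| "run (Binary f p q) env =
     bind_spmf (run p env) (\<lambda>(v, s1).
     map_spmf (\<lambda>(u, s2). (apply_bin f v u, s1 + s2 + 1)) (run q env))"
| "run (Cond c p q) env =
     bind_spmf (run c env) (\<lambda>(v, s1).
     map_spmf (\<lambda>(u, s2). (u, s1 + s2 + 1)) (if is_true v then run p env else run q env))"
| "run (Bind p q) env =
     bind_spmf (run p env) (\<lambda>(v, s1).
     map_spmf (\<lambda>(u, s2). (u, s1 + s2 + 1)) (run q (v # env)))"
| "run (While g b p) env =
     bind_spmf (run p env) (\<lambda>(v, s).
     while_steps (\<lambda>u. run g (u # env)) (\<lambda>u. run b (u # env)) v s)"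

text \<open>Las Vegas computation: the program halts almost surely, every possible result is correct,
  and only the running time is bounded in expectation.\<close>

definition computes_within ::
    "prog \<Rightarrow> val list \<Rightarrow> (val \<Rightarrow> bool) \<Rightarrow> nat \<Rightarrow> bool" where
  "computes_within p inputs Q T \<longleftrightarrow>
     lossless_spmf (run p inputs) \<and>
     (\<forall>(v, s)\<in>set_spmf (run p inputs). Q v) \<and>
     (\<integral>\<^sup>+(v, s). of_nat s \<partial>measure_spmf (run p inputs)) \<le> of_nat T"

text \<open>A graph may be presented by listing its vertices and edges in any order. The lists in a
  presentation of a cover are repetition-free, which bounds its size in terms of the graph.\<close>

definition vertex_val :: "nat \<Rightarrow> val" where
  "vertex_val v = Num (real v)"

definition represents_graph :: "val \<Rightarrow> wgraph \<Rightarrow> bool" where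
  "represents_graph x G \<longleftrightarrow>
     (\<exists>vs es. distinct vs \<and> set vs = verts G \<and>
        distinct (map (\<lambda>(a, b). {a, b}) es) \<and> set (map (\<lambda>(a, b). {a, b}) es) = edges G \<and>
        x = Lst [Lst (map vertex_val vs),
                 Lst (map (\<lambda>(a, b). Lst [vertex_val a, vertex_val b, Num (weight G {a, b})]) es)])"

definition represents_cover :: "val \<Rightarrow> nat set set list \<Rightarrow> bool" where
  "represents_cover x \<P> \<longleftrightarrow>
     (\<exists>L :: nat list list list.
        (\<forall>P\<in>set L. distinct P \<and> (\<forall>C\<in>set P. distinct C)) \<and>
        (\<forall>P\<in>set L. inj_on set (set P)) \<and>
        \<P> = map (\<lambda>P. set ` set P) L \<and>
        x = Lst (map (\<lambda>P. Lst (map (\<lambda>C. Lst (map vertex_val C)) P)) L))"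

definition represents_embedding ::
    "val \<Rightarrow> wgraph \<Rightarrow> nat \<Rightarrow> (nat \<Rightarrow> nat \<Rightarrow> real) \<Rightarrow> bool" where
  "represents_embedding x G k f \<longleftrightarrow>
     (\<exists>vs. distinct vs \<and> set vs = verts G \<and>
        x = Lst (map (\<lambda>v. Lst [vertex_val v, Lst (map (\<lambda>i. Num (f v i)) [0..<k])]) vs))"

text \<open>Polynomial time is a property of one program on a whole family, not of a single graph, so the
  program and the polynomial \<open>c * n ^ c\<close> (with \<open>n \<ge> 1\<close> the number of vertices) are the same for
  all members of the family and all scales.\<close>

definition admits_sparse_partition_cover_scheme ::
    "wgraph set \<Rightarrow> real \<Rightarrow> nat \<Rightarrow> bool" where
  "admits_sparse_partition_cover_scheme \<F> \<beta> \<tau> \<longleftrightarrow>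
     (\<exists>p c. \<forall>G\<in>\<F>. \<forall>\<Delta>>0. \<forall>x. represents_graph x G \<longrightarrow>
        computes_within p [x, Num \<Delta>]
          (\<lambda>y. \<exists>\<P>. represents_cover y \<P> \<and> sparse_partition_cover G \<beta> \<tau> \<Delta> \<P>)
          (c * card (verts G) ^ c))"

definition admits_efficient_embeddings ::
    "wgraph set \<Rightarrow> real \<Rightarrow> (nat \<Rightarrow> real) \<Rightarrow> bool" where
  "admits_efficient_embeddings \<F> D K \<longleftrightarrow>
     (\<exists>p c. \<forall>G\<in>\<F>. \<forall>x. represents_graph x G \<longrightarrow>
        computes_within p [x]
          (\<lambda>y. \<exists>k f. represents_embedding y G k f \<and> has_distortion G k f D \<and>
                     real k \<le> K (card (verts G)))
          (c * card (verts G) ^ c))"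

end

theory Submission
  imports Defs
begin

text \<open>
  Take the distances that occur in the graph, thin them out greedily to a list of scales
  \<open>\<Delta>\<close> growing by factors of at least \<open>6 / 5\<close>, and compute one cover per scale. The scales are split
  into \<open>m = O(log \<beta>)\<close> residue classes, so that within a class they grow by factors of at least
  \<open>560 * \<beta>\<close>. For every class, every index of a partition, every power of two \<open>q\<close> up to the number of
  vertices and every bit there is one coordinate: the sum, over the scales of the class, of the
  truncated distances to the boundaries of some clusters. A cluster \<open>C\<close> contributes only if
  \<open>\<bar>C\<bar> < 2 * q\<close> while its neighbourhood of radius \<open>6 * \<Delta>\<close> has at least \<open>q\<close> points. Two such
  neighbourhoods inside a contributing cluster of a larger scale in the same coordinate must meet; hence
  the smaller scales are active in that cluster only near a single place, around which its contribution
  is made constant. So the sum stays 1-Lipschitz, and a separation once achieved survives the larger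
  scales. Within one scale, clusters that are close to each other are told apart by the bit, chosen for
  \<open>q\<close> from large to small as the one that the smaller part (by mass) of the not yet separated
  neighbours has. This gives distortion \<open>2 * \<beta>\<close>.

  Re-weighting is only needed to see that \<open>\<beta> \<ge> 1\<close> as soon as some graph has two vertices.
\<close>

section \<open>Expected-cost rules for programs\<close>

text \<open>Two obstacles shape the construction. There may be far more scales than the dimension
  allows, so scales share coordinates, and a plain sum of truncated distances could there exceed the
  Lipschitz bound or cancel earlier separations. And both ends of a pair may lie deep inside their
  own clusters, where distances to the boundary alone do not tell them apart; a cluster can have
  many neighbours, so it gets a code word of logarithmically many bits. What is halved per bit is a
  number of points, because this ties the bit \<open>q\<close> to balls with \<open>q\<close>
  points. The constants: a scale \<Delta> serves distances \<open>t\<close> with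
  \<open>\<Delta> < t \<le> 3/2 * \<Delta>\<close> and separates by
  \<open>3/4 * (\<Delta> / \<beta>)\<close>, which is at least \<open>t / (2 * \<beta>)\<close>. In
  units of \<open>w = \<Delta> / (20 * \<beta>)\<close> the padding radius is 20; of these, 2 pay
  for vanishing near cluster boundaries, 2 for the flat stretch around active points and at most 1
  for the smaller scales, which leaves 15. The ratio \<open>560 * \<beta>\<close> is
  \<open>28 * (20 * \<beta>)\<close>: smaller scales stay below \<open>w / 28\<close>.\<close>

definition spmf_within :: "(val \<times> nat) spmf \<Rightarrow> (val \<Rightarrow> bool) \<Rightarrow> nat \<Rightarrow> bool" where
  "spmf_within M Q T \<longleftrightarrow> lossless_spmf M \<and> (\<forall>(v, s)\<in>set_spmf M. Q v) \<and>
     (\<integral>\<^sup>+(v, s). of_nat s \<partial>measure_spmf M) \<le> of_nat T"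

lemma computes_within_spmf: "computes_within p env Q T = spmf_within (run p env) Q T"
  by (simp add: computes_within_def spmf_within_def)

lemma spmf_within_return: "Q v \<Longrightarrow> s \<le> T \<Longrightarrow> spmf_within (return_spmf (v, s)) Q T"
  by (simp add: spmf_within_def measure_spmf_return_spmf nn_integral_return)

lemma spmf_within_mono: "spmf_within M Q T \<Longrightarrow> (\<And>v. Q v \<Longrightarrow> Q' v) \<Longrightarrow> T \<le> T' \<Longrightarrow> spmf_within M Q' T'"
  unfolding spmf_within_def by (fastforce intro: order_trans)

text \<open>The bound \<open>T2\<close> holds for every possible intermediate result and comes on
  top of the \<open>s\<close> steps already charged, so the expectations add however
  \<open>v\<close> and \<open>s\<close> depend on each other.\<close>

lemma spmf_within_bind:
  assumes M: "spmf_within M Q T1" and K: "\<And>v s. Q v \<Longrightarrow> spmf_within (K v s) R (s + T2)"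
  shows "spmf_within (bind_spmf M (\<lambda>(v, s). K v s)) R (T1 + T2)"
proof -
  have ll: "lossless_spmf (bind_spmf M (\<lambda>(v, s). K v s))"
    using M K by (auto simp: spmf_within_def)
  have sup: "\<forall>(v, s)\<in>set_spmf (bind_spmf M (\<lambda>(v, s). K v s)). R v"
    using M K by (fastforce simp: spmf_within_def set_bind_spmf)
  have "(\<integral>\<^sup>+(v, s). of_nat s \<partial>measure_spmf (bind_spmf M (\<lambda>(v, s). K v s)))
      = (\<integral>\<^sup>+x. (\<integral>\<^sup>+(v, s). of_nat s \<partial>measure_spmf (case x of (v, s) \<Rightarrow> K v s)) \<partial>measure_spmf M)"
    unfolding measure_spmf_bind
    by (subst nn_integral_bind[where B="count_space UNIV"]) (auto simp: o_def space_subprob_algebra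
        intro!: measurable_count_space)
  also have "\<dots> \<le> (\<integral>\<^sup>+x. (of_nat (snd x) + of_nat T2) \<partial>measure_spmf M)"
  proof (rule nn_integral_mono_AE)
    show "AE x in measure_spmf M. (\<integral>\<^sup>+(v, s). of_nat s \<partial>measure_spmf (case x of (v, s) \<Rightarrow> K v s)) \<le>
        of_nat (snd x) + (of_nat T2 :: ennreal)"
      unfolding AE_measure_spmf_iff using M K by (fastforce simp: spmf_within_def)
  qed
  also have "\<dots> = (\<integral>\<^sup>+(v, s). of_nat s \<partial>measure_spmf M) + of_nat T2 * emeasure (measure_spmf M) (space
      (measure_spmf M))"
    by (subst nn_integral_add) (simp_all add: case_prod_beta')
  also have "\<dots> \<le> of_nat T1 + of_nat T2 * 1"
    by (intro add_mono mult_left_mono) (use M in \<open>auto simp: spmf_within_def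
        measure_spmf.subprob_emeasure_le_1\<close>)
  finally show ?thesis using ll sup by (simp add: spmf_within_def)
qed

lemma spmf_within_bind_map:
  assumes M: "spmf_within M Q T1" and K: "\<And>v. Q v \<Longrightarrow> spmf_within (K v) (\<lambda>u. R (h v u)) T2"
  shows "spmf_within (bind_spmf M (\<lambda>(v, s1). map_spmf (\<lambda>(u, s2). (h v u, s1 + s2 + 1)) (K v))) R (T1 +
      (T2 + 1))"
proof (rule spmf_within_bind[OF M])
  fix v s assume "Q v"
  have "spmf_within (bind_spmf (K v) (\<lambda>(u, s2). return_spmf (h v u, s + s2 + 1))) R (T2 + (s + 1))"
    by (rule spmf_within_bind[OF K[OF \<open>Q v\<close>]]) (rule spmf_within_return, auto)
  then show "spmf_within (map_spmf (\<lambda>(u, s2). (h v u, s + s2 + 1)) (K v)) R (s + (T2 + 1))"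
    by (simp add: map_spmf_conv_bind_spmf case_prod_unfold add.commute add.left_commute)
qed

abbreviation cw where "cw \<equiv> computes_within"

lemma cw_mono: "cw p env Q T \<Longrightarrow> (\<And>v. Q v \<Longrightarrow> Q' v) \<Longrightarrow> T \<le> T' \<Longrightarrow> cw p env Q' T'"
  unfolding computes_within_spmf by (rule spmf_within_mono)

lemma cw_Var: "i < length env \<Longrightarrow> Q (env ! i) \<Longrightarrow> cw (Var i) env Q 1"
  unfolding computes_within_spmf by (simp add: spmf_within_return)

lemma cw_Const: "Q (Num r) \<Longrightarrow> cw (Const r) env Q 1"
  unfolding computes_within_spmf by (simp add: spmf_within_return)

lemma cw_Empty: "Q (Lst []) \<Longrightarrow> cw Empty env Q 1"
  unfolding computes_within_spmf by (simp add: spmf_within_return)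

lemma cw_Unary:
  assumes "cw p env (\<lambda>v. Q (apply_un f v)) T" shows "cw (Unary f p) env Q (T + 1)"
proof -
  have "spmf_within (bind_spmf (run p env) (\<lambda>(v, s). return_spmf (apply_un f v, s + 1))) Q (T + 1)"
    by (rule spmf_within_bind[OF assms[unfolded computes_within_spmf]]) (rule spmf_within_return, auto)
  then show ?thesis by (simp add: computes_within_spmf map_spmf_conv_bind_spmf case_prod_unfold)
qed

lemma cw_Binary:
  assumes "cw p env P T1" "\<And>v. P v \<Longrightarrow> cw q env (\<lambda>u. Q (apply_bin f v u)) T2"
  shows "cw (Binary f p q) env Q (T1 + T2 + 1)"
  using spmf_within_bind_map[where h="apply_bin f" and R=Q, OF assms[unfolded computes_within_spmf]]
  by (simp add: computes_within_spmf)

lemma cw_Cond: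
  assumes "cw c env P T1" "\<And>v. P v \<Longrightarrow> is_true v \<Longrightarrow> cw p env Q T2" "\<And>v. P v \<Longrightarrow> \<not> is_true v \<Longrightarrow> cw q env Q T2"
  shows "cw (Cond c p q) env Q (T1 + T2 + 1)"
proof -
  have "spmf_within (bind_spmf (run c env) (\<lambda>(v, s1). map_spmf (\<lambda>(u, s2). ((\<lambda>v u. u) v u, s1 + s2 + 1))
      (if is_true v then run p env else run q env))) Q (T1 + (T2 + 1))"
    by (rule spmf_within_bind_map[OF assms(1)[unfolded computes_within_spmf]]) (use assms(2,3) in \<open>auto
        simp: computes_within_spmf\<close>)
  then show ?thesis by (simp add: computes_within_spmf)
qed

lemma cw_Bind:
  assumes "cw p env P T1" "\<And>v. P v \<Longrightarrow> cw q (v # env) Q T2"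
  shows "cw (Bind p q) env Q (T1 + T2 + 1)"
proof -
  have "spmf_within (bind_spmf (run p env) (\<lambda>(v, s1). map_spmf (\<lambda>(u, s2). ((\<lambda>v u. u) v u, s1 + s2 + 1))
      (run q (v # env)))) Q (T1 + (T2 + 1))"
    by (rule spmf_within_bind_map[OF assms(1)[unfolded computes_within_spmf]]) (use assms(2) in \<open>auto
        simp: computes_within_spmf\<close>)
  then show ?thesis by (simp add: computes_within_spmf)
qed

text \<open>\<open>n\<close> counts the rounds still to come. The invariant fixes it in advance,
  whatever the coins yield, so the expected costs of the rounds just add up; the summand 1 in
  \<open>n + 1\<close> pays for the last guard, which fails.\<close>

lemma spmf_within_while_steps:
  assumes g: "\<And>n v. I n v \<Longrightarrow> spmf_within (g v) (\<lambda>c. is_true c \<longleftrightarrow> 0 < n) Tg"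
    and b: "\<And>n v. I (Suc n) v \<Longrightarrow> spmf_within (b v) (I n) Tb"
  shows "I n v \<Longrightarrow> spmf_within (while_steps g b v s) (I 0) (s + (n + 1) * (Tg + Tb + 1))"
proof (induction n arbitrary: v s)
  case 0
  have "spmf_within (while_steps g b v s) (I 0) (Tg + (s + 1))"
  proof (subst while_steps.simps, rule spmf_within_bind[OF g[OF 0]])
    fix c s1 assume "is_true c \<longleftrightarrow> 0 < (0::nat)"
    then show "spmf_within (if is_true c then bind_spmf (b v) (\<lambda>(v', s2). while_steps g b v' (s + s1 +
        s2 + 1))
      else return_spmf (v, s + s1 + 1)) (I 0) (s1 + (s + 1))"
      using 0 by (auto intro: spmf_within_return)
  qed
  then show ?case by (rule spmf_within_mono) auto
next
  case (Suc n)
  have "spmf_within (while_steps g b v s) (I 0) (Tg + (Tb + (s + 1 + (n + 1) * (Tg + Tb + 1))))"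
  proof (subst while_steps.simps, rule spmf_within_bind[OF g[OF Suc.prems]])
    fix c s1 assume c: "is_true c \<longleftrightarrow> 0 < Suc n"
    have "spmf_within (bind_spmf (b v) (\<lambda>(v', s2). while_steps g b v' (s + s1 + s2 + 1))) (I 0)
        (Tb + (s1 + s + 1 + (n + 1) * (Tg + Tb + 1)))"
    proof (rule spmf_within_bind[OF b[OF Suc.prems]])
      fix v' s2 assume "I n v'"
      from Suc.IH[OF this] show "spmf_within (while_steps g b v' (s + s1 + s2 + 1)) (I 0)
          (s2 + (s1 + s + 1 + (n + 1) * (Tg + Tb + 1)))"
        by (rule spmf_within_mono) auto
    qed
    then show "spmf_within (if is_true c then bind_spmf (b v) (\<lambda>(v', s2). while_steps g b v' (s + s1 +
        s2 + 1))
      else return_spmf (v, s + s1 + 1)) (I 0) (s1 + (Tb + (s + 1 + (n + 1) * (Tg + Tb + 1))))"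
      using c by (auto elim!: spmf_within_mono)
  qed
  then show ?case by (rule spmf_within_mono) (auto simp: algebra_simps)
qed

lemma cw_While:
  assumes "cw p env (I n) T" "\<And>n v. I n v \<Longrightarrow> cw g (v # env) (\<lambda>c. is_true c \<longleftrightarrow> 0 < n) Tg"
    "\<And>n v. I (Suc n) v \<Longrightarrow> cw b (v # env) (I n) Tb"
  shows "cw (While g b p) env (I 0) (T + (n + 1) * (Tg + Tb + 1))"
  unfolding computes_within_spmf run.simps
  by (rule spmf_within_bind[OF assms(1)[unfolded computes_within_spmf]])
     (rule spmf_within_while_steps[where I=I], use assms(2,3) in \<open>auto simp: computes_within_spmf\<close>)

text \<open>An index outside the environment gives \<open>Lst []\<close>, but in a longer
  environment the same index would hit a foreign value. Replacing such variables by
  \<open>Empty\<close>, of equal result and cost, lets a program run as a subroutine inside a larger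
  environment.\<close>

primrec close_prog :: "nat \<Rightarrow> prog \<Rightarrow> prog" where
  "close_prog k (Var i) = (if i < k then Var i else Empty)"
| "close_prog k (Const r) = Const r"
| "close_prog k Empty = Empty"
| "close_prog k Coin = Coin"
| "close_prog k (Unary f p) = Unary f (close_prog k p)"
| "close_prog k (Binary f p q) = Binary f (close_prog k p) (close_prog k q)"
| "close_prog k (Cond c p q) = Cond (close_prog k c) (close_prog k p) (close_prog k q)"
| "close_prog k (Bind p q) = Bind (close_prog k p) (close_prog (Suc k) q)"
| "close_prog k (While g b p) = While (close_prog (Suc k) g) (close_prog (Suc k) b) (close_prog k p)"

lemma run_close_prog: "length env = k \<Longrightarrow> run (close_prog k p) (env @ rest) = run p env"
proof (induction p arbitrary: k env)
  case (Bind p q)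
  then show ?case using Bind.IH(2)[of "_ # env" "Suc k"] by (auto intro!: bind_spmf_cong)
next
  case (While g b p)
  show ?case using While.IH(3)[OF While.prems] While.IH(1)[of "_ # env" "Suc k"] While.IH(2)[of "_ #
      env" "Suc k"] While.prems by simp
next
  case (Cond c p q)
  then show ?case by (auto intro!: bind_spmf_cong)
qed (auto simp: nth_append)

lemma cw_close: "cw p env Q T \<Longrightarrow> length env = k \<Longrightarrow> cw (close_prog k p) (env @ rest) Q T"
  by (simp add: computes_within_spmf run_close_prog)


section \<open>Functions computable in polynomial time\<close>

class enc = fixes enc :: "'a \<Rightarrow> val"

instantiation val :: enc begin
definition enc_val :: "val \<Rightarrow> val" where [simp]: "enc_val v = v"
instance ..
end

instantiation real :: enc begin
definition enc_real :: "real \<Rightarrow> val" where [simp]: "enc_real r = Num r"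
instance ..
end

instantiation nat :: enc begin
definition enc_nat :: "nat \<Rightarrow> val" where [simp]: "enc_nat n = Num (real n)"
instance ..
end

instantiation bool :: enc begin
definition enc_bool :: "bool \<Rightarrow> val" where [simp]: "enc_bool b = truth b"
instance ..
end

instantiation list :: (enc) enc begin
definition enc_list :: "'a list \<Rightarrow> val" where [simp]: "enc_list xs = Lst (map enc xs)"
instance ..
end

instantiation prod :: (enc, enc) enc begin
definition enc_prod :: "'a \<times> 'b \<Rightarrow> val" where [simp]: "enc_prod x = Lst [enc (fst x), enc (snd x)]"
instance ..
end

lemma is_true_truth [simp]: "is_true (truth b) \<longleftrightarrow> b"
  by (simp add: is_true_def truth_def)

text \<open>Every operation costs one step whatever the size of its arguments, so running times are governed by
  the lengths of the lists that occur in a value.\<close>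

primrec breadth :: "val \<Rightarrow> nat" where
  "breadth (Num r) = 0"
| "breadth (Lst vs) = fold max (map breadth vs) (length vs)"

lemma fold_max_le_iff: "fold max xs a \<le> (n::nat) \<longleftrightarrow> a \<le> n \<and> (\<forall>x\<in>set xs. x \<le> n)"
  by (induction xs arbitrary: a) auto

lemma breadth_Lst_le [simp]: "breadth (Lst vs) \<le> n \<longleftrightarrow> length vs \<le> n \<and> (\<forall>v\<in>set vs. breadth v \<le> n)"
  by (auto simp: fold_max_le_iff)

declare breadth.simps(2) [simp del]

lemma breadth_truth [simp]: "breadth (truth b) = 0"
  by (simp add: truth_def)

abbreviation br :: "'a::enc \<Rightarrow> nat" where "br x \<equiv> breadth (enc x)"

lemma br_le_list: "length xs \<le> br xs" "x \<in> set xs \<Longrightarrow> br x \<le> br xs"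
  using breadth_Lst_le[of "map enc xs" "br xs"] by auto

lemma br_list_le: "br xs \<le> n \<longleftrightarrow> length xs \<le> n \<and> (\<forall>x\<in>set xs. br x \<le> n)"
  by simp

lemma br_le_prod: "br (fst p) \<le> br p" "br (snd p) \<le> br p" "2 \<le> br p"
  using breadth_Lst_le[of "[enc (fst p), enc (snd p)]" "br p"] by auto

text \<open>The base is at least 2, so a larger exponent absorbs constants, sums and
  products.\<close>

definition polybd :: "('a::enc \<Rightarrow> nat) \<Rightarrow> bool" where
  "polybd g \<longleftrightarrow> (\<exists>c. \<forall>x. g x \<le> (br x + 2) ^ c)"

lemma pb_mono: "polybd g \<Longrightarrow> (\<And>x. f x \<le> g x) \<Longrightarrow> polybd f"
  unfolding polybd_def by (meson order_trans)

lemma pb_const: "polybd (\<lambda>_. k)"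
proof -
  have "k \<le> (n + 2) ^ k" for n
    by (rule order_trans[OF less_imp_le[OF less_exp] power_mono]) auto
  then show ?thesis unfolding polybd_def by blast
qed

lemma pb_br: "polybd br"
  unfolding polybd_def by (rule exI[of _ 1]) auto

lemma pb_mult:
  assumes "polybd f" "polybd g" shows "polybd (\<lambda>x. f x * g x)"
proof -
  obtain c d where "\<And>x. f x \<le> (br x + 2) ^ c" "\<And>x. g x \<le> (br x + 2) ^ d"
    using assms unfolding polybd_def by blast
  then have "f x * g x \<le> (br x + 2) ^ (c + d)" for x
    by (simp add: power_add mult_mono)
  then show ?thesis unfolding polybd_def by blast
qed

lemma pb_add:
  assumes "polybd f" "polybd g" shows "polybd (\<lambda>x. f x + g x)"
proof -
  obtain c d where c: "\<And>x. f x \<le> (br x + 2) ^ c" and d: "\<And>x. g x \<le> (br x + 2) ^ d"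
    using assms unfolding polybd_def by blast
  have "f x + g x \<le> (br x + 2) ^ (c + d + 1)" for x
  proof -
    have "f x \<le> (br x + 2) ^ (c + d)" "g x \<le> (br x + 2) ^ (c + d)"
      by (auto intro: order_trans[OF c] order_trans[OF d] power_increasing)
    then have "f x + g x \<le> 2 * (br x + 2) ^ (c + d)" by simp
    also have "\<dots> \<le> (br x + 2) * (br x + 2) ^ (c + d)" by (intro mult_right_mono) auto
    finally show ?thesis by simp
  qed
  then show ?thesis unfolding polybd_def by blast
qed

lemma pb_comp:
  assumes "polybd g" "polybd (\<lambda>x. br (f x))" shows "polybd (\<lambda>x. g (f x))"
proof -
  obtain c where c: "\<And>y. g y \<le> (br y + 2) ^ c" using assms unfolding polybd_def by blast
  obtain d where d: "\<And>x. br (f x) + 2 \<le> (br x + 2) ^ d"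
    using pb_add[OF assms(2) pb_const[of 2]] unfolding polybd_def by blast
  have "g (f x) \<le> (br x + 2) ^ (d * c)" for x
    unfolding power_mult by (rule order_trans[OF c power_mono[OF d]]) simp
  then show ?thesis unfolding polybd_def by blast
qed

lemmas pb_intros = pb_const pb_br pb_add pb_mult

text \<open>The size of the result is bounded along with the running time: in a composition the
  second program is charged in terms of the output of the first.\<close>

definition ptime :: "('a::enc \<Rightarrow> 'b::enc) \<Rightarrow> bool" where
  "ptime f \<longleftrightarrow> polybd (\<lambda>x. br (f x)) \<and>
     (\<exists>p T. polybd T \<and> (\<forall>x. computes_within p [enc x] (\<lambda>v. v = enc (f x)) (T x)))"

lemma pcI: "polybd (\<lambda>x. br (f x)) \<Longrightarrow> polybd T \<Longrightarrow> (\<And>x. cw p [enc x] (\<lambda>v. v = enc (f x)) (T x)) \<Longrightarrow> ptime f"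
  unfolding ptime_def by blast

lemma pcE:
  assumes "ptime f"
  obtains p T where "polybd (\<lambda>x. br (f x))" "polybd T" "\<And>x. cw p [enc x] (\<lambda>v. v = enc (f x)) (T x)"
  using assms unfolding ptime_def by blast

lemma pc_pb: "ptime f \<Longrightarrow> polybd (\<lambda>x. br (f x))" by (simp add: ptime_def)

lemma cw_Var': "i < length env \<Longrightarrow> cw (Var i) env (\<lambda>v. v = env ! i) 1"
  by (rule cw_Var) auto

lemma cw_Unary': "cw p env (\<lambda>v. v = a) T \<Longrightarrow> cw (Unary f p) env (\<lambda>v. v = apply_un f a) (T + 1)"
  by (rule cw_Unary) (erule cw_mono, auto)

lemma cw_Binary': "cw p env (\<lambda>v. v = a) T1 \<Longrightarrow> cw q env (\<lambda>v. v = b) T2 \<Longrightarrow>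
    cw (Binary f p q) env (\<lambda>v. v = apply_bin f a b) (T1 + T2 + 1)"
  by (rule cw_Binary, assumption) (erule cw_mono, auto)

lemma cw_Binary_right: "cw p env (\<lambda>v. v = a) T1 \<Longrightarrow> cw q env Q T2 \<Longrightarrow>
    (\<And>b. Q b \<Longrightarrow> R (apply_bin f a b)) \<Longrightarrow> cw (Binary f p q) env R (T1 + T2 + 1)"
  by (rule cw_Binary, assumption) (erule cw_mono, auto)

lemma pc_id: "ptime (\<lambda>x. x)"
  by (rule pcI[OF pb_br pb_const, where p="Var 0"]) (rule cw_Var, auto)

lemma ex_const_prog: "\<exists>p T. \<forall>env. cw p env (\<lambda>u. u = v) T"
proof (induction v)
  case (Num r)
  show ?case by (intro exI[of _ "Const r"] exI[of _ 1] allI cw_Const refl)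
next
  case (Lst vs)
  then show ?case
  proof (induction vs)
    case Nil
    show ?case by (intro exI[of _ Empty] exI[of _ 1] allI cw_Empty refl)
  next
    case (Cons v vs)
    then obtain p T q T' where "\<And>env. cw p env (\<lambda>u. u = v) T" "\<And>env. cw q env (\<lambda>u. u = Lst vs) T'"
      by (metis list.set_intros(1,2))
    then have "cw (Binary Prepend p q) env (\<lambda>u. u = Lst (v # vs)) (T + T' + 1)" for env
      using cw_Binary'[of p env v T q "Lst vs" T' Prepend] by simp
    then show ?case by blast
  qed
qed

lemma pc_const: "ptime (\<lambda>_. k)"
proof -
  obtain p T where "\<And>env. cw p env (\<lambda>u. u = enc k) T" using ex_const_prog by blast
  then show ?thesis by (intro pcI[OF pb_const pb_const])
qed

lemma pc_comp:
  assumes "ptime g" "ptime f" shows "ptime (\<lambda>x. g (f x))"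
proof -
  obtain q T' where g: "polybd (\<lambda>x. br (g x))" "polybd T'" "\<And>x. cw q [enc x] (\<lambda>v. v = enc (g x)) (T' x)"
    using pcE[OF assms(1)] by metis
  obtain p T where f: "polybd (\<lambda>x. br (f x))" "polybd T" "\<And>x. cw p [enc x] (\<lambda>v. v = enc (f x)) (T x)"
    using pcE[OF assms(2)] by metis
  show ?thesis
  proof (rule pcI)
    show "cw (Bind p (close_prog 1 q)) [enc x] (\<lambda>v. v = enc (g (f x))) (T x + T' (f x) + 1)" for x
      by (rule cw_Bind[OF f(3)]) (use cw_close[OF g(3), of "f x" 1 "[enc x]"] in auto)
  qed (intro pb_intros pb_comp[OF g(1) f(1)] pb_comp[OF g(2) f(1)] f(2))+
qed

text \<open>Forgetting the type does not affect computability, so components of different types fit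
  into one list of raw values; pairs and loop states are built this way.\<close>

lemma pc_enc: "ptime (\<lambda>x. enc (f x)) = ptime f"
  by (simp add: ptime_def)

lemma pc_un:
  assumes "ptime f" "\<And>x. enc (h x) = apply_un u (enc (f x))" "polybd (\<lambda>x. br (h x))" shows "ptime h"
proof -
  obtain p T where f: "polybd T" "\<And>x. cw p [enc x] (\<lambda>v. v = enc (f x)) (T x)" using pcE[OF assms(1)] by
      metis
  show ?thesis
    by (rule pcI[OF assms(3), where T="\<lambda>x. T x + 1"], intro pb_intros f(1), subst assms(2), rule
        cw_Unary'[OF f(2)])
qed

lemma pc_bin:
  assumes "ptime f" "ptime g" "\<And>x. enc (h x) = apply_bin u (enc (f x)) (enc (g x))" "polybd (\<lambda>x. br (h
      x))" shows "ptime h"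
proof -
  obtain p T where f: "polybd T" "\<And>x. cw p [enc x] (\<lambda>v. v = enc (f x)) (T x)" using pcE[OF assms(1)] by
      metis
  obtain q T' where g: "polybd T'" "\<And>x. cw q [enc x] (\<lambda>v. v = enc (g x)) (T' x)" using pcE[OF assms(2)]
      by metis
  show ?thesis
    by (rule pcI[OF assms(4), where T="\<lambda>x. T x + T' x + 1"], intro pb_intros f(1) g(1),
        subst assms(3), rule cw_Binary'[OF f(2) g(2)])
qed

lemma pc_if:
  assumes "ptime b" "ptime f" "ptime g" shows "ptime (\<lambda>x. if b x then f x else g x)"
proof -
  obtain p0 T0 where b: "polybd T0" "\<And>x. cw p0 [enc x] (\<lambda>v. v = enc (b x)) (T0 x)" using pcE[OF
      assms(1)] by metis
  obtain p T where f: "polybd T" "\<And>x. cw p [enc x] (\<lambda>v. v = enc (f x)) (T x)" using pcE[OF assms(2)] by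
      metis
  obtain q T' where g: "polybd T'" "\<And>x. cw q [enc x] (\<lambda>v. v = enc (g x)) (T' x)" using pcE[OF assms(3)]
      by metis
  show ?thesis
  proof (rule pcI)
    show "cw (Cond p0 p q) [enc x] (\<lambda>v. v = enc (if b x then f x else g x)) (T0 x + (T x + T' x) + (T x
        + T' x) + 1)" for x
      by (rule cw_mono[OF cw_Cond[OF b(2), of _ _ _ "T x + T' x"]]) (auto intro: cw_mono[OF f(2)]
      cw_mono[OF g(2)])
    show "polybd (\<lambda>x. br (if b x then f x else g x))"
      by (rule pb_mono[OF pb_add[OF pc_pb[OF assms(2)] pc_pb[OF assms(3)]]]) auto
  qed (intro pb_intros b f g)
qed

lemma pb_fst: "polybd (\<lambda>x. br (f x)) \<Longrightarrow> polybd (\<lambda>x. br (fst (f x)))"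
  and pb_snd: "polybd (\<lambda>x. br (f x)) \<Longrightarrow> polybd (\<lambda>x. br (snd (f x)))"
  by (erule pb_mono, rule br_le_prod)+

lemma pb_Cons: "polybd (\<lambda>x. br (f x)) \<Longrightarrow> polybd (\<lambda>x. br (g x)) \<Longrightarrow> polybd (\<lambda>x. br (f x # g x))"
proof (rule pb_mono[OF pb_add[OF pb_add[of "\<lambda>x. br (f x)" "\<lambda>x. br (g x)"] pb_const[of 1]]])
  show "br (f x # g x) \<le> br (f x) + br (g x) + 1" for x
    unfolding br_list_le using br_le_list(1)[of "g x"] br_le_list(2)[of _ "g x"] by (auto intro:
        trans_le_add2 le_SucI simp del: enc_list_def)
qed

lemma pc_fst: "ptime f \<Longrightarrow> ptime (\<lambda>x. fst (f x))"
  by (rule pc_un[where u=Head]) (assumption, simp, intro pb_fst pc_pb)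

lemma pc_snd:
  assumes "ptime f" shows "ptime (\<lambda>x. snd (f x))"
proof -
  have "ptime (\<lambda>x. Lst [enc (snd (f x))])"
    by (rule pc_un[OF assms, where u=Tail], simp)
       (rule pb_mono[OF pb_add[OF pb_snd[OF pc_pb[OF assms]] pb_const[of 1]]], auto)
  then show ?thesis by (rule pc_un[where u=Head]) (simp, intro pb_snd pc_pb assms)
qed

lemma pc_Cons: "ptime f \<Longrightarrow> ptime g \<Longrightarrow> ptime (\<lambda>x. f x # g x)"
  by (rule pc_bin[where u=Prepend and f=f and g=g]) (assumption, assumption, simp, intro pb_Cons pc_pb)

lemma pc_Pair:
  assumes "ptime f" "ptime g" shows "ptime (\<lambda>x. (f x, g x))"
proof -
  have "ptime (\<lambda>x. [enc (f x), enc (g x)])"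
    using pc_enc[THEN iffD2, OF assms(1)] pc_enc[THEN iffD2, OF assms(2)] by (intro pc_Cons pc_const)
  then have "ptime (\<lambda>x. enc [enc (f x), enc (g x)])" unfolding pc_enc .
  moreover have "(\<lambda>x. enc [enc (f x), enc (g x)]) = (\<lambda>x. enc (f x, g x))" by auto
  ultimately show ?thesis by (simp only: pc_enc)
qed

lemma pc_tl: "ptime f \<Longrightarrow> ptime (\<lambda>x. tl (f x))"
proof (rule pc_un[where u=Tail])
  show "enc (tl (f x)) = apply_un Tail (enc (f x))" for x by (cases "f x") auto
  assume "ptime f"
  then show "polybd (\<lambda>x. br (tl (f x)))"
  proof (rule pb_mono[OF pc_pb])
    show "br (tl (f x)) \<le> br (f x)" for x
      unfolding br_list_le using br_le_list(1)[of "f x"] br_le_list(2)[of _ "f x"]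
      by (cases "f x") (auto simp del: enc_list_def)
  qed
qed auto

definition isnil :: "'a list \<Rightarrow> bool" where "isnil xs \<longleftrightarrow> xs = []"

text \<open>\<open>Head\<close> of an empty list gives \<open>Lst []\<close>, which need not encode
  a value of the element type; the explicit default repairs this.\<close>

definition hd_or :: "'a \<Rightarrow> 'a list \<Rightarrow> 'a" where "hd_or a xs = (case xs of [] \<Rightarrow> a | y # ys \<Rightarrow> y)"

lemma pc_Not: assumes "ptime b" shows "ptime (\<lambda>x. \<not> b x)"
proof -
  have "ptime (\<lambda>x. if b x then False else True)" by (intro pc_if assms pc_const)
  moreover have "(\<lambda>x. if b x then False else True) = (\<lambda>x. \<not> b x)" by auto
  ultimately show ?thesis by simp
qed

lemma pc_conj: assumes "ptime b" "ptime c" shows "ptime (\<lambda>x. b x \<and> c x)"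
proof -
  have "ptime (\<lambda>x. if b x then c x else False)" by (intro pc_if assms pc_const)
  moreover have "(\<lambda>x. if b x then c x else False) = (\<lambda>x. b x \<and> c x)" by auto
  ultimately show ?thesis by simp
qed

lemma pc_disj: "ptime b \<Longrightarrow> ptime c \<Longrightarrow> ptime (\<lambda>x. b x \<or> c x)"
  using pc_Not[OF pc_conj[OF pc_Not pc_Not], of b c] by simp

lemma pc_eq_bool: "ptime b \<Longrightarrow> ptime c \<Longrightarrow> ptime (\<lambda>x. b x = (c x :: bool))"
proof -
  assume "ptime b" "ptime c"
  then have "ptime (\<lambda>x. if b x then c x else \<not> c x)" by (intro pc_if pc_Not)
  moreover have "(\<lambda>x. if b x then c x else \<not> c x) = (\<lambda>x. b x = c x)" by auto
  ultimately show ?thesis by simp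
qed

lemma pc_isnil: "ptime f \<Longrightarrow> ptime (\<lambda>x. isnil (f x))"
proof -
  assume "ptime f"
  then have "ptime (\<lambda>x. \<not> isnil (f x))"
  proof (rule pc_un[where u=IsCons])
    show "enc (\<not> isnil (f x)) = apply_un IsCons (enc (f x))" for x
      by (cases "f x") (auto simp: isnil_def)
  qed (simp add: pb_const)
  from pc_Not[OF this] show ?thesis by simp
qed

lemma pc_hd_or:
  assumes "ptime a" "ptime f" shows "ptime (\<lambda>x. hd_or (a x) (f x))"
proof -
  obtain p T where a: "polybd T" "\<And>x. cw p [enc x] (\<lambda>v. v = enc (a x)) (T x)" using pcE[OF assms(1)] by
      metis
  obtain q T' where f: "polybd T'" "\<And>x. cw q [enc x] (\<lambda>v. v = enc (f x)) (T' x)" using pcE[OF assms(2)]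
      by metis
  obtain p0 T0 where b: "polybd T0" "\<And>x. cw p0 [enc x] (\<lambda>v. v = enc (isnil (f x))) (T0 x)"
    using pcE[OF pc_isnil[OF assms(2)]] by metis
  show ?thesis
  proof (rule pcI)
    show "cw (Cond p0 p (Unary Head q)) [enc x] (\<lambda>v. v = enc (hd_or (a x) (f x))) (T0 x + (T x + T' x +
        1) + (T x + T' x + 1) + 1)" for x
      by (rule cw_mono[OF cw_Cond[OF b(2), of _ _ _ "T x + T' x + 1"]])
         (auto intro: cw_mono[OF a(2)] cw_mono[OF cw_Unary'[OF f(2)]] simp: isnil_def hd_or_def split:
         list.splits)
    show "polybd (\<lambda>x. br (hd_or (a x) (f x)))"
    proof (rule pb_mono[OF pb_add[OF pc_pb[OF assms(1)] pc_pb[OF assms(2)]]])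
      show "br (hd_or (a x) (f x)) \<le> br (a x) + br (f x)" for x
        using br_le_list(2)[of "hd (f x)" "f x"] by (cases "f x") (auto simp: hd_or_def)
    qed
  qed (intro pb_intros a f b)
qed

lemma pc_real_bin:
  fixes f g :: "'a::enc \<Rightarrow> real"
  assumes "ptime f" "ptime g"
  shows pc_add_real: "ptime (\<lambda>x. f x + g x)" and pc_diff_real: "ptime (\<lambda>x. f x - g x)"
    and pc_mult_real: "ptime (\<lambda>x. f x * g x)" and pc_divide_real: "ptime (\<lambda>x. f x / g x)"
    and pc_less_real: "ptime (\<lambda>x. f x < g x)" and pc_le_real: "ptime (\<lambda>x. f x \<le> g x)"
    and pc_min: "ptime (\<lambda>x. min (f x) (g x))" and pc_max: "ptime (\<lambda>x. max (f x) (g x))"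
proof -
  show "ptime (\<lambda>x. f x + g x)" by (rule pc_bin[OF assms, where u=Add]) (auto intro: pb_const)
  show "ptime (\<lambda>x. f x - g x)" by (rule pc_bin[OF assms, where u=Sub]) (auto intro: pb_const)
  show "ptime (\<lambda>x. f x * g x)" by (rule pc_bin[OF assms, where u=Mul]) (auto intro: pb_const)
  show "ptime (\<lambda>x. f x / g x)" by (rule pc_bin[OF assms, where u=Div]) (auto intro: pb_const)
  show "ptime (\<lambda>x. f x < g x)" by (rule pc_bin[OF assms, where u=Less]) (auto intro: pb_const)
  have "ptime (\<lambda>x. \<not> (g x < f x))"
    by (rule pc_Not, rule pc_bin[OF assms(2,1), where u=Less]) (auto intro: pb_const)
  then show *: "ptime (\<lambda>x. f x \<le> g x)" by (simp add: not_less)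
  show "ptime (\<lambda>x. min (f x) (g x))" "ptime (\<lambda>x. max (f x) (g x))"
    unfolding min_def max_def by (intro pc_if * assms)+
qed

lemma pc_of_nat: "ptime f \<Longrightarrow> ptime (\<lambda>x. real (f x))"
  by (simp add: ptime_def)

lemma pc_nat_bin:
  fixes f g :: "'a::enc \<Rightarrow> nat"
  assumes "ptime f" "ptime g"
  shows pc_add_nat: "ptime (\<lambda>x. f x + g x)" and pc_mult_nat: "ptime (\<lambda>x. f x * g x)"
    and pc_less_nat: "ptime (\<lambda>x. f x < g x)" and pc_le_nat: "ptime (\<lambda>x. f x \<le> g x)" and pc_eq_nat:
        "ptime (\<lambda>x. f x = g x)"
proof -
  show "ptime (\<lambda>x. f x + g x)" by (rule pc_bin[OF assms, where u=Add]) (auto intro: pb_const)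
  show "ptime (\<lambda>x. f x * g x)" by (rule pc_bin[OF assms, where u=Mul]) (auto intro: pb_const)
  show "ptime (\<lambda>x. f x < g x)" using pc_less_real[OF assms[THEN pc_of_nat]] by simp
  show le: "ptime (\<lambda>x. f x \<le> g x)" using pc_le_real[OF assms[THEN pc_of_nat]] by simp
  have "ptime (\<lambda>x. g x \<le> f x)" using pc_le_real[OF assms(2,1)[THEN pc_of_nat]] by simp
  from pc_conj[OF le this] show "ptime (\<lambda>x. f x = g x)" by (simp add: eq_iff)
qed

section \<open>Loops over lists\<close>

definition loop_prog :: "prog \<Rightarrow> prog \<Rightarrow> prog" where
  "loop_prog body init = Unary Head (Unary Tail
     (While (Unary IsCons (Unary Head (Var 0)))
       (Binary Prepend (Unary Tail (Unary Head (Var 0)))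
         (Binary Prepend
           (Bind (Binary Prepend (Unary Head (Unary Tail (Unary Tail (Var 0))))
                   (Binary Prepend
                     (Binary Prepend (Unary Head (Unary Tail (Var 0)))
                       (Binary Prepend (Unary Head (Unary Head (Var 0))) Empty)) Empty))
             (close_prog 1 body))
           (Binary Prepend (Unary Head (Unary Tail (Unary Tail (Var 0)))) Empty)))
       init))"

text \<open>The loop state consists of the remaining items, the accumulator and a fixed context
  \<open>X\<close>. The invariant is a predicate and not an equation because the same loop later
  runs the cover program, whose result depends on coin flips.\<close>

lemma cw_loop:
  assumes init: "cw init env (\<lambda>v. v = Lst [Lst xs, a0, X]) T0" and "J 0 a0"
    and body: "\<And>k a. k < length xs \<Longrightarrow> J k a \<Longrightarrow> cw body [Lst [X, Lst [a, xs ! k]]] (J (Suc k)) Tb"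
  shows "cw (loop_prog body init) env (J (length xs)) (T0 + (length xs + 1) * (Tb + 50) + 2)"
proof -
  define I where "I = (\<lambda>n v. n \<le> length xs \<and> (\<exists>a. v = Lst [Lst (drop (length xs - n) xs), a, X] \<and> J
      (length xs - n) a))"
  let ?b = "Binary Prepend (Unary Tail (Unary Head (Var 0)))
         (Binary Prepend
           (Bind (Binary Prepend (Unary Head (Unary Tail (Unary Tail (Var 0))))
                   (Binary Prepend
                     (Binary Prepend (Unary Head (Unary Tail (Var 0)))
                       (Binary Prepend (Unary Head (Unary Head (Var 0))) Empty)) Empty))
             (close_prog 1 body))
           (Binary Prepend (Unary Head (Unary Tail (Unary Tail (Var 0)))) Empty))"
  have "cw (While (Unary IsCons (Unary Head (Var 0))) ?b init) env (I 0)
      (T0 + (length xs + 1) * (3 + (Tb + 46) + 1))"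
  proof (rule cw_While[where I=I])
    show "cw init env (I (length xs)) T0"
      by (rule cw_mono[OF init]) (use \<open>J 0 a0\<close> in \<open>auto simp: I_def\<close>)
    show "cw (Unary IsCons (Unary Head (Var 0))) (v # env) (\<lambda>c. is_true c = (0 < n)) 3" if "I n v" for n v
    proof (rule cw_mono[OF cw_Unary'[OF cw_Unary'[OF cw_Var']]])
      obtain a where v: "v = Lst [Lst (drop (length xs - n) xs), a, X]" and n: "n \<le> length xs"
        using \<open>I n v\<close> by (auto simp: I_def)
      have "drop (length xs - n) xs = [] \<longleftrightarrow> n = 0" using n by auto
      then show "is_true c = (0 < n)" if "c = apply_un IsCons (apply_un Head ((v # env) ! 0))" for c
        using that by (cases "drop (length xs - n) xs") (auto simp: v)
    qed auto
    fix n v assume I: "I (Suc n) v"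
    define k where "k = length xs - Suc n"
    obtain a where v: "v = Lst [Lst (drop k xs), a, X]" and k: "k < length xs" "length xs - n = Suc k"
        "J k a"
      using I by (auto simp: I_def k_def)
    have d: "drop k xs = xs ! k # drop (Suc k) xs" using k by (simp add: Cons_nth_drop_Suc)
    show "cw ?b (v # env) (I n) (Tb + 46)"
    proof -
      have 1: "cw (Binary Prepend (Unary Head (Unary Tail (Unary Tail (Var 0))))
                   (Binary Prepend
                     (Binary Prepend (Unary Head (Unary Tail (Var 0)))
                       (Binary Prepend (Unary Head (Unary Head (Var 0))) Empty)) Empty)) (v # env)
          (\<lambda>u. u = Lst [X, Lst [a, xs ! k]]) 20"
        by (rule cw_mono[OF cw_Binary'[OF cw_Unary'[OF cw_Unary'[OF cw_Unary'[OF cw_Var']]]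
           cw_Binary'[OF cw_Binary'[OF cw_Unary'[OF cw_Unary'[OF cw_Var']]
             cw_Binary'[OF cw_Unary'[OF cw_Unary'[OF cw_Var']] cw_Empty]] cw_Empty]]]) (auto simp: v d)
      have 2: "cw (close_prog 1 body) (u # v # env) (J (Suc k)) Tb" if "u = Lst [X, Lst [a, xs ! k]]" for u
        using cw_close[OF body[OF k(1,3)], of 1 "v # env"] that by simp
      have 3: "cw (Binary Prepend (Unary Head (Unary Tail (Unary Tail (Var 0)))) Empty) (v # env)
         (\<lambda>u. apply_bin Prepend w u = Lst [w, X]) 6" for w
        by (rule cw_mono[OF cw_Binary'[OF cw_Unary'[OF cw_Unary'[OF cw_Unary'[OF cw_Var']]] cw_Empty]])
           (auto simp: v)
      have 4: "cw (Binary Prepend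
           (Bind (Binary Prepend (Unary Head (Unary Tail (Unary Tail (Var 0))))
                   (Binary Prepend
                     (Binary Prepend (Unary Head (Unary Tail (Var 0)))
                       (Binary Prepend (Unary Head (Unary Head (Var 0))) Empty)) Empty))
             (close_prog 1 body))
           (Binary Prepend (Unary Head (Unary Tail (Unary Tail (Var 0)))) Empty)) (v # env)
          (\<lambda>u. \<exists>w. J (Suc k) w \<and> u = Lst [w, X]) (20 + Tb + 1 + 6 + 1)"
        by (rule cw_Binary[OF cw_Bind[OF 1 2]], assumption) (rule cw_mono[OF 3], auto)
      show ?thesis
        by (rule cw_mono[OF cw_Binary_right[OF cw_Unary'[OF cw_Unary'[OF cw_Var']] 4, where
              R="\<lambda>u. \<exists>w. J (Suc k) w \<and> u = Lst [Lst (drop (Suc k) xs), w, X]"]])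
           (use k in \<open>auto simp: v d I_def\<close>)
    qed
  qed
  then have "cw (While (Unary IsCons (Unary Head (Var 0))) ?b init) env
      (\<lambda>v. J (length xs) (apply_un Head (apply_un Tail v))) (T0 + (length xs + 1) * (Tb + 50))"
    by (rule cw_mono) (auto simp: I_def)
  from cw_Unary[OF cw_Unary[OF this]] show ?thesis unfolding loop_prog_def by (rule cw_mono) auto
qed


lemma pb_power: "polybd g \<Longrightarrow> polybd (\<lambda>x. g x ^ c)"
  by (induction c) (auto intro: pb_const pb_mult simp: pb_const[of 1, simplified])

text \<open>Trades a bound in terms of an argument for one in terms of any number that dominates its
  breadth. Such a bound can be applied to arguments of another type, such as loop states.\<close>

lemma pb_pairE:
  assumes "polybd T"
  obtains T' where "\<And>R. polybd R \<Longrightarrow> polybd (\<lambda>x. T' (R x))" "\<And>n x. br x \<le> n \<Longrightarrow> T x \<le> T' n"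
proof -
  obtain c where c: "\<And>x. T x \<le> (br x + 2) ^ c" using assms unfolding polybd_def by blast
  show thesis
  proof (rule that[of "\<lambda>n. (n + 2) ^ c"])
    show "polybd (\<lambda>x. (R x + 2) ^ c)" if "polybd R" for R :: "'b::enc \<Rightarrow> nat"
      by (intro pb_power pb_add that pb_const)
    show "T x \<le> (n + 2) ^ c" if "br x \<le> n" for n x
      by (rule order_trans[OF c power_mono]) (use that in auto)
  qed
qed

lemma pb_elem:
  assumes "polybd (\<lambda>z. h (fst z) (snd z))" "polybd (\<lambda>x. br (xs x))"
  obtains B where "polybd B" "\<And>x i. i \<in> set (xs x) \<Longrightarrow> h x i \<le> B x"
proof -
  obtain T' where T': "\<And>R::'a\<Rightarrow>nat. polybd R \<Longrightarrow> polybd (\<lambda>x. T' (R x))" "\<And>n z. br z \<le> n \<Longrightarrow> h (fst z) (snd z)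
      \<le> T' n"
    using pb_pairE[OF assms(1)] by metis
  show thesis
  proof (rule that)
    show "polybd (\<lambda>x. T' (br x + br (xs x) + 2))" by (intro T' pb_intros assms)
    show "h x i \<le> T' (br x + br (xs x) + 2)" if "i \<in> set (xs x)" for x i
      using T'(2)[of "(x, i)" "br x + br (xs x) + 2"] br_le_list(2)[OF that] by (auto simp del:
      enc_list_def)
  qed
qed

text \<open>Iterating a polynomial time step may square the size in every round, so the breadth of
  all intermediate accumulators is bounded separately, by \<open>B\<close>.\<close>

lemma pc_foldl:
  fixes F :: "'a::enc \<Rightarrow> 'b::enc \<Rightarrow> 'c::enc \<Rightarrow> 'b"
  assumes xs: "ptime xs" and a0: "ptime a0" and F: "ptime (\<lambda>z. F (fst z) (fst (snd z)) (snd (snd z)))"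
    and B: "polybd B" "\<And>x k. k \<le> length (xs x) \<Longrightarrow> br (foldl (F x) (a0 x) (take k (xs x))) \<le> B x"
  shows "ptime (\<lambda>x. foldl (F x) (a0 x) (xs x))"
proof -
  obtain q T where q: "polybd T" "\<And>z. cw q [enc z] (\<lambda>v. v = enc (F (fst z) (fst (snd z)) (snd (snd z))))
      (T z)"
    using pcE[OF F] by metis
  obtain T' where T': "\<And>R::'a\<Rightarrow>nat. polybd R \<Longrightarrow> polybd (\<lambda>x. T' (R x))" "\<And>n z. br z \<le> n \<Longrightarrow> T z \<le> T' n"
    using pb_pairE[OF q(1)] by metis
  have "ptime (\<lambda>x. [enc (xs x), enc (a0 x), enc x])"
    using pc_enc[THEN iffD2, OF xs] pc_enc[THEN iffD2, OF a0] pc_enc[THEN iffD2, OF pc_id]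
    by (intro pc_Cons pc_const)
  then obtain p T0 where p: "polybd T0" "\<And>x. cw p [enc x] (\<lambda>v. v = Lst [Lst (map enc (xs x)), enc (a0
      x), enc x]) (T0 x)"
    by (rule pcE) auto
  define R where "R = (\<lambda>x. br x + B x + br (xs x) + 2)"
  show ?thesis
  proof (rule pcI)
    show "polybd (\<lambda>x. br (foldl (F x) (a0 x) (xs x)))"
      by (rule pb_mono[OF B(1)]) (use B(2)[of "length (xs x)" x for x] in simp)
    show "polybd (\<lambda>x. T0 x + (br (xs x) + 1) * (T' (R x) + 50) + 2)"
      unfolding R_def by (intro pb_intros p T' B pc_pb[OF xs])
    fix x
    define J where "J = (\<lambda>k v. v = enc (foldl (F x) (a0 x) (take k (xs x))))"
    have "cw (loop_prog q p) [enc x] (J (length (map enc (xs x)))) (T0 x + (length (map enc (xs x)) + 1)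
        * (T' (R x) + 50) + 2)"
    proof (rule cw_loop[OF p(2)])
      show "J 0 (enc (a0 x))" by (simp add: J_def)
      fix k a assume k: "k < length (map enc (xs x))" and J: "J k a"
      let ?a = "foldl (F x) (a0 x) (take k (xs x))"
      have "br (x, ?a, xs x ! k) \<le> R x"
        using B(2)[of k x] k br_le_list(2)[of "xs x ! k" "xs x"] by (auto simp: R_def simp del:
        enc_list_def)
      then show "cw q [Lst [enc x, Lst [a, map enc (xs x) ! k]]] (J (Suc k)) (T' (R x))"
        using cw_mono[OF q(2)[of "(x, ?a, xs x ! k)"], of "J (Suc k)" "T' (R x)"] T'(2)[of "(x, ?a, xs x
        ! k)" "R x"] J k
        by (simp add: J_def take_Suc_conv_app_nth)
    qed
    then show "cw (loop_prog q p) [enc x] (\<lambda>v. v = enc (foldl (F x) (a0 x) (xs x))) (T0 x + (br (xs x) +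
        1) * (T' (R x) + 50) + 2)"
      by (rule cw_mono) (auto simp: J_def br_le_list(1)[of "xs x", simplified])
  qed
qed

lemma pc_rev: assumes "ptime xs" shows "ptime (\<lambda>x. rev (xs x))"
proof -
  have "foldl (\<lambda>a i. i # a) ys zs = rev zs @ ys" for ys zs :: "'b list"
    by (induction zs arbitrary: ys) auto
  then have *: "rev zs = foldl (\<lambda>a i. i # a) [] zs" for zs :: "'b list" by simp
  show ?thesis unfolding *
  proof (rule pc_foldl[OF assms pc_const _ pc_pb[OF assms]])
    show "ptime (\<lambda>z. snd (snd z) # fst (snd z))" by (intro pc_Cons pc_fst pc_snd pc_id)
    show "br (foldl (\<lambda>a i. i # a) [] (take k (xs x))) \<le> br (xs x)" for x k
      unfolding *[symmetric] br_list_le using br_le_list(1)[of "xs x"] br_le_list(2)[of _ "xs x"]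
      by (auto dest: in_set_takeD simp del: enc_list_def)
  qed
qed

lemma pc_foldr:
  fixes F :: "'a::enc \<Rightarrow> 'c::enc \<Rightarrow> 'b::enc \<Rightarrow> 'b"
  assumes "ptime xs" "ptime a0" "ptime (\<lambda>z. F (fst z) (fst (snd z)) (snd (snd z)))"
    "polybd B" "\<And>x k. k \<le> length (xs x) \<Longrightarrow> br (foldr (F x) (drop k (xs x)) (a0 x)) \<le> B x"
  shows "ptime (\<lambda>x. foldr (F x) (xs x) (a0 x))"
  unfolding foldr_conv_foldl
proof (rule pc_foldl[OF pc_rev[OF assms(1)] assms(2) _ assms(4)])
  show "ptime (\<lambda>z. F (fst z) (snd (snd z)) (fst (snd z)))"
    using pc_comp[OF assms(3), of "\<lambda>z. (fst z, snd (snd z), fst (snd z))"]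
    by (simp add: pc_Pair pc_fst pc_snd pc_id)
  show "br (foldl (\<lambda>a b. F x b a) (a0 x) (take k (rev (xs x)))) \<le> B x" if "k \<le> length (rev (xs x))" for x k
    using assms(5)[of "length (xs x) - k" x] that by (simp add: take_rev foldr_conv_foldl)
qed

lemma pc_map:
  assumes xs: "ptime xs" and F: "ptime (\<lambda>z. F (fst z) (snd z))" shows "ptime (\<lambda>x. map (F x) (xs x))"
proof -
  obtain B where B: "polybd B" "\<And>x i. i \<in> set (xs x) \<Longrightarrow> br (F x i) \<le> B x"
    using pb_elem[OF pc_pb[OF F] pc_pb[OF xs]] by metis
  have *: "map (F x) zs = foldr (\<lambda>i a. F x i # a) zs []" for x zs by (induction zs) auto
  show ?thesis unfolding *
  proof (rule pc_foldr[OF xs pc_const _ pb_add[OF B(1) pc_pb[OF xs]]])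
    show "ptime (\<lambda>z. F (fst z) (fst (snd z)) # snd (snd z))"
      using pc_comp[OF F, of "\<lambda>z. (fst z, fst (snd z))"]
      by (intro pc_Cons) (simp_all add: pc_Pair pc_fst pc_snd pc_id)
    show "br (foldr (\<lambda>i a. F x i # a) (drop k (xs x)) []) \<le> B x + br (xs x)" for x k
      unfolding *[symmetric] br_list_le using br_le_list(1)[of "xs x"] B(2)
      by (auto dest!: in_set_dropD simp del: enc_list_def intro: trans_le_add1)
  qed
qed

lemma pc_filter:
  assumes xs: "ptime xs" and F: "ptime (\<lambda>z. P (fst z) (snd z))" shows "ptime (\<lambda>x. filter (P x) (xs x))"
proof -
  have *: "filter (P x) zs = foldr (\<lambda>i a. if P x i then i # a else a) zs []" for x zs by (induction zs) auto
  show ?thesis unfolding *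
  proof (rule pc_foldr[OF xs pc_const _ pc_pb[OF xs]])
    show "ptime (\<lambda>z. if P (fst z) (fst (snd z)) then fst (snd z) # snd (snd z) else snd (snd z))"
      using pc_comp[OF F, of "\<lambda>z. (fst z, fst (snd z))"]
      by (intro pc_if pc_Cons) (simp_all add: pc_Pair pc_fst pc_snd pc_id)
    show "br (foldr (\<lambda>i a. if P x i then i # a else a) (drop k (xs x)) []) \<le> br (xs x)" for x k
      unfolding *[symmetric] br_list_le using br_le_list(1)[of "xs x"] br_le_list(2)[of _ "xs x"]
      by (auto dest!: in_set_dropD simp del: enc_list_def intro: order_trans[OF length_filter_le])
  qed
qed

lemma pc_append: assumes "ptime f" "ptime g" shows "ptime (\<lambda>x. f x @ g x)"
proof -
  have *: "ys @ zs = foldr (\<lambda>i a. i # a) ys zs" for ys zs :: "'b list" by (induction ys) auto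
  show ?thesis unfolding *
  proof (rule pc_foldr[OF assms _ pb_add[OF pc_pb[OF assms(1)] pc_pb[OF assms(2)]]])
    show "ptime (\<lambda>z. fst (snd z) # snd (snd z))" by (intro pc_Cons pc_fst pc_snd pc_id)
    show "br (foldr (\<lambda>i a. i # a) (drop k (f x)) (g x)) \<le> br (f x) + br (g x)" for x k
      unfolding *[symmetric] br_list_le
      using br_le_list(1)[of "f x"] br_le_list(2)[of _ "f x"] br_le_list(1)[of "g x"] br_le_list(2)[of _
      "g x"]
      by (auto dest!: in_set_dropD simp del: enc_list_def intro: trans_le_add1 trans_le_add2)
  qed
qed

lemma pc_concat: assumes "ptime f" shows "ptime (\<lambda>x. concat (f x))"
proof -
  have *: "concat ys = foldr (\<lambda>i a. i @ a) ys []" for ys :: "'b list list" by (induction ys) auto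
  show ?thesis unfolding *
  proof (rule pc_foldr[OF assms pc_const _ pb_add[OF pb_mult[OF pc_pb[OF assms] pc_pb[OF assms]]
      pc_pb[OF assms]]])
    show "ptime (\<lambda>z. fst (snd z) @ snd (snd z))" by (intro pc_append pc_fst pc_snd pc_id)
    fix x k
    have e: "br i \<le> br (f x)" if "i \<in> set xs" "xs \<in> set (f x)" for i xs
      using br_le_list(2)[OF that(1)] br_le_list(2)[OF that(2)] by (rule order_trans)
    have "length (concat ys) \<le> length ys * m" if "\<And>xs. xs \<in> set ys \<Longrightarrow> length xs \<le> m" for ys :: "'b list
        list" and m
      using that by (induction ys) (fastforce simp: add_mono)+
    then have "length (concat (drop k (f x))) \<le> length (drop k (f x)) * br (f x)"
      using order_trans[OF br_le_list(1) br_le_list(2)] by (metis in_set_dropD)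
    also have "\<dots> \<le> br (f x) * br (f x)" using br_le_list(1)[of "f x"] by (intro mult_right_mono) auto
    finally show "br (foldr (\<lambda>i a. i @ a) (drop k (f x)) []) \<le> br (f x) * br (f x) + br (f x)"
      unfolding *[symmetric] br_list_le
      using e by (auto dest!: in_set_dropD simp del: enc_list_def intro: trans_le_add1 trans_le_add2)
  qed
qed

text \<open>Numbers and truth values have breadth 0, so accumulators of these types cannot
  grow.\<close>

lemma pc_foldr_scalar:
  fixes F :: "'a::enc \<Rightarrow> 'c::enc \<Rightarrow> 'b::enc \<Rightarrow> 'b"
  assumes "\<And>b::'b. br b = 0" "ptime xs" "ptime a0" "ptime (\<lambda>z. F (fst z) (fst (snd z)) (snd (snd z)))"
  shows "ptime (\<lambda>x. foldr (F x) (xs x) (a0 x))"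
  by (rule pc_foldr[OF assms(2-4) pb_const[of 0]]) (simp add: assms(1))

lemma pc_foldr_min: "ptime xs \<Longrightarrow> ptime a \<Longrightarrow> ptime (\<lambda>x. foldr min (xs x) (a x :: real))"
  by (rule pc_foldr_scalar) (auto intro!: pc_min pc_fst pc_snd pc_id)

lemma pc_foldr_max: "ptime xs \<Longrightarrow> ptime a \<Longrightarrow> ptime (\<lambda>x. foldr max (xs x) (a x :: real))"
  by (rule pc_foldr_scalar) (auto intro!: pc_max pc_fst pc_snd pc_id)

lemma pc_sum_list_real: "ptime xs \<Longrightarrow> ptime (\<lambda>x. sum_list (xs x) :: real)"
  unfolding sum_list.eq_foldr by (rule pc_foldr_scalar) (auto intro!: pc_add_real pc_fst pc_snd pc_id
      pc_const)

lemma pc_sum_list_nat: "ptime xs \<Longrightarrow> ptime (\<lambda>x. sum_list (xs x) :: nat)"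
  unfolding sum_list.eq_foldr by (rule pc_foldr_scalar) (auto intro!: pc_add_nat pc_fst pc_snd pc_id
      pc_const)

lemma pc_length: "ptime xs \<Longrightarrow> ptime (\<lambda>x. length (xs x))"
proof -
  assume xs: "ptime xs"
  have *: "length ys = foldr (\<lambda>_ a. a + 1) ys 0" for ys :: "'b list" by (induction ys) auto
  show ?thesis unfolding *
    by (rule pc_foldr_scalar[OF _ xs]) (auto intro!: pc_add_nat[of _ "\<lambda>_. 1", simplified] pc_fst pc_snd
        pc_id pc_const)
qed

lemma pc_list_ex: assumes "ptime xs" "ptime (\<lambda>z. P (fst z) (snd z))" shows "ptime (\<lambda>x. list_ex (P x) (xs
    x))"
proof -
  have *: "list_ex (P x) ys = foldr (\<lambda>i a. P x i \<or> a) ys False" for x and ys :: "'b list" by (induction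
      ys) auto
  have "ptime (\<lambda>z. P (fst z) (fst (snd z)))" using pc_comp[OF assms(2), of "\<lambda>z. (fst z, fst (snd z))"]
    by (simp add: pc_Pair pc_fst pc_snd pc_id)
  then show ?thesis unfolding *
    by (intro pc_foldr_scalar[OF _ assms(1)] pc_disj pc_const pc_snd pc_id) simp
qed

lemma pc_mem_nat: assumes "ptime a" "ptime xs" shows "ptime (\<lambda>x. (a x :: nat) \<in> set (xs x))"
proof -
  have "ptime (\<lambda>x. list_ex (\<lambda>y. y = a x) (xs x))"
    using pc_comp[OF assms(1) pc_fst[OF pc_id]] by (intro pc_list_ex[OF assms(2)] pc_eq_nat pc_snd pc_id)
  then show ?thesis by (simp add: list_ex_iff)
qed

text \<open>The list \<open>js\<close> belongs to the program text and not to its input: the map is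
  unrolled. Residue classes, partition indices and bits enter this way, as \<open>m\<close> and
  \<tau> are fixed for the whole family.\<close>

lemma pc_map_static: "(\<And>j. j \<in> set js \<Longrightarrow> ptime (\<lambda>x. F x j)) \<Longrightarrow> ptime (\<lambda>x. map (F x) js)"
  by (induction js) (auto intro: pc_const pc_Cons)

text \<open>A function is compiled once with its arguments packed into a tuple;
  \<open>pc_lift2\<close> to \<open>pc_lift7\<close> then admit arbitrary computable
  arguments.\<close>

lemma pc_lift2: "ptime (\<lambda>z. F (fst z) (snd z)) \<Longrightarrow> ptime a \<Longrightarrow> ptime b \<Longrightarrow> ptime (\<lambda>x. F (a x) (b x))"
  by (drule pc_comp[of _ "\<lambda>x. (a x, b x)"]) (simp_all add: pc_Pair)

lemma pc_lift3: "ptime (\<lambda>z. F (fst z) (fst (snd z)) (snd (snd z))) \<Longrightarrow> ptime a \<Longrightarrow> ptime b \<Longrightarrow> ptime c \<Longrightarrow> ptime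
    (\<lambda>x. F (a x) (b x) (c x))"
  by (drule pc_comp[of _ "\<lambda>x. (a x, b x, c x)"]) (simp_all add: pc_Pair)

lemma pc_lift4: "ptime (\<lambda>z. F (fst z) (fst (snd z)) (fst (snd (snd z))) (snd (snd (snd z)))) \<Longrightarrow>
    ptime a \<Longrightarrow> ptime b \<Longrightarrow> ptime c \<Longrightarrow> ptime d \<Longrightarrow> ptime (\<lambda>x. F (a x) (b x) (c x) (d x))"
  by (drule pc_comp[of _ "\<lambda>x. (a x, b x, c x, d x)"]) (simp_all add: pc_Pair)

lemma pc_lift5: "ptime (\<lambda>z. F (fst z) (fst (snd z)) (fst (snd (snd z))) (fst (snd (snd (snd z)))) (snd
    (snd (snd (snd z))))) \<Longrightarrow>
    ptime a \<Longrightarrow> ptime b \<Longrightarrow> ptime c \<Longrightarrow> ptime d \<Longrightarrow> ptime e \<Longrightarrow> ptime (\<lambda>x. F (a x) (b x) (c x) (d x) (e x))"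
  by (drule pc_comp[of _ "\<lambda>x. (a x, b x, c x, d x, e x)"]) (simp_all add: pc_Pair)

lemma pc_lift6: "ptime (\<lambda>z. F (fst z) (fst (snd z)) (fst (snd (snd z))) (fst (snd (snd (snd z))))
      (fst (snd (snd (snd (snd z))))) (snd (snd (snd (snd (snd z)))))) \<Longrightarrow>
    ptime a \<Longrightarrow> ptime b \<Longrightarrow> ptime c \<Longrightarrow> ptime d \<Longrightarrow> ptime e \<Longrightarrow> ptime f \<Longrightarrow> ptime (\<lambda>x. F (a x) (b x) (c x) (d x) (e
        x) (f x))"
  by (drule pc_comp[of _ "\<lambda>x. (a x, b x, c x, d x, e x, f x)"]) (simp_all add: pc_Pair)

lemma pc_lift7: "ptime (\<lambda>z. F (fst z) (fst (snd z)) (fst (snd (snd z))) (fst (snd (snd (snd z))))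
      (fst (snd (snd (snd (snd z))))) (fst (snd (snd (snd (snd (snd z)))))) (snd (snd (snd (snd (snd
      (snd z))))))) \<Longrightarrow>
    ptime a \<Longrightarrow> ptime b \<Longrightarrow> ptime c \<Longrightarrow> ptime d \<Longrightarrow> ptime e \<Longrightarrow> ptime f \<Longrightarrow> ptime g \<Longrightarrow>
    ptime (\<lambda>x. F (a x) (b x) (c x) (d x) (e x) (f x) (g x))"
  by (drule pc_comp[of _ "\<lambda>x. (a x, b x, c x, d x, e x, f x, g x)"]) (simp_all add: pc_Pair)

lemmas pc_intros = pc_id pc_const pc_fst pc_snd pc_Pair pc_Cons pc_tl pc_isnil pc_hd_or pc_Not pc_conj
    pc_disj
  pc_eq_bool pc_if pc_add_real pc_diff_real pc_mult_real pc_divide_real pc_less_real pc_le_real pc_min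
      pc_max
  pc_of_nat pc_add_nat pc_mult_nat pc_less_nat pc_le_nat pc_eq_nat pc_map pc_filter pc_append pc_concat
  pc_foldr_min pc_foldr_max pc_sum_list_real pc_sum_list_nat pc_length pc_list_ex pc_mem_nat


section \<open>The embedding algorithm\<close>

definition lookup1 :: "(nat \<times> real) list \<Rightarrow> nat \<Rightarrow> real" where
  "lookup1 T v = sum_list (map (\<lambda>e. if fst e = v then snd e else 0) T)"

definition lookup2 :: "(nat \<times> nat \<times> real) list \<Rightarrow> nat \<Rightarrow> nat \<Rightarrow> real" where
  "lookup2 T u v = sum_list (map (\<lambda>e. if fst e = u \<and> fst (snd e) = v then snd (snd e) else 0) T)"

definition tab1 :: "nat list \<Rightarrow> (nat \<Rightarrow> real) \<Rightarrow> (nat \<times> real) list" where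
  "tab1 vs h = map (\<lambda>v. (v, h v)) vs"

definition tab2 :: "nat list \<Rightarrow> (nat \<Rightarrow> nat \<Rightarrow> real) \<Rightarrow> (nat \<times> nat \<times> real) list" where
  "tab2 vs h = concat (map (\<lambda>u. map (\<lambda>v. (u, v, h u v)) vs) vs)"

text \<open>An edge is a list of three reals because \<open>represents_graph\<close> presents it as
  one flat list of numbers, which nested pairs would not match.\<close>

type_synonym graph_data = "nat list \<times> real list list"

definition edge_weight :: "real list \<Rightarrow> real" where "edge_weight e = hd_or 0 (tl (tl e))"

definition joins :: "real list \<Rightarrow> nat \<Rightarrow> nat \<Rightarrow> bool" where
  "joins e u v \<longleftrightarrow> hd_or 0 e \<le> real u \<and> real u \<le> hd_or 0 e \<and> hd_or 0 (tl e) \<le> real v \<and> real v \<le> hd_or 0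
      (tl e)"

text \<open>Stands in for an infinite distance: no distance in a connected graph exceeds it.\<close>

definition far :: "graph_data \<Rightarrow> real" where
  "far g = real (length (fst g)) * sum_list (map edge_weight (snd g))"

definition hop :: "graph_data \<Rightarrow> nat \<Rightarrow> nat \<Rightarrow> real" where
  "hop g u v = foldr min (map edge_weight (filter (\<lambda>e. joins e u v \<or> joins e v u) (snd g))) (far g)"

text \<open>One round of Bellman-Ford for all pairs: after \<open>k\<close> rounds an entry is at
  most the length of every walk with at most \<open>k\<close> edges. In \<open>dists\<close> the
  list of vertices only counts the rounds.\<close>

definition relax :: "graph_data \<Rightarrow> (nat \<times> nat \<times> real) list \<Rightarrow> (nat \<times> nat \<times> real) list" where
  "relax g dm = tab2 (fst g) (\<lambda>u v. foldr min (map (\<lambda>z. hop g u z + lookup2 dm z v) (fst g)) (lookup2 dm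
      u v))"

definition dists :: "graph_data \<Rightarrow> (nat \<times> nat \<times> real) list" where
  "dists g = foldl (\<lambda>dm _. relax g dm) (tab2 (fst g) (\<lambda>u v. if u = v then 0 else far g)) (fst g)"

text \<open>The state holds the distance up to which everything is served, the next residue class
  and the scales so far. The least unserved distance \<open>a\<close> gives the scale
  \<open>4/5 * a\<close>, which serves all distances from \<open>a\<close> to
  \<open>6/5 * a\<close>, the latter being \<open>3/2\<close> times the scale. The minimum starts
  from the head of \<open>cand\<close>, which is neutral for it.\<close>

definition scale_step :: "nat \<Rightarrow> real list \<Rightarrow> real \<times> nat \<times> (nat \<times> real) list \<Rightarrow> real \<times> nat \<times> (nat \<times> real)
    list" where
  "scale_step m ds st = (let cand = filter (\<lambda>r. fst st < r) ds; a = foldr min cand (hd_or 0 cand) in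
     if isnil cand then st
     else (6/5 * a, if fst (snd st) + 1 = m then 0 else fst (snd st) + 1, (fst (snd st), 4/5 * a) # snd
         (snd st)))"

definition scales :: "nat \<Rightarrow> real list \<Rightarrow> (nat \<times> real) list" where
  "scales m ds = snd (snd (foldl (\<lambda>st _. scale_step m ds st) (0, 0, []) ds))"

definition powers :: "nat list \<Rightarrow> nat list" where
  "powers vs = foldl (\<lambda>ps _. if 2 * hd_or 1 ps \<le> length vs then 2 * hd_or 1 ps # ps else ps) [1] vs"

section \<open>Codes for the clusters of one partition\<close>

definition near :: "(nat \<Rightarrow> nat \<Rightarrow> real) \<Rightarrow> real \<Rightarrow> nat list \<Rightarrow> nat \<Rightarrow> bool" where
  "near d r C u \<longleftrightarrow> list_ex (\<lambda>v. d u v \<le> r) C"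

definition adj :: "(nat \<Rightarrow> nat \<Rightarrow> real) \<Rightarrow> real \<Rightarrow> nat list \<Rightarrow> nat list \<Rightarrow> bool" where
  "adj d r C D \<longleftrightarrow> list_ex (\<lambda>u. near d r C u) D"

definition nbhd_size :: "nat list \<Rightarrow> (nat \<Rightarrow> nat \<Rightarrow> real) \<Rightarrow> real \<Rightarrow> nat list \<Rightarrow> nat" where
  "nbhd_size vs d r C = length (filter (\<lambda>u. near d r C u) vs)"

text \<open>A code word is given by the powers of two at which its bit is set.\<close>

type_synonym coded = "(nat list \<times> nat list) list"

definition mass :: "coded \<Rightarrow> nat" where
  "mass A = sum_list (map (\<lambda>e. length (fst e)) A)"

text \<open>The bit of the new cluster is made to differ from that of the heavier part, which is
  thereby separated; the lighter part is kept. If fewer than \<open>q\<close> points are left, the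
  bit stays unset and nothing is dropped. Either way, a mass below \<open>2 * q\<close> becomes a
  mass below \<open>q\<close>.\<close>

definition code_step :: "coded \<times> nat list \<Rightarrow> nat \<Rightarrow> coded \<times> nat list" where
  "code_step st q = (let A1 = filter (\<lambda>e. q \<in> set (snd e)) (fst st); A0 = filter (\<lambda>e. \<not> q \<in> set (snd e))
      (fst st) in
     if q \<le> mass (fst st) then (if mass A1 \<le> mass A0 then (A1, q # snd st) else (A0, snd st)) else st)"

definition code_word :: "nat list \<Rightarrow> coded \<Rightarrow> nat list" where
  "code_word ps A = snd (foldl code_step (A, []) ps)"

text \<open>Size classes between consecutive powers of two, large classes first when
  \<open>ps\<close> decreases. A cluster is then coded after all those of larger classes, so a
  condition \<open>length C < 2 * q\<close> that an earlier cluster meets is met by it as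
  well.\<close>

definition by_size :: "nat list \<Rightarrow> nat list list \<Rightarrow> nat list list" where
  "by_size ps P = concat (map (\<lambda>q. filter (\<lambda>C. q \<le> length C \<and> length C < 2 * q) P) ps)"

definition code :: "(nat \<Rightarrow> nat \<Rightarrow> real) \<Rightarrow> real \<Rightarrow> nat list \<Rightarrow> nat list list \<Rightarrow> coded" where
  "code d r ps P = foldl (\<lambda>A C. (C, code_word ps (filter (\<lambda>e. adj d r C (fst e)) A)) # A) [] (by_size ps P)"

section \<open>Bumps and coordinates\<close>

definition depth :: "nat list \<Rightarrow> (nat \<Rightarrow> nat \<Rightarrow> real) \<Rightarrow> real \<Rightarrow> nat list \<Rightarrow> nat \<Rightarrow> real" where
  "depth vs d c C u = foldr min (map (\<lambda>y. d u y) (filter (\<lambda>y. \<not> y \<in> set C) vs)) c"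

definition plateau :: "nat list \<Rightarrow> (nat \<Rightarrow> nat \<Rightarrow> real) \<Rightarrow> real \<Rightarrow> (nat \<Rightarrow> real) \<Rightarrow> nat list \<Rightarrow> real" where
  "plateau vs d c H C = foldr max (map (\<lambda>u. depth vs d c C u) (filter (\<lambda>u. 0 < H u) C)) 0"

text \<open>Constant for \<open>x\<close> between \<open>S - w\<close> and \<open>S + w\<close>; \<open>S\<close> is the depth at which smaller scales are active.\<close>

definition height :: "real \<Rightarrow> real \<Rightarrow> real \<Rightarrow> real" where
  "height S w x = max 0 (min x (max (S - w) (x - 2 * w)) - 2 * w)"

text \<open>The upper bound on the cluster leaves room for a single active place inside it. The
  lower bound on its neighbourhood provides the balls with \<open>q\<close> points that the argument
  needs at the next scales.\<close>

definition raised :: "nat list \<Rightarrow> (nat \<Rightarrow> nat \<Rightarrow> real) \<Rightarrow> real \<Rightarrow> bool \<Rightarrow> nat \<Rightarrow> nat list \<times> nat list \<Rightarrow> bool" where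
  "raised vs d \<Delta> a q e \<longleftrightarrow> length (fst e) < 2 * q \<and> q \<le> nbhd_size vs d (6 * \<Delta>) (fst e) \<and> (q \<in> set (snd e))
      = a"

definition entry :: "coded \<Rightarrow> nat \<Rightarrow> nat list \<times> nat list" where
  "entry cps v = hd_or ([], []) (filter (\<lambda>e. v \<in> set (fst e)) cps)"

definition bump :: "real \<Rightarrow> nat list \<Rightarrow> (nat \<Rightarrow> nat \<Rightarrow> real) \<Rightarrow> real \<Rightarrow> bool \<Rightarrow> nat \<Rightarrow> coded \<Rightarrow> (nat \<Rightarrow> real) \<Rightarrow>
    nat \<Rightarrow> real" where
  "bump \<beta> vs d \<Delta> a q cps H v =
     (if raised vs d \<Delta> a q (entry cps v)
      then height (plateau vs d (\<Delta> / \<beta>) H (fst (entry cps v))) (\<Delta> / (20 * \<beta>)) (depth vs d (\<Delta> / \<beta>) (fst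
      (entry cps v)) v)
      else 0)"

text \<open>\<open>j\<close> is fixed in the program text, so the iteration of \<open>tl\<close> is
  unrolled.\<close>

definition nth_or_nil :: "nat \<Rightarrow> 'a list list \<Rightarrow> 'a list" where
  "nth_or_nil j xs = hd_or [] ((tl ^^ j) xs)"

type_synonym cover = "nat list list list"

text \<open>The new function is tabulated at once, so its breadth stays bounded in terms of the
  number of vertices through all levels.\<close>

definition level_step :: "real \<Rightarrow> nat list \<Rightarrow> (nat \<times> nat \<times> real) list \<Rightarrow> nat list \<Rightarrow> nat \<Rightarrow> nat \<Rightarrow> bool \<Rightarrow> nat \<Rightarrow>
    (nat \<times> real) list \<Rightarrow> nat \<times> real \<times> cover \<Rightarrow> (nat \<times> real) list" where
  "level_step \<beta> vs dm ps r j a q H lev =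
     (if fst lev = r
      then tab1 vs (\<lambda>v. lookup1 H v + bump \<beta> vs (lookup2 dm) (fst (snd lev)) a q
              (code (lookup2 dm) (2 * fst (snd lev)) ps (nth_or_nil j (snd (snd lev)))) (lookup1 H) v)
      else H)"

definition coord :: "real \<Rightarrow> nat list \<Rightarrow> (nat \<times> nat \<times> real) list \<Rightarrow> nat list \<Rightarrow> nat \<Rightarrow> nat \<Rightarrow> bool \<Rightarrow> nat \<Rightarrow>
    (nat \<times> real \<times> cover) list \<Rightarrow> (nat \<times> real) list" where
  "coord \<beta> vs dm ps r j a q levs = foldl (level_step \<beta> vs dm ps r j a q) (tab1 vs (\<lambda>_. 0)) levs"

text \<open>Both bits \<open>a\<close> occur because only the end \<open>x\<close> of a pair whose
  ball is padded is known to lie deep in its cluster, so it is the cluster of \<open>x\<close> that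
  has to be raised, whichever bit it carries.\<close>

definition coords :: "real \<Rightarrow> nat \<Rightarrow> nat \<Rightarrow> nat list \<Rightarrow> (nat \<times> nat \<times> real) list \<Rightarrow> nat list \<Rightarrow>
    (nat \<times> real \<times> cover) list \<Rightarrow> (nat \<times> real) list list" where
  "coords \<beta> m \<tau> vs dm ps levs =
     concat (map (\<lambda>r. concat (map (\<lambda>j. concat (map (\<lambda>a. map (\<lambda>q. coord \<beta> vs dm ps r j a q levs) ps)
         [True, False])) [0..<\<tau>])) [0..<m])"

definition embed :: "real \<Rightarrow> nat \<Rightarrow> nat \<Rightarrow> graph_data \<times> (nat \<times> real \<times> cover) list \<Rightarrow> (nat \<times> real list) list"
    where
  "embed \<beta> m \<tau> z = map (\<lambda>v. (v, map (\<lambda>H. lookup1 H v)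
      (coords \<beta> m \<tau> (fst (fst z)) (dists (fst z)) (powers (fst (fst z))) (snd z)))) (fst (fst z))"

section \<open>Polynomial running time of the algorithm\<close>

lemma pc_lookup1: "ptime T \<Longrightarrow> ptime v \<Longrightarrow> ptime (\<lambda>x. lookup1 (T x) (v x))"
  by (rule pc_lift2[of lookup1]) (unfold lookup1_def, intro pc_intros)

lemma pc_lookup2: "\<lbrakk>ptime T; ptime u; ptime v\<rbrakk> \<Longrightarrow> ptime (\<lambda>x. lookup2 (T x) (u x) (v x))"
  by (rule pc_lift3[of lookup2]) (unfold lookup2_def, intro pc_intros)

lemma pc_tab1: "ptime vs \<Longrightarrow> ptime (\<lambda>z. h (fst z) (snd z)) \<Longrightarrow> ptime (\<lambda>x. tab1 (vs x) (h x))"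
  unfolding tab1_def by (intro pc_intros)

lemma pc_tab2:
  assumes "ptime vs" "ptime (\<lambda>z. h (fst z) (fst (snd z)) (snd (snd z)))" shows "ptime (\<lambda>x. tab2 (vs x)
      (h x))"
proof -
  have "ptime (\<lambda>z. vs (fst z))" by (rule pc_comp[OF assms(1)]) (intro pc_intros)
  moreover have "ptime (\<lambda>z. h (fst (fst z)) (snd (fst z)) (snd z))"
    using pc_comp[OF assms(2), of "\<lambda>z. (fst (fst z), snd (fst z), snd z)"] by (simp add: pc_intros)
  ultimately show ?thesis unfolding tab2_def by (intro pc_intros assms(1))
qed

lemma pc_edge_weight: "ptime e \<Longrightarrow> ptime (\<lambda>x. edge_weight (e x))"
  unfolding edge_weight_def by (intro pc_intros)

lemma pc_joins: "\<lbrakk>ptime e; ptime u; ptime v\<rbrakk> \<Longrightarrow> ptime (\<lambda>x. joins (e x) (u x) (v x))"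
  by (rule pc_lift3[of joins]) (unfold joins_def, intro pc_intros)

lemma pc_far: "ptime g \<Longrightarrow> ptime (\<lambda>x. far (g x))"
  by (rule pc_comp[of far]) (unfold far_def, intro pc_intros pc_edge_weight)

lemma pc_hop: "\<lbrakk>ptime g; ptime u; ptime v\<rbrakk> \<Longrightarrow> ptime (\<lambda>x. hop (g x) (u x) (v x))"
  by (rule pc_lift3[of hop]) (unfold hop_def, intro pc_intros pc_edge_weight pc_joins pc_far)

lemma pc_relax: "ptime g \<Longrightarrow> ptime dm \<Longrightarrow> ptime (\<lambda>x. relax (g x) (dm x))"
  by (rule pc_lift2[of relax]) (unfold relax_def, intro pc_tab2 pc_intros pc_lookup2 pc_hop)

lemma length_take_le: "length (take k xs) \<le> length xs"
  by simp

text \<open>Numbers have breadth 0, so the breadth of a table depends on the number of vertices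
  alone, and recomputing a table over and over cannot enlarge it. This bounds the folds in
  \<open>dists\<close> and \<open>coord\<close>.\<close>

lemma br_tab1: "br (tab1 vs h) \<le> length vs + 2"
  by (auto simp: tab1_def)

lemma br_tab2: "br (tab2 vs h) \<le> length vs * length vs + 2"
  by (auto simp: tab2_def length_concat sum_list_triv o_def)

lemma pc_dists: "ptime g \<Longrightarrow> ptime (\<lambda>x. dists (g x))"
proof (rule pc_comp[of dists])
  let ?F = "\<lambda>g. foldl (\<lambda>dm _. relax g dm) (tab2 (fst g) (\<lambda>u v. if u = v then 0 else far g))"
  show "ptime dists" unfolding dists_def
  proof (rule pc_foldl)
    show "polybd (\<lambda>g::graph_data. br g * br g + 2)" by (intro pb_intros)
    fix g :: graph_data and k
    have "br (?F g xs) \<le> length (fst g) * length (fst g) + 2" for xs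
      by (induction xs rule: rev_induct) (simp_all only: foldl_append foldl.simps relax_def br_tab2)
    also have "\<dots> \<le> br g * br g + 2"
      using order_trans[OF br_le_list(1) br_le_prod(1), of g] by (intro add_mono mult_mono) auto
    finally show "br (?F g (take k (fst g))) \<le> br g * br g + 2" .
  qed (intro pc_tab2 pc_intros pc_far pc_relax)+
qed

lemma pc_scale_step: "ptime ds \<Longrightarrow> ptime st \<Longrightarrow> ptime (\<lambda>x. scale_step m (ds x) (st x))"
  by (rule pc_lift2[of "scale_step m"]) (unfold scale_step_def Let_def, intro pc_intros)

lemma pc_scales: "ptime ds \<Longrightarrow> ptime (\<lambda>x. scales m (ds x))"
proof (rule pc_comp[of "scales m"])
  let ?F = "\<lambda>ds. foldl (\<lambda>st _. scale_step m ds st) (0, 0, [])"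
  have "ptime (\<lambda>ds. ?F ds ds)"
  proof (rule pc_foldl)
    show "polybd (\<lambda>ds::real list. br ds + 2)" by (intro pb_intros)
    fix ds :: "real list" and k
    have "length (snd (snd (?F ds xs))) \<le> length xs" for xs
      by (induction xs rule: rev_induct) (auto simp: scale_step_def Let_def)
    from this[of "take k ds"] show "br (?F ds (take k ds)) \<le> br ds + 2"
      using br_le_list(1)[of ds] length_take_le[of k ds] by (auto simp: case_prod_unfold simp del:
      length_take)
  qed (intro pc_intros pc_scale_step)+
  then show "ptime (scales m)" unfolding scales_def by (intro pc_intros)
qed

lemma pc_powers: "ptime vs \<Longrightarrow> ptime (\<lambda>x. powers (vs x))"
proof (rule pc_comp[of powers])
  let ?F = "\<lambda>vs. foldl (\<lambda>ps _. if 2 * hd_or 1 ps \<le> length vs then 2 * hd_or 1 ps # ps else ps) [1]"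
  show "ptime powers" unfolding powers_def
  proof (rule pc_foldl)
    show "polybd (\<lambda>vs::nat list. br vs + 1)" by (intro pb_intros)
    fix vs :: "nat list" and k
    have "length (?F vs xs) \<le> length xs + 1" for xs :: "nat list"
      by (induction xs rule: rev_induct) auto
    from this[of "take k vs"] show "br (?F vs (take k vs)) \<le> br vs + 1"
      using br_le_list(1)[of vs] length_take_le[of k vs] by (auto simp del: length_take)
  qed (intro pc_intros)+
qed

lemma pc_near: "\<lbrakk>ptime dm; ptime r; ptime C; ptime u\<rbrakk> \<Longrightarrow> ptime (\<lambda>x. near (lookup2 (dm x)) (r x) (C x) (u x))"
  by (rule pc_lift4[of "\<lambda>dm. near (lookup2 dm)"]) (unfold near_def, intro pc_intros pc_lookup2)

lemma pc_adj: "\<lbrakk>ptime dm; ptime r; ptime C; ptime D\<rbrakk> \<Longrightarrow> ptime (\<lambda>x. adj (lookup2 (dm x)) (r x) (C x) (D x))"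
  by (rule pc_lift4[of "\<lambda>dm. adj (lookup2 dm)"]) (unfold adj_def, intro pc_intros pc_near)

lemma pc_nbhd_size: "\<lbrakk>ptime vs; ptime dm; ptime r; ptime C\<rbrakk> \<Longrightarrow> ptime (\<lambda>x. nbhd_size (vs x) (lookup2 (dm
    x)) (r x) (C x))"
  by (rule pc_lift4[of "\<lambda>vs dm. nbhd_size vs (lookup2 dm)"]) (unfold nbhd_size_def, intro pc_intros pc_near)

lemma pc_mass: "ptime A \<Longrightarrow> ptime (\<lambda>x. mass (A x))"
  by (rule pc_comp[of mass]) (unfold mass_def, intro pc_intros)

lemma pc_code_step: "ptime st \<Longrightarrow> ptime q \<Longrightarrow> ptime (\<lambda>x. code_step (st x) (q x))"
  by (rule pc_lift2[of code_step]) (unfold code_step_def Let_def, intro pc_intros pc_mass)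

lemma br_filter: "br (filter P xs) \<le> br xs"
  unfolding br_list_le using br_le_list(1)[of xs] br_le_list(2)[of _ xs]
  by (auto simp del: enc_list_def intro: order_trans[OF length_filter_le])

lemma br_take: "br (take k xs) \<le> br xs"
  unfolding br_list_le using br_le_list(1)[of xs] br_le_list(2)[of _ xs]
  by (auto dest: in_set_takeD simp del: enc_list_def)

lemma code_step_bounds:
  "br (fst (foldl code_step (A, W) ps)) \<le> br A" "length (snd (foldl code_step (A, W) ps)) \<le> length ps +
      length W"
  by (induction ps rule: rev_induct)
     (auto simp: code_step_def Let_def simp del: enc_list_def intro: order_trans[OF br_filter])

lemma br_nat_list: "br (W :: nat list) = length W"
  by (rule antisym) (auto simp: br_le_list(1)[of W, simplified])

lemma pc_code_word: "ptime ps \<Longrightarrow> ptime A \<Longrightarrow> ptime (\<lambda>x. code_word (ps x) (A x))"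
proof (rule pc_lift2[of code_word])
  have "ptime (\<lambda>z. foldl code_step (snd z, []) (fst z))"
  proof (rule pc_foldl)
    show "polybd (\<lambda>z::nat list \<times> coded. br z + br z + 2)" by (intro pb_intros)
    fix z :: "nat list \<times> coded" and k
    show "br (foldl code_step (snd z, []) (take k (fst z))) \<le> br z + br z + 2"
      using code_step_bounds(1)[of "snd z" "[]" "take k (fst z)"] code_step_bounds(2)[of "snd z" "[]"
      "take k (fst z)"]
        br_le_prod(1,2)[of z] br_nat_list[of "snd (foldl code_step (snd z, []) (take k (fst z)))"]
        br_nat_list[of "fst z"]
      by (auto simp del: enc_list_def)
  qed (intro pc_intros pc_code_step)+
  then show "ptime (\<lambda>z. code_word (fst z) (snd z))" unfolding code_word_def by (intro pc_intros)
qed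

lemma pc_by_size: "ptime ps \<Longrightarrow> ptime P \<Longrightarrow> ptime (\<lambda>x. by_size (ps x) (P x))"
  by (rule pc_lift2[of by_size]) (unfold by_size_def, intro pc_intros)

lemma pc_code: "\<lbrakk>ptime dm; ptime r; ptime ps; ptime P\<rbrakk> \<Longrightarrow> ptime (\<lambda>x. code (lookup2 (dm x)) (r x) (ps x)
    (P x))"
proof (rule pc_lift4[of "\<lambda>dm. code (lookup2 dm)"])
  let ?F = "\<lambda>d r ps. foldl (\<lambda>A C. (C, code_word ps (filter (\<lambda>e. adj d r C (fst e)) A)) # A) []"
  let ?L = "\<lambda>z. by_size (fst (snd (snd z))) (snd (snd (snd z)))"
  have L: "ptime ?L" by (intro pc_intros pc_by_size)
  show "ptime (\<lambda>z. code (lookup2 (fst z)) (fst (snd z)) (fst (snd (snd z))) (snd (snd (snd z))))"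
      unfolding code_def
  proof (rule pc_foldl[OF L])
    show "polybd (\<lambda>z. br (?L z) + br z + 2)" by (intro pb_intros pc_pb[OF L])
    fix z :: "(nat \<times> nat \<times> real) list \<times> real \<times> nat list \<times> nat list list" and k
    have *: "br (?F d r ps xs) \<le> br xs + length ps + 2" for d r ps xs
    proof -
      have "length (?F d r ps xs) = length xs" by (induction xs rule: rev_induct) auto
      moreover have "fst e \<in> set xs \<and> length (snd e) \<le> length ps" if "e \<in> set (?F d r ps xs)" for e
        using that code_step_bounds(2)[of _ "[]" ps]
        by (induction xs rule: rev_induct) (auto simp: code_word_def)
      ultimately show ?thesis
        unfolding br_list_le using br_le_list(1)[of xs] br_le_list(2)[of _ xs] br_nat_list
        by (fastforce simp del: enc_list_def)
    qed
    have "br (take k (?L z)) \<le> br (?L z)"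
      by (rule br_take)
    moreover have "length (fst (snd (snd z))) \<le> br z"
      using br_nat_list[of "fst (snd (snd z))"] br_le_prod[of z] br_le_prod[of "snd z"] br_le_prod[of
      "snd (snd z)"]
      by linarith
    moreover have "br (?F (lookup2 (fst z)) (fst (snd z)) (fst (snd (snd z))) (take k (?L z)))
        \<le> br (take k (?L z)) + length (fst (snd (snd z))) + 2" by (rule *)
    ultimately show "br (?F (lookup2 (fst z)) (fst (snd z)) (fst (snd (snd z))) (take k (?L z))) \<le> br
        (?L z) + br z + 2"
      by linarith
  qed (intro pc_intros pc_code_word pc_adj)+
qed

lemma pc_depth: "\<lbrakk>ptime vs; ptime dm; ptime c; ptime C; ptime u\<rbrakk> \<Longrightarrow> ptime (\<lambda>x. depth (vs x) (lookup2 (dm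
    x)) (c x) (C x) (u x))"
  by (rule pc_lift5[of "\<lambda>vs dm. depth vs (lookup2 dm)"]) (unfold depth_def, intro pc_intros pc_lookup2)

lemma pc_plateau: "\<lbrakk>ptime vs; ptime dm; ptime c; ptime H; ptime C\<rbrakk> \<Longrightarrow> ptime (\<lambda>x. plateau (vs x) (lookup2
    (dm x)) (c x) (lookup1 (H x)) (C x))"
  by (rule pc_lift5[of "\<lambda>vs dm c H. plateau vs (lookup2 dm) c (lookup1 H)"])
     (unfold plateau_def, intro pc_intros pc_lookup1 pc_depth)

lemma pc_height: "\<lbrakk>ptime S; ptime w; ptime y\<rbrakk> \<Longrightarrow> ptime (\<lambda>x. height (S x) (w x) (y x))"
  unfolding height_def by (intro pc_intros)

lemma pc_raised: "\<lbrakk>ptime vs; ptime dm; ptime \<Delta>; ptime a; ptime q; ptime e\<rbrakk> \<Longrightarrow> ptime (\<lambda>x. raised (vs x)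
    (lookup2 (dm x)) (\<Delta> x) (a x) (q x) (e x))"
  unfolding raised_def by (intro pc_intros pc_nbhd_size)

lemma pc_entry: "ptime cps \<Longrightarrow> ptime v \<Longrightarrow> ptime (\<lambda>x. entry (cps x) (v x))"
  by (rule pc_lift2[of entry]) (unfold entry_def, intro pc_intros)

lemma pc_bump: "\<lbrakk>ptime vs; ptime dm; ptime \<Delta>; ptime q; ptime cps; ptime H; ptime v\<rbrakk> \<Longrightarrow> ptime (\<lambda>x. bump \<beta>
    (vs x) (lookup2 (dm x)) (\<Delta> x) a (q x) (cps x) (lookup1 (H x)) (v x))"
  unfolding bump_def by (intro pc_intros pc_raised pc_height pc_plateau pc_depth pc_entry)

lemma pc_nth_or_nil: "ptime f \<Longrightarrow> ptime (\<lambda>x. nth_or_nil j (f x))"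
proof -
  assume "ptime f"
  then have "ptime (\<lambda>x. (tl ^^ j) (f x))" by (induction j) (auto intro: pc_tl)
  then show ?thesis unfolding nth_or_nil_def by (intro pc_hd_or pc_const)
qed

lemma pc_level_step: "\<lbrakk>ptime vs; ptime dm; ptime ps; ptime r; ptime q; ptime H; ptime lev\<rbrakk> \<Longrightarrow> ptime (\<lambda>x.
    level_step \<beta> (vs x) (dm x) (ps x) (r x) j a (q x) (H x) (lev x))"
  by (rule pc_lift7[of "\<lambda>vs dm ps r. level_step \<beta> vs dm ps r j a"])
     (unfold level_step_def, intro pc_intros pc_tab1 pc_lookup1 pc_bump pc_code pc_nth_or_nil)

lemma pc_coord: "\<lbrakk>ptime vs; ptime dm; ptime ps; ptime r; ptime q; ptime levs\<rbrakk> \<Longrightarrow> ptime (\<lambda>x. coord \<beta> (vs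
    x) (dm x) (ps x) (r x) j a (q x) (levs x))"
proof (rule pc_lift6[of "\<lambda>vs dm ps r. coord \<beta> vs dm ps r j a"])
  let ?F = "\<lambda>vs dm ps r q. foldl (level_step \<beta> vs dm ps r j a q) (tab1 vs (\<lambda>_. 0))"
  let ?vs = "\<lambda>z. fst z"
  let ?G = "\<lambda>z. ?F (fst z) (fst (snd z)) (fst (snd (snd z))) (fst (snd (snd (snd z)))) (fst (snd (snd
      (snd (snd z)))))"
  show "ptime (\<lambda>z. coord \<beta> (fst z) (fst (snd z)) (fst (snd (snd z))) (fst (snd (snd (snd z)))) j a
      (fst (snd (snd (snd (snd z))))) (snd (snd (snd (snd (snd z))))))" unfolding coord_def
  proof (rule pc_foldl)
    show "polybd (\<lambda>z :: nat list \<times> (nat \<times> nat \<times> real) list \<times> nat list \<times> nat \<times> nat \<times> (nat \<times> real \<times> cover)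
        list. br z + 2)" by (intro pb_intros)
    fix z :: "nat list \<times> (nat \<times> nat \<times> real) list \<times> nat list \<times> nat \<times> nat \<times> (nat \<times> real \<times> cover) list" and k
    have "br (?G z xs) \<le> length (fst z) + 2" for xs
      by (induction xs rule: rev_induct) (simp_all only: foldl_append foldl.simps level_step_def br_tab1
      split: if_split, auto)
    also have "\<dots> \<le> br z + 2"
      using order_trans[OF br_le_list(1) br_le_prod(1), of z] by simp
    finally show "br (?G z (take k (snd (snd (snd (snd (snd z))))))) \<le> br z + 2" .
  qed (intro pc_tab1 pc_intros pc_level_step)+
qed

lemma pc_coords: "\<lbrakk>ptime vs; ptime dm; ptime ps; ptime levs\<rbrakk> \<Longrightarrow> ptime (\<lambda>x. coords \<beta> m \<tau> (vs x) (dm x) (ps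
    x) (levs x))"
proof (rule pc_lift4[of "coords \<beta> m \<tau>"])
  show "ptime (\<lambda>z. coords \<beta> m \<tau> (fst z) (fst (snd z)) (fst (snd (snd z))) (snd (snd (snd z))))"
    unfolding coords_def
    by (rule pc_concat, rule pc_map_static, rule pc_concat, rule pc_map_static, rule pc_concat, rule
        pc_map_static)
       (intro pc_intros pc_coord)
qed

lemma pc_embed: "ptime (embed \<beta> m \<tau>)"
  unfolding embed_def by (intro pc_intros pc_lookup1 pc_coords pc_dists pc_powers)


section \<open>Bumps over one partition\<close>

lemma foldr_min_ge_iff: "(t::real) \<le> foldr min xs a \<longleftrightarrow> t \<le> a \<and> (\<forall>x\<in>set xs. t \<le> x)"
  by (induction xs) auto

lemma foldr_min_le: "foldr min xs a \<le> (a::real)" "x \<in> set xs \<Longrightarrow> foldr min xs a \<le> x"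
  using foldr_min_ge_iff[of "foldr min xs a" xs a] by auto

lemma foldr_max_le_iff: "foldr max xs a \<le> (t::real) \<longleftrightarrow> a \<le> t \<and> (\<forall>x\<in>set xs. x \<le> t)"
  by (induction xs) auto

lemma foldr_max_ge: "(a::real) \<le> foldr max xs a" "x \<in> set xs \<Longrightarrow> x \<le> foldr max xs a"
  using foldr_max_le_iff[of xs a "foldr max xs a"] by auto

lemma foldr_max_in: "foldr max xs (a::real) = a \<or> foldr max xs a \<in> set xs"
  by (induction xs) (auto simp: max_def)

lemma lookup1_tab1: "distinct vs \<Longrightarrow> v \<in> set vs \<Longrightarrow> lookup1 (tab1 vs h) v = h v"
proof -
  assume "distinct vs" "v \<in> set vs"
  have "lookup1 (tab1 vs h) v = (\<Sum>u\<leftarrow>vs. if u = v then h u else 0)"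
    by (simp only: lookup1_def tab1_def map_map o_def fst_conv snd_conv)
  also have "\<dots> = (\<Sum>u\<in>set vs. if u = v then h u else 0)"
    using \<open>distinct vs\<close> by (rule sum_list_distinct_conv_sum_set)
  finally show ?thesis using \<open>v \<in> set vs\<close> by simp
qed

lemma height_le: "height S w x \<le> max 0 (x - 2 * w)"
  by (auto simp: height_def)

lemma height_ge: "0 \<le> w \<Longrightarrow> x - 4 * w \<le> height S w x" "0 \<le> height S w x"
  by (auto simp: height_def)

lemma height_flat: "0 \<le> w \<Longrightarrow> S - w \<le> x \<Longrightarrow> x \<le> S + w \<Longrightarrow> height S w x = max 0 (S - 3 * w)"
  by (auto simp: height_def)

text \<open>If \<open>hx\<close> is positive, then \<open>x\<close> lies in a stretch where
  \<open>height S w\<close> is constant, at least \<open>w / 2\<close> away from its ends: around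
  \<open>S\<close>, or below \<open>2 * w\<close>, where the value is 0. A change of height
  therefore requires a move of at least \<open>w / 2\<close> that earns nothing, and this pays for
  the difference of \<open>hx\<close> and \<open>hy\<close>, which is at most \<open>w / 2\<close>.
  If both are 0, the profile alone is 1-Lipschitz.\<close>

lemma height_glue:
  assumes "0 < w" "\<bar>x - y\<bar> \<le> D" "\<bar>hx - hy\<bar> \<le> D" "0 \<le> hx" "0 \<le> hy" "hx \<le> w / 2" "hy \<le> w / 2"
    and "0 < hx \<Longrightarrow> x \<le> S" "0 < hx \<Longrightarrow> w < x \<Longrightarrow> S - w / 2 \<le> x"
    and "0 < hy \<Longrightarrow> y \<le> S" "0 < hy \<Longrightarrow> w < y \<Longrightarrow> S - w / 2 \<le> y"
  shows "\<bar>(hx + height S w x) - (hy + height S w y)\<bar> \<le> D"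
  using assms unfolding height_def by (cases "0 < hx"; cases "0 < hy"; smt (z3) field_sum_of_halves)

locale finite_pseudometric =
  fixes vs :: "nat list" and d :: "nat \<Rightarrow> nat \<Rightarrow> real"
  assumes distinct_vs: "distinct vs"
    and d_self: "u \<in> set vs \<Longrightarrow> d u u = 0"
    and d_sym: "u \<in> set vs \<Longrightarrow> v \<in> set vs \<Longrightarrow> d u v = d v u"
    and d_tri: "u \<in> set vs \<Longrightarrow> v \<in> set vs \<Longrightarrow> z \<in> set vs \<Longrightarrow> d u z \<le> d u v + d v z"
    and d_nonneg: "u \<in> set vs \<Longrightarrow> v \<in> set vs \<Longrightarrow> 0 \<le> d u v"
begin

definition clustering :: "real \<Rightarrow> nat list list \<Rightarrow> bool" where
  "clustering \<Delta> P \<longleftrightarrow> distinct P \<and> (\<forall>C\<in>set P. distinct C \<and> C \<noteq> [] \<and> (\<forall>x\<in>set C. x \<in> set vs \<and> (\<forall>y\<in>set C. d x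
      y \<le> \<Delta>))) \<and>
     (\<forall>v\<in>set vs. \<exists>C\<in>set P. v \<in> set C) \<and> (\<forall>C\<in>set P. \<forall>D\<in>set P. \<forall>v\<in>set C. v \<in> set D \<longrightarrow> C = D)"

lemma nbhd_size_card: "nbhd_size vs d r C = card {u \<in> set vs. \<exists>v\<in>set C. d u v \<le> r}"
proof -
  have "near d r C = (\<lambda>u. \<exists>v\<in>set C. d u v \<le> r)" by (auto simp: near_def list_ex_iff fun_eq_iff)
  then show ?thesis
    using distinct_length_filter[OF distinct_vs, of "near d r C"] by (simp add: nbhd_size_def Int_def
        conj_commute)
qed

lemma adj_iff: "adj d r C D \<longleftrightarrow> (\<exists>u\<in>set D. \<exists>v\<in>set C. d u v \<le> r)"
  by (simp add: adj_def near_def list_ex_iff)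

lemma depth_le: "depth vs d c C u \<le> c" "y \<in> set vs \<Longrightarrow> y \<notin> set C \<Longrightarrow> depth vs d c C u \<le> d u y"
  unfolding depth_def by (auto intro: foldr_min_le)

lemma depth_ge_iff: "t \<le> depth vs d c C u \<longleftrightarrow> t \<le> c \<and> (\<forall>y\<in>set vs - set C. t \<le> d u y)"
  unfolding depth_def foldr_min_ge_iff by auto

lemma depth_lip:
  assumes "u \<in> set vs" "v \<in> set vs" shows "\<bar>depth vs d c C u - depth vs d c C v\<bar> \<le> d u v"
proof -
  have "depth vs d c C u - d u v \<le> depth vs d c C v" if "u \<in> set vs" "v \<in> set vs" for u v
    unfolding depth_ge_iff
  proof (intro conjI ballI)
    show "depth vs d c C u - d u v \<le> c" using depth_le(1)[of c C u] d_nonneg[OF that] by linarith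
    fix y assume y: "y \<in> set vs - set C"
    then show "depth vs d c C u - d u v \<le> d v y"
      using depth_le(2)[of y C c u] d_tri[OF that, of y] by auto
  qed
  from this[OF assms] this[OF assms(2,1)] show ?thesis using d_sym[OF assms] by auto
qed

definition well_coded :: "real \<Rightarrow> coded \<Rightarrow> bool" where
  "well_coded \<Delta> cps \<longleftrightarrow> (\<forall>e\<in>set cps. distinct (fst e) \<and> (\<forall>x\<in>set (fst e). x \<in> set vs \<and> (\<forall>y\<in>set (fst e). d x
      y \<le> \<Delta>))) \<and>
     (\<forall>v\<in>set vs. \<exists>e\<in>set cps. v \<in> set (fst e)) \<and> (\<forall>e\<in>set cps. \<forall>e'\<in>set cps. \<forall>v\<in>set (fst e). v \<in> set (fst
         e') \<longrightarrow> e = e')"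

lemma entry_in:
  assumes "well_coded \<Delta> cps" "v \<in> set vs"
  shows "entry cps v \<in> set cps" "v \<in> set (fst (entry cps v))"
proof -
  obtain e where "e \<in> set cps" "v \<in> set (fst e)" using assms unfolding well_coded_def by blast
  then have "filter (\<lambda>e. v \<in> set (fst e)) cps \<noteq> []" by (auto simp: filter_empty_conv)
  then obtain e xs where e: "filter (\<lambda>e. v \<in> set (fst e)) cps = e # xs" by (cases "filter (\<lambda>e. v \<in> set
      (fst e)) cps") auto
  then have "e \<in> set (filter (\<lambda>e. v \<in> set (fst e)) cps)" by (simp only: list.set_intros)
  moreover have "entry cps v = e" by (simp add: entry_def hd_or_def e)
  ultimately show "entry cps v \<in> set cps" "v \<in> set (fst (entry cps v))" by (simp_all only: set_filter
      mem_Collect_eq)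
qed

lemma entry_eq:
  assumes "well_coded \<Delta> cps" "v \<in> set vs" "u \<in> set (fst (entry cps v))" shows "entry cps u = entry cps v"
proof -
  have "u \<in> set vs" using assms entry_in[OF assms(1,2)] unfolding well_coded_def by blast
  then show ?thesis using assms entry_in[OF assms(1)] unfolding well_coded_def by metis
qed

text \<open>The invariant carried through the scales of one coordinate. Its last conjunct makes
  active places scarce: a cluster with fewer than \<open>2 * q\<close> points has no room for two
  disjoint balls of this kind.\<close>

definition controlled :: "real \<Rightarrow> nat \<Rightarrow> (nat \<Rightarrow> real) \<Rightarrow> bool" where
  "controlled \<mu> q H \<longleftrightarrow> (\<forall>u\<in>set vs. \<forall>v\<in>set vs. \<bar>H u - H v\<bar> \<le> d u v) \<and>
     (\<forall>v\<in>set vs. 0 \<le> H v \<and> H v \<le> \<mu> \<and> (0 < H v \<longrightarrow> q \<le> card {u \<in> set vs. d v u \<le> 7 * \<mu>}))"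

lemma controlled_zero: "0 \<le> \<mu> \<Longrightarrow> controlled \<mu> q (\<lambda>_. 0)"
  by (simp add: controlled_def d_nonneg)

lemma controlled_mono:
  assumes "controlled \<mu> q H" "\<mu> \<le> \<mu>'" shows "controlled \<mu>' q H"
proof -
  have "card {u \<in> set vs. d v u \<le> 7 * \<mu>} \<le> card {u \<in> set vs. d v u \<le> 7 * \<mu>'}" for v
    using assms(2) by (intro card_mono) auto
  then show ?thesis using assms unfolding controlled_def by (meson order_trans)
qed

lemma controlled_cong: "(\<And>v. v \<in> set vs \<Longrightarrow> H v = H' v) \<Longrightarrow> controlled \<mu> q H = controlled \<mu> q H'"
  by (simp add: controlled_def)

text \<open>Here \<open>H\<close> is the sum over the smaller scales. From
  \<open>28 * \<mu> \<le> w\<close>, the ball of radius \<open>7 * \<mu>\<close> around an active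
  point deeper than \<open>w\<close> stays inside its cluster, and \<open>14 * \<mu>\<close> is at
  most the tolerance \<open>w / 2\<close> of \<open>height_glue\<close>.\<close>

context
  fixes \<beta> \<Delta> w \<mu> :: real and q :: nat and a :: bool and cps :: coded and H :: "nat \<Rightarrow> real"
  assumes \<beta>: "1 \<le> \<beta>" and \<Delta>: "0 < \<Delta>" and w: "w = \<Delta> / (20 * \<beta>)" and cps: "well_coded \<Delta> cps"
    and H: "controlled \<mu> q H" and \<mu>: "28 * \<mu> \<le> w"
begin

abbreviation "b v \<equiv> depth vs d (\<Delta> / \<beta>) (fst (entry cps v)) v"
abbreviation "S v \<equiv> plateau vs d (\<Delta> / \<beta>) H (fst (entry cps v))"
abbreviation "g \<equiv> bump \<beta> vs d \<Delta> a q cps H"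

lemma w_pos: "0 < w" "20 * w = \<Delta> / \<beta>" "20 * w \<le> \<Delta>"
proof -
  show "0 < w" using \<beta> \<Delta> by (simp add: w)
  show *: "20 * w = \<Delta> / \<beta>" by (simp add: w)
  show "20 * w \<le> \<Delta>" unfolding * using \<beta> \<Delta> by (simp add: field_simps)
qed

lemma H_facts: "u \<in> set vs \<Longrightarrow> 0 \<le> H u" "u \<in> set vs \<Longrightarrow> H u \<le> \<mu>" "u \<in> set vs \<Longrightarrow> v \<in> set vs \<Longrightarrow> \<bar>H u - H v\<bar> \<le> d u v"
  using H by (auto simp: controlled_def)

lemma entry_vs: "v \<in> set vs \<Longrightarrow> u \<in> set (fst (entry cps v)) \<Longrightarrow> u \<in> set vs"
  using entry_in[OF cps] cps unfolding well_coded_def by blast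

text \<open>Two balls with at least \<open>q\<close> points inside a cluster with fewer than \<open>2 * q\<close> points meet.\<close>

lemma active_close:
  assumes v: "v \<in> set vs" and r: "raised vs d \<Delta> a q (entry cps v)"
    and u: "u \<in> set (fst (entry cps v))" "0 < H u" "w < b u"
    and z: "z \<in> set (fst (entry cps v))" "0 < H z" "w < b z"
  shows "d u z \<le> 14 * \<mu>"
proof -
  let ?C = "set (fst (entry cps v))" and ?B = "\<lambda>u. {p \<in> set vs. d u p \<le> 7 * \<mu>}"
  have uz: "u \<in> set vs" "z \<in> set vs" using entry_vs[OF v] u z by auto
  have sub: "?B y \<subseteq> ?C" and card: "q \<le> card (?B y)" if y: "y \<in> ?C" "0 < H y" "w < b y" for y
  proof -
    have yv: "y \<in> set vs" using entry_vs[OF v y(1)] .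
    show "q \<le> card (?B y)" using H yv y(2) by (auto simp: controlled_def)
    show "?B y \<subseteq> ?C"
    proof
      fix p assume p: "p \<in> ?B y"
      show "p \<in> ?C"
      proof (rule ccontr)
        assume "p \<notin> ?C"
        then have "b y \<le> d y p" using p entry_eq[OF cps v y(1)] by (intro depth_le) auto
        then show False using p y(3) \<mu> w_pos H_facts[OF yv] by auto
      qed
    qed
  qed
  have "?B u \<inter> ?B z \<noteq> {}"
  proof
    assume "?B u \<inter> ?B z = {}"
    then have "card (?B u) + card (?B z) = card (?B u \<union> ?B z)" by (subst card_Un_disjoint) auto
    also have "\<dots> \<le> card ?C" using sub[OF u] sub[OF z] by (intro card_mono) auto
    also have "\<dots> < 2 * q" using r entry_in[OF cps v] cps by (auto simp: raised_def well_coded_def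
        distinct_card)
    finally show False using card[OF u] card[OF z] by simp
  qed
  then obtain p where "p \<in> set vs" "d u p \<le> 7 * \<mu>" "d z p \<le> 7 * \<mu>" by blast
  then show ?thesis using d_tri[of u p z] d_sym[of z p] uz by auto
qed

text \<open>\<open>v\<close> itself takes part in the maximum that defines the plateau. If the
  maximum is attained at a point \<open>z\<close> deeper than \<open>w\<close>, then
  \<open>v\<close> and \<open>z\<close> are within \<open>14 * \<mu>\<close> of each other and so
  are their depths; otherwise the plateau is not above \<open>w\<close>.\<close>

lemma plateau_bounds:
  assumes v: "v \<in> set vs" and r: "raised vs d \<Delta> a q (entry cps v)" and "0 < H v"
  shows "b v \<le> S v" "w < b v \<Longrightarrow> S v - w / 2 \<le> b v"
proof -
  let ?C = "fst (entry cps v)"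
  have vC: "v \<in> set ?C" using entry_in[OF cps v] by simp
  show "b v \<le> S v" unfolding plateau_def by (rule foldr_max_ge) (use vC \<open>0 < H v\<close> in auto)
  assume bv: "w < b v"
  consider "S v = 0" | z where "z \<in> set ?C" "0 < H z" "S v = depth vs d (\<Delta> / \<beta>) ?C z"
    using foldr_max_in[of "map (depth vs d (\<Delta> / \<beta>) ?C) (filter (\<lambda>u. 0 < H u) ?C)" 0] by (auto simp:
        plateau_def)
  then show "S v - w / 2 \<le> b v"
  proof cases
    case 1 then show ?thesis using bv w_pos by auto
  next
    case (2 z)
    have zv: "z \<in> set vs" using entry_vs[OF v 2(1)] .
    have Sz: "S v = b z" using 2 entry_eq[OF cps v 2(1)] by simp
    show ?thesis
    proof (cases "w < b z")
      case True
      have "d v z \<le> 14 * \<mu>" by (rule active_close[OF v r vC \<open>0 < H v\<close> bv 2(1,2) True])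
      then show ?thesis using depth_lip[OF v zv, of "\<Delta> / \<beta>" ?C] 2(3) \<mu> by auto
    qed (use Sz bv w_pos in auto)
  qed
qed

lemma bump_bounds: "0 \<le> g v" "g v \<le> max 0 (b v - 2 * w)"
  unfolding bump_def w[symmetric] using height_ge(2) height_le by auto

lemma other_entry:
  assumes "u \<in> set vs" "v \<in> set vs" "entry cps u \<noteq> entry cps v" shows "b u \<le> d u v"
  using assms entry_eq[OF cps assms(1), of v] by (intro depth_le) auto

text \<open>Inside one raised cluster the Lipschitz bound is \<open>height_glue\<close>. Across a
  boundary both depths are at most \<open>d u v\<close>, so a positive bump is at most
  \<open>d u v - 2 * w\<close>, and the \<open>2 * w\<close> leave room for the change of
  \<open>H\<close>.\<close>

lemma controlled_step: "controlled \<Delta> q (\<lambda>v. H v + g v)"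
  unfolding controlled_def
proof (intro conjI ballI impI)
  fix u v assume uv: "u \<in> set vs" "v \<in> set vs"
  show "\<bar>(H u + g u) - (H v + g v)\<bar> \<le> d u v"
  proof (cases "entry cps u = entry cps v")
    case True
    show ?thesis
    proof (cases "raised vs d \<Delta> a q (entry cps v)")
      case r: True
      have "\<bar>(H u + height (S v) w (b u)) - (H v + height (S v) w (b v))\<bar> \<le> d u v"
      proof (rule height_glue[OF w_pos(1)])
        show "\<bar>b u - b v\<bar> \<le> d u v" using depth_lip[OF uv] True by simp
        show "\<bar>H u - H v\<bar> \<le> d u v" "0 \<le> H u" "0 \<le> H v" by (intro H_facts uv)+
        show "H u \<le> w / 2" "H v \<le> w / 2"
          using H_facts(2)[OF uv(1)] H_facts(2)[OF uv(2)] H_facts(1)[OF uv(1)] \<mu> by auto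
        show "0 < H u \<Longrightarrow> b u \<le> S v" "0 < H u \<Longrightarrow> w < b u \<Longrightarrow> S v - w / 2 \<le> b u"
          using plateau_bounds[OF uv(1)] r True by auto
        show "0 < H v \<Longrightarrow> b v \<le> S v" "0 < H v \<Longrightarrow> w < b v \<Longrightarrow> S v - w / 2 \<le> b v"
          using plateau_bounds[OF uv(2) r] by auto
      qed
      then show ?thesis using r True by (simp add: bump_def w)
    next
      case False
      then show ?thesis using True H_facts(3)[OF uv] by (simp add: bump_def)
    qed
  next
    case False
    have "g u \<le> max 0 (d u v - 2 * w)" "g v \<le> max 0 (d u v - 2 * w)"
      using bump_bounds(2)[of u] bump_bounds(2)[of v] other_entry[OF uv False] other_entry[OF uv(2,1)]
      False d_sym[OF uv]
      by (smt (verit))+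
    then show ?thesis
      using bump_bounds(1)[of u] bump_bounds(1)[of v] H_facts(1,2)[OF uv(1)] H_facts(1,2)[OF uv(2)]
      H_facts(3)[OF uv] \<mu> w_pos
      by (auto simp: max_def split: if_splits)
  qed
next
  fix v assume v: "v \<in> set vs"
  show "0 \<le> H v + g v" using H_facts(1)[OF v] bump_bounds(1) by simp
  have "b v \<le> 20 * w" using depth_le(1) w_pos by simp
  then have "g v \<le> 18 * w" using bump_bounds(2)[of v] w_pos by auto
  then show "H v + g v \<le> \<Delta>" using H_facts(1,2)[OF v] \<mu> w_pos by auto
  assume pos: "0 < H v + g v"
  show "q \<le> card {u \<in> set vs. d v u \<le> 7 * \<Delta>}"
  proof (cases "0 < H v")
    case True
    have "\<mu> \<le> \<Delta>" using \<mu> w_pos H_facts(1,2)[OF v] by auto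
    from controlled_mono[OF H this] show ?thesis using True v by (auto simp: controlled_def)
  next
    case False
    let ?C = "fst (entry cps v)"
    have "raised vs d \<Delta> a q (entry cps v)" using False pos by (auto simp: bump_def split: if_splits)
    then have "q \<le> card {u \<in> set vs. \<exists>y\<in>set ?C. d u y \<le> 6 * \<Delta>}" by (simp add: raised_def nbhd_size_card)
    \<comment> \<open>The diameter of the cluster turns the radius \<open>6 * \<Delta>\<close>
      around the cluster into \<open>7 * \<Delta>\<close> around \<open>v\<close>.\<close>
    also have "\<dots> \<le> card {u \<in> set vs. d v u \<le> 7 * \<Delta>}"
    proof (intro card_mono subsetI CollectI conjI)
      fix u assume "u \<in> {u \<in> set vs. \<exists>y\<in>set ?C. d u y \<le> 6 * \<Delta>}"
      then obtain y where y: "u \<in> set vs" "y \<in> set ?C" "d u y \<le> 6 * \<Delta>" by blast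
      have "y \<in> set vs" using entry_vs[OF v y(2)] .
      moreover have "d v y \<le> \<Delta>" using cps entry_in[OF cps v] y(2) by (auto simp: well_coded_def)
      ultimately show "d v u \<le> 7 * \<Delta>" using y d_tri[OF v, of y u] d_sym[of u y] by auto
    qed auto
    finally show ?thesis .
  qed
qed

text \<open>The purpose of the plateau: the depth of an active \<open>x\<close> lies well inside a
  flat stretch of the profile, and a move by \<open>2 * \<mu>\<close> cannot leave it. Across a
  boundary both depths are at most \<open>2 * \<mu>\<close>, where all bumps vanish.\<close>

lemma bump_const:
  assumes "x \<in> set vs" "y \<in> set vs" "0 < H x" "d x y \<le> 2 * \<mu>" shows "g x = g y"
proof (cases "entry cps x = entry cps y")
  case True
  show ?thesis
  proof (cases "raised vs d \<Delta> a q (entry cps x)")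
    case r: True
    have b: "\<bar>b x - b y\<bar> \<le> w / 14" using depth_lip[OF assms(1,2), of "\<Delta> / \<beta>" "fst (entry cps y)"] True
        assms(4) \<mu> by auto
    have "height (S x) w (b x) = height (S x) w (b y)"
    proof (cases "w < b x")
      case True
      have "b x \<le> S x" "S x - w / 2 \<le> b x" using plateau_bounds[OF assms(1) r assms(3)] True by auto
      then show ?thesis using b[unfolded abs_le_iff] w_pos by (subst (1 2) height_flat) auto
    next
      case False
      then show ?thesis using b[unfolded abs_le_iff] w_pos height_le[of "S x" w "b x"] height_le[of "S
      x" w "b y"]
          height_ge(2)[of "S x" w "b x"] height_ge(2)[of "S x" w "b y"] by auto
    qed
    then show ?thesis using True r by (simp add: bump_def w)
  qed (use True in \<open>simp add: bump_def\<close>)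
next
  case False
  then show ?thesis
    using bump_bounds[of x] bump_bounds[of y] other_entry[OF assms(1,2)] other_entry[OF assms(2,1)]
        d_sym[OF assms(1,2)]
      assms(4) \<mu> w_pos by (auto simp: max_def split: if_splits)
qed

text \<open>The padded point has full depth \<open>20 * w\<close>; the profile takes away at most
  \<open>4 * w\<close> and the smaller scales at most \<mu>, so at least \<open>15 * w\<close>
  remain.\<close>

lemma bump_separates:
  assumes xy: "x \<in> set vs" "y \<in> set vs"
    and "raised vs d \<Delta> a q (entry cps x)" "\<not> raised vs d \<Delta> a q (entry cps y)"
    and "\<And>u. u \<in> set vs \<Longrightarrow> u \<notin> set (fst (entry cps x)) \<Longrightarrow> \<Delta> / \<beta> \<le> d x u"
  shows "3 / 4 * (\<Delta> / \<beta>) \<le> (H x + g x) - (H y + g y)"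
proof -
  have "b x = 20 * w" using assms(5) w_pos depth_le(1)[of "\<Delta> / \<beta>" "fst (entry cps x)" x] depth_ge_iff[of
      "\<Delta> / \<beta>" "\<Delta> / \<beta>" "fst (entry cps x)" x]
    by auto
  then have "16 * w \<le> height (S x) w (b x)" using height_ge(1)[of w "b x" "S x"] w_pos by auto
  then have "16 * w \<le> g x" using assms(3) by (simp add: bump_def w)
  moreover have "g y = 0" using assms(4) by (simp add: bump_def)
  ultimately show ?thesis using H_facts(1,2)[OF xy(1)] H_facts(1,2)[OF xy(2)] \<mu> unfolding
      w_pos(2)[symmetric] by auto
qed

end

end


section \<open>Separating the clusters of one partition\<close>

definition pow2s :: "nat \<Rightarrow> nat list" where
  "pow2s L = rev (map (\<lambda>i. 2 ^ i) [0..<L])"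

lemma pow2s_Suc: "pow2s (Suc L) = 2 ^ L # pow2s L"
  by (simp add: pow2s_def)

lemma in_pow2s: "q \<in> set (pow2s L) \<longleftrightarrow> (\<exists>i<L. q = 2 ^ i)"
  by (auto simp: pow2s_def)

lemma mass_simps [simp]: "mass [] = 0" "mass (e # A) = length (fst e) + mass A"
  by (simp_all add: mass_def)

lemma mass_filter: "mass (filter P A) + mass (filter (\<lambda>e. \<not> P e) A) = mass A"
  by (induction A) auto

lemma length_le_mass: "e \<in> set A \<Longrightarrow> length (fst e) \<le> mass A"
  by (induction A) auto

text \<open>The kept part is always the lighter one, so its mass is below \<open>2 ^ L\<close> when
  the powers below \<open>2 ^ L\<close> are left, and since clusters are nonempty, nothing survives
  the last power. An entry is dropped at a \<open>q\<close> with
  \<open>q \<le> mass A < 2 * q\<close>, which yields both size conditions. \<open>N\<close>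
  remembers the original mass while \<open>A\<close> shrinks.\<close>

lemma code_word_aux:
  assumes "mass A < 2 ^ L" "mass A \<le> N" "\<And>e. e \<in> set A \<Longrightarrow> fst e \<noteq> []" "\<And>p. p \<in> set W \<Longrightarrow> 2 ^ L \<le> p"
    "e \<in> set A"
  shows "\<exists>q\<in>set (pow2s L). (q \<in> set (snd (foldl code_step (A, W) (pow2s L)))) \<noteq> (q \<in> set (snd e)) \<and>
      length (fst e) < 2 * q \<and> q \<le> N"
    (is "\<exists>q\<in>_. ?P A W q L")
  using assms
proof (induction L arbitrary: A W)
  case 0
  then have "length (fst e) \<le> 0" using length_le_mass[of e A] by simp
  then show ?case using 0 by simp
next
  case (Suc L)
  \<comment> \<open>Only smaller powers are added later, so the decision made at \<open>p\<close> is
    final.\<close>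
  have keep: "p \<in> set (snd (foldl code_step (B, V) (pow2s K))) \<longleftrightarrow> p \<in> set V" if "2 ^ K \<le> p" for p B V K
    using that
  proof (induction K arbitrary: B V)
    case (Suc K)
    have "2 ^ K < p" using Suc.prems by (rule less_le_trans[rotated]) simp
    then show ?case using Suc.IH[of "fst (code_step (B, V) (2 ^ K))" "snd (code_step (B, V) (2 ^ K))"]
      by (auto simp: pow2s_Suc code_step_def Let_def)
  qed (simp add: pow2s_def)
  define A' W' where "A' = fst (code_step (A, W) (2 ^ L))" and "W' = snd (code_step (A, W) (2 ^ L))"
  have step: "foldl code_step (A, W) (pow2s (Suc L)) = foldl code_step (A', W') (pow2s L)"
    by (simp add: pow2s_Suc A'_def W'_def)
  have mass: "mass A' < 2 ^ L" "mass A' \<le> mass A" and sub: "set A' \<subseteq> set A"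
    using Suc.prems(1) mass_filter[of "\<lambda>e. 2 ^ L \<in> set (snd e)" A]
    by (auto simp: A'_def code_step_def Let_def)
  have W': "2 ^ L \<le> p" if "p \<in> set W'" for p
    using that Suc.prems(4)[of p] by (auto simp: W'_def code_step_def Let_def split: if_splits)
  show ?case
  proof (cases "e \<in> set A'")
    case True
    have "\<exists>q\<in>set (pow2s L). ?P A' W' q L"
      by (rule Suc.IH[OF mass(1) _ _ W' True]) (use mass Suc.prems sub in auto)
    then show ?thesis unfolding step by (auto simp: pow2s_Suc)
  next
    case False
    have W: "2 ^ L \<notin> set W" using Suc.prems(4)[of "2 ^ L"] by auto
    have "2 ^ L \<le> mass A \<and> (2 ^ L \<in> set W') \<noteq> (2 ^ L \<in> set (snd e))"
      using False Suc.prems(5) W by (auto simp: A'_def W'_def code_step_def Let_def split: if_splits)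
    moreover have "length (fst e) < 2 * 2 ^ L"
      using length_le_mass[OF Suc.prems(5)] Suc.prems(1) by simp
    ultimately show ?thesis unfolding step
      using keep[of L "2 ^ L" A' W'] Suc.prems(2) by (intro bexI[of _ "2 ^ L"]) (auto simp: pow2s_Suc)
  qed
qed

lemma code_word_separates:
  assumes "mass A < 2 ^ L" "\<And>e. e \<in> set A \<Longrightarrow> fst e \<noteq> []" "e \<in> set A"
  shows "\<exists>q\<in>set (pow2s L). (q \<in> set (code_word (pow2s L) A)) \<noteq> (q \<in> set (snd e)) \<and> length (fst e) < 2 *
      q \<and> q \<le> mass A"
  unfolding code_word_def using code_word_aux[OF assms(1) order_refl assms(2) _ assms(3), of "[]"] by auto

lemma by_size_set:
  assumes "\<And>C. C \<in> set P \<Longrightarrow> C \<noteq> [] \<and> length C < 2 ^ L" shows "set (by_size (pow2s L) P) = set P"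
proof -
  have "\<exists>i<L. 2 ^ i \<le> n \<and> n < 2 * 2 ^ i" if "0 < n" "n < 2 ^ L" for n :: nat
    using that(2)
  proof (induction L)
    case 0
    then show ?case using that by simp
  next
    case (Suc L)
    then show ?case by (cases "n < 2 ^ L") (auto simp: less_Suc_eq)
  qed
  note * = this
  show ?thesis
  proof (intro equalityI subsetI)
    fix C assume C: "C \<in> set P"
    then obtain i where "i < L" "2 ^ i \<le> length C" "length C < 2 * 2 ^ i"
      using *[of "length C"] assms by auto
    then show "C \<in> set (by_size (pow2s L) P)" using C by (auto simp: by_size_def pow2s_def)
  qed (auto simp: by_size_def)
qed

lemma by_size_Suc: "by_size (pow2s (Suc L)) P = filter (\<lambda>C. 2 ^ L \<le> length C \<and> length C < 2 * 2 ^ L) P @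
    by_size (pow2s L) P"
  by (simp add: by_size_def pow2s_Suc)

lemma by_size_less: "C \<in> set (by_size (pow2s L) P) \<Longrightarrow> length C < 2 ^ L"
proof (induction L)
  case (Suc L)
  then show ?case by (auto simp: by_size_Suc)
qed (simp add: by_size_def pow2s_def)

lemma by_size_distinct: "distinct P \<Longrightarrow> distinct (by_size (pow2s L) P)"
proof (induction L)
  case (Suc L)
  then show ?case using by_size_less[of _ L P] by (fastforce simp: by_size_Suc)
qed (simp add: by_size_def pow2s_def)

lemma by_size_sorted:
  "sorted_wrt (\<lambda>D C. \<forall>i. length D < 2 ^ i \<longrightarrow> length C < 2 ^ i) (by_size (pow2s L) P)"
proof (induction L)
  case (Suc L)
  have "length C < 2 ^ i" if "2 ^ L \<le> length D" "length D < 2 ^ i" "length C < 2 ^ Suc L" for C D ::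
      "nat list" and i
  proof -
    have "(2::nat) ^ L < 2 ^ i" using that by linarith
    then have "Suc L \<le> i" by (simp add: Suc_leI)
    then have "(2::nat) ^ Suc L \<le> 2 ^ i" by (rule power_increasing) simp
    then show ?thesis using that by linarith
  qed
  moreover have "sorted_wrt (\<lambda>_ _. True) xs" for xs :: "nat list list" by (simp add:
      sorted_wrt_iff_nth_less)
  moreover have "sorted_wrt (\<lambda>D C. \<forall>i. length D < 2 ^ i \<longrightarrow> length C < 2 ^ i)
     (filter (\<lambda>C. 2 ^ L \<le> length C \<and> length C < 2 * 2 ^ L) P)"
    by (rule sorted_wrt_mono_rel[of _ "\<lambda>_ _. True"]) (use calculation in auto)
  ultimately show ?case using Suc by_size_less[of _ L P] by (fastforce simp: by_size_Suc sorted_wrt_append)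
qed (simp add: by_size_def pow2s_def)

context finite_pseudometric
begin

text \<open>Both clusters meet the size conditions at \<open>q\<close> and have different bits
  there: for either value of \<open>a\<close> exactly one of them is raised.\<close>

definition tells_apart :: "real \<Rightarrow> nat \<Rightarrow> nat list \<times> nat list \<Rightarrow> nat list \<times> nat list \<Rightarrow> bool" where
  "tells_apart \<Delta> q e e' \<longleftrightarrow> (\<forall>a. raised vs d \<Delta> a q e = (a = (q \<in> set (snd e))) \<and>
     raised vs d \<Delta> a q e' = (a = (q \<in> set (snd e'))) \<and> (q \<in> set (snd e)) \<noteq> (q \<in> set (snd e')))"

definition separated :: "real \<Rightarrow> nat list \<Rightarrow> coded \<Rightarrow> bool" where
  "separated \<Delta> ps cps \<longleftrightarrow> (\<forall>e\<in>set cps. \<forall>e'\<in>set cps. fst e \<noteq> fst e' \<longrightarrow> adj d (2 * \<Delta>) (fst e) (fst e') \<longrightarrow>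
     (\<exists>q\<in>set ps. tells_apart \<Delta> q e e'))"

lemma separatedD:
  assumes "separated \<Delta> ps cps" "e \<in> set cps" "e' \<in> set cps" "fst e \<noteq> fst e'" "adj d (2 * \<Delta>) (fst e) (fst
      e')"
  obtains q a where "q \<in> set ps" "raised vs d \<Delta> a q e" "\<not> raised vs d \<Delta> a q e'"
proof -
  obtain q where "q \<in> set ps" and q: "tells_apart \<Delta> q e e'"
    using assms unfolding separated_def by metis
  show thesis by (rule that[OF \<open>q \<in> set ps\<close>, of "q \<in> set (snd e)"]) (use q in \<open>auto simp: tells_apart_def\<close>)
qed

lemma adj_sym: "set C \<subseteq> set vs \<Longrightarrow> set D \<subseteq> set vs \<Longrightarrow> adj d r C D = adj d r D C"
  unfolding adj_iff using d_sym by (metis subsetD)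

text \<open>As clusters are disjoint, the mass is a number of points. A point of a neighbour of
  \<open>C\<close> is within \<open>\<Delta> + 2 * \<Delta>\<close> of a point of \<open>C\<close>,
  and from there it is at most another \<open>\<Delta> + 2 * \<Delta>\<close> to any second
  neighbour \<open>D\<close>. This is the origin of the radius \<open>6 * \<Delta>\<close>.\<close>

lemma mass_le_nbhd:
  assumes P: "clustering \<Delta> P" and A: "distinct (map fst A)" "fst ` set A \<subseteq> set P"
    and C: "C \<in> set P" "\<And>e. e \<in> set A \<Longrightarrow> adj d (2 * \<Delta>) C (fst e)"
    and D: "D = C \<or> D \<in> fst ` set A" and \<Delta>: "0 < \<Delta>"
  shows "mass A \<le> nbhd_size vs d (6 * \<Delta>) D"
proof -
  have in_vs: "x \<in> set vs" if "x \<in> set E" "E \<in> set P" for x E using P that unfolding clustering_def by blast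
  have diam: "d x y \<le> \<Delta>" if "x \<in> set E" "y \<in> set E" "E \<in> set P" for x y E using P that unfolding
      clustering_def by blast
  have "mass A = (\<Sum>E\<in>fst ` set A. card (set E))"
  proof -
    have "mass A = sum_list (map length (map fst A))" by (simp add: mass_def o_def)
    also have "\<dots> = (\<Sum>E\<in>set (map fst A). length E)" using A(1) by (rule sum_list_distinct_conv_sum_set)
    also have "\<dots> = (\<Sum>E\<in>fst ` set A. card (set E))"
      using A(2) P by (intro sum.cong) (auto simp: clustering_def distinct_card)
    finally show ?thesis .
  qed
  also have "\<dots> = card (\<Union>E\<in>fst ` set A. set E)"
  proof (rule card_UN_disjoint[symmetric])
    have "x = y" if "x \<in> set P" "y \<in> set P" "v \<in> set x" "v \<in> set y" for x y v
      using P that unfolding clustering_def by blast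
    then show "\<forall>i\<in>fst ` set A. \<forall>j\<in>fst ` set A. i \<noteq> j \<longrightarrow> set i \<inter> set j = {}"
      using A(2) by (meson disjoint_iff subsetD)
  qed auto
  also have "\<dots> \<le> card {u \<in> set vs. \<exists>v\<in>set D. d u v \<le> 6 * \<Delta>}"
  proof (intro card_mono subsetI CollectI conjI)
    fix p assume "p \<in> (\<Union>E\<in>fst ` set A. set E)"
    then obtain e where e: "e \<in> set A" "p \<in> set (fst e)" by blast
    then have eP: "fst e \<in> set P" using A(2) by auto
    show pv: "p \<in> set vs" using in_vs e eP by blast
    obtain u v where uv: "u \<in> set (fst e)" "v \<in> set C" "d u v \<le> 2 * \<Delta>" using C(2)[OF e(1)] by (auto
        simp: adj_iff)
    have vv: "u \<in> set vs" "v \<in> set vs" using in_vs uv eP C(1) by auto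
    have 1: "d p v \<le> 3 * \<Delta>" using d_tri[OF pv vv] diam[OF e(2) uv(1) eP] uv(3) by linarith
    show "\<exists>v\<in>set D. d p v \<le> 6 * \<Delta>"
    proof (cases "D = C")
      case True
      then show ?thesis using 1 uv(2) \<Delta> by (intro bexI[of _ v]) auto
    next
      case False
      then obtain e' where e': "e' \<in> set A" "D = fst e'" using D by auto
      then have "D \<in> set P" using A(2) by auto
      obtain u' v' where uv': "u' \<in> set D" "v' \<in> set C" "d u' v' \<le> 2 * \<Delta>" using C(2)[OF e'(1)] e'(2) by
      (auto simp: adj_iff)
      have vv': "u' \<in> set vs" "v' \<in> set vs" using in_vs uv' \<open>D \<in> set P\<close> C(1) by auto
      have "d p u' \<le> 6 * \<Delta>"
        using 1 d_tri[OF pv vv(2) vv'(1)] d_tri[OF vv(2) vv'(2,1)] diam[OF uv(2) uv'(2) C(1)] uv'(3)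
        d_sym[OF vv'] by linarith
      then show ?thesis using uv'(1) by blast
    qed
  qed auto
  finally show ?thesis by (simp add: nbhd_size_card)
qed

lemma code_correct:
  assumes P: "clustering \<Delta> P" and L: "length vs < 2 ^ L" and \<Delta>: "0 < \<Delta>"
  shows "well_coded \<Delta> (code d (2 * \<Delta>) (pow2s L) P)" "separated \<Delta> (pow2s L) (code d (2 * \<Delta>) (pow2s L) P)"
    "fst ` set (code d (2 * \<Delta>) (pow2s L) P) = set P"
proof -
  let ?ps = "pow2s L"
  let ?f = "\<lambda>A C. (C, code_word ?ps (filter (\<lambda>e. adj d (2 * \<Delta>) C (fst e)) A)) # A"
  have card: "card (set vs) = length vs" using distinct_vs by (rule distinct_card)
  have fst: "map fst (foldl ?f [] Cs) = rev Cs" for Cs by (induction Cs rule: rev_induct) auto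
  have len: "C \<noteq> [] \<and> length C < 2 ^ L" if "C \<in> set P" for C
  proof -
    have "length C = card (set C)" using P that by (auto simp: clustering_def distinct_card)
    also have "\<dots> \<le> card (set vs)" using P that by (intro card_mono) (auto simp: clustering_def)
    finally show ?thesis using L card P that by (auto simp: clustering_def)
  qed
  have set: "set (by_size ?ps P) = set P" by (rule by_size_set) (rule len)
  have "distinct P" using P by (simp add: clustering_def)
  show fset: "fst ` set (code d (2 * \<Delta>) ?ps P) = set P"
    using arg_cong[OF fst[of "by_size ?ps P"], of set] set by (simp add: code_def)
  have dist: "distinct (map fst (code d (2 * \<Delta>) ?ps P))"
    unfolding code_def fst using by_size_distinct[OF \<open>distinct P\<close>] by simp
  show "well_coded \<Delta> (code d (2 * \<Delta>) ?ps P)"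
    unfolding well_coded_def
  proof (intro conjI ballI impI)
    fix v assume "v \<in> set vs"
    then obtain C where "C \<in> set P" "v \<in> set C" using P unfolding clustering_def by blast
    then show "\<exists>e\<in>set (code d (2 * \<Delta>) ?ps P). v \<in> set (fst e)" using fset by (metis imageE)
  next
    fix e e' v assume e: "e \<in> set (code d (2 * \<Delta>) ?ps P)" "e' \<in> set (code d (2 * \<Delta>) ?ps P)" "v \<in> set
        (fst e)" "v \<in> set (fst e')"
    have "fst e \<in> set P" "fst e' \<in> set P" using fset e by auto
    then have "fst e = fst e'" using e P unfolding clustering_def by blast
    then show "e = e'" using e dist by (auto simp: distinct_map dest: inj_onD)
  qed (use P fset in \<open>auto simp: clustering_def\<close>)
  \<comment> \<open>Induction over the order of processing: a new cluster has to be compared only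
    with those coded before it, since adjacency and \<open>tells_apart\<close> are
    symmetric.\<close>
  have "separated \<Delta> ?ps (foldl ?f [] Cs)"
    if "distinct Cs" "set Cs \<subseteq> set P" "sorted_wrt (\<lambda>D C. \<forall>i. length D < 2 ^ i \<longrightarrow> length C < 2 ^ i) Cs" for Cs
    using that
  proof (induction Cs rule: rev_induct)
    case Nil
    then show ?case by (simp add: separated_def)
  next
    case (snoc C Cs)
    define A where "A = foldl ?f [] Cs"
    define A0 where "A0 = filter (\<lambda>e. adj d (2 * \<Delta>) C (fst e)) A"
    define e0 where "e0 = (C, code_word ?ps A0)"
    have IH: "separated \<Delta> ?ps A" unfolding A_def by (rule snoc.IH) (use snoc.prems in \<open>auto simp:
        sorted_wrt_append\<close>)
    have fA: "map fst A = rev Cs" unfolding A_def by (rule fst)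
    have fA0: "fst ` set A = set Cs" using arg_cong[OF fA, of set] by simp
    have A0: "distinct (map fst A0)" "fst ` set A0 \<subseteq> set P" "C \<in> set P"
      using snoc.prems fA fA0 by (auto simp: A0_def intro!: distinct_map_filter)
    have mass: "mass A0 \<le> nbhd_size vs d (6 * \<Delta>) D" if "D = C \<or> D \<in> fst ` set A0" for D
      by (rule mass_le_nbhd[OF P A0(1,2,3) _ that \<Delta>]) (simp add: A0_def)
    have "nbhd_size vs d (6 * \<Delta>) C \<le> length vs" by (simp add: nbhd_size_def)
    then have mL: "mass A0 < 2 ^ L" using mass[of C] L by simp
    have sep: "\<exists>q\<in>set ?ps. tells_apart \<Delta> q e0 e" if e: "e \<in> set A" "adj d (2 * \<Delta>) C (fst e)" for e
    proof -
      have eA: "e \<in> set A0" using e by (simp add: A0_def)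
      have ne: "fst x \<noteq> []" if "x \<in> set A0" for x using that A0(2) len by auto
      obtain q where q: "q \<in> set ?ps" "(q \<in> set (code_word ?ps A0)) \<noteq> (q \<in> set (snd e))" "length (fst e)
      < 2 * q" "q \<le> mass A0"
        using code_word_separates[OF mL ne eA] by blast
      \<comment> \<open>The order of processing is expressed by comparisons with powers of two, and
        \<open>2 * q\<close> is one: the size condition of the earlier \<open>e\<close> passes to
        \<open>C\<close>.\<close>
      obtain i where "2 * q = 2 ^ i" using q(1) by (metis in_pow2s power_Suc)
      moreover have "fst e \<in> set Cs" using e(1) fA0 by auto
      ultimately have "length C < 2 * q" using snoc.prems(3) q(3) by (auto simp: sorted_wrt_append)
      moreover have "q \<le> nbhd_size vs d (6 * \<Delta>) C" "q \<le> nbhd_size vs d (6 * \<Delta>) (fst e)"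
        using mass[of C] mass[of "fst e"] q(4) eA by auto
      ultimately show ?thesis using q by (intro bexI[of _ q]) (auto simp: tells_apart_def raised_def e0_def)
    qed
    have "separated \<Delta> ?ps (e0 # A)"
      unfolding separated_def
    proof (intro ballI impI)
      fix e e' assume e: "e \<in> set (e0 # A)" "e' \<in> set (e0 # A)" "fst e \<noteq> fst e'" "adj d (2 * \<Delta>) (fst e)
      (fst e')"
      have sub: "set (fst x) \<subseteq> set vs" if "x \<in> set (e0 # A)" for x
        using that fA0 snoc.prems(2) P by (auto simp: e0_def clustering_def)
      consider "e = e0" "e' \<in> set A" | "e \<in> set A" "e' = e0" | "e \<in> set A" "e' \<in> set A" using e by auto
      then show "\<exists>q\<in>set ?ps. tells_apart \<Delta> q e e'"
      proof cases
        case 1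
        then show ?thesis using sep[of e'] e(4) by (auto simp: e0_def)
      next
        case 2
        then have "adj d (2 * \<Delta>) C (fst e)" using e(4) adj_sym[OF sub sub, of e e0] by (auto simp: e0_def)
        then show ?thesis using sep[of e] 2 by (auto simp: tells_apart_def)
      next
        case 3
        then show ?thesis using IH e unfolding separated_def by blast
      qed
    qed
    then show ?case by (simp add: A_def A0_def e0_def)
  qed
  from this[of "by_size ?ps P"] show "separated \<Delta> ?ps (code d (2 * \<Delta>) ?ps P)"
    unfolding code_def using by_size_distinct[OF \<open>distinct P\<close>] by_size_sorted set by simp
qed

end


section \<open>Superposing the scales\<close>

lemma powers_eq:
  assumes "vs \<noteq> []"
  obtains L where "powers vs = pow2s (Suc L)" "length vs < 2 ^ Suc L" "2 ^ L \<le> length vs"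
proof -
  let ?F = "foldl (\<lambda>ps _. if 2 * hd_or 1 ps \<le> length vs then 2 * hd_or 1 ps # ps else ps) [1]"
  \<comment> \<open>The case \<open>L = length xs\<close> means that doubling has not stopped yet.
    As \<open>length vs < 2 ^ length vs\<close>, this cannot last for \<open>length vs\<close>
    rounds.\<close>
  have "\<exists>L. ?F xs = pow2s (Suc L) \<and> 2 ^ L \<le> length vs \<and> (L = length xs \<or> length vs < 2 ^ Suc L)" for xs
      :: "nat list"
  proof (induction xs rule: rev_induct)
    case Nil
    then show ?case using assms by (intro exI[of _ 0]) (auto simp: pow2s_def Suc_le_eq)
  next
    case (snoc x xs)
    then obtain L where L: "?F xs = pow2s (Suc L)" "2 ^ L \<le> length vs" "L = length xs \<or> length vs < 2 ^
        Suc L" by blast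
    have h: "hd_or 1 (pow2s (Suc L)) = 2 ^ L" by (simp add: pow2s_Suc hd_or_def)
    show ?case
    proof (cases "2 * 2 ^ L \<le> length vs")
      case True
      then show ?thesis using L h by (intro exI[of _ "Suc L"]) (auto simp: pow2s_Suc hd_or_def)
    next
      case False
      then show ?thesis using L h by (intro exI[of _ L]) auto
    qed
  qed
  from this[of vs] obtain L where "powers vs = pow2s (Suc L)" "2 ^ L \<le> length vs" "L = length vs \<or>
      length vs < 2 ^ Suc L"
    unfolding powers_def by blast
  moreover have "length vs < 2 ^ Suc (length vs)" by (rule less_trans[OF less_exp]) simp
  ultimately show thesis using that by blast
qed

definition nxt :: "nat \<Rightarrow> nat \<Rightarrow> nat" where
  "nxt m r = (if r + 1 = m then 0 else r + 1)"

text \<open>The largest scale comes first because \<open>scales\<close> puts each new one in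
  front.\<close>

definition scale_chain :: "nat \<Rightarrow> (nat \<times> real) list \<Rightarrow> bool" where
  "scale_chain m xs \<longleftrightarrow> (\<forall>i. Suc i < length xs \<longrightarrow> fst (xs ! i) = nxt m (fst (xs ! Suc i)) \<and> 6/5 * snd (xs !
      Suc i) \<le> snd (xs ! i)) \<and>
     (\<forall>x\<in>set xs. 0 < snd x \<and> (0 < m \<longrightarrow> fst x < m))"

lemma scale_chain_Cons:
  "scale_chain m (x # xs) \<longleftrightarrow> scale_chain m xs \<and> 0 < snd x \<and> (0 < m \<longrightarrow> fst x < m) \<and>
     (xs \<noteq> [] \<longrightarrow> fst x = nxt m (fst (hd xs)) \<and> 6/5 * snd (hd xs) \<le> snd x)"
proof -
  have "(\<forall>i. Suc i < length (x # xs) \<longrightarrow> Q ((x # xs) ! i) ((x # xs) ! Suc i)) \<longleftrightarrow>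
      (xs \<noteq> [] \<longrightarrow> Q x (hd xs)) \<and> (\<forall>i. Suc i < length xs \<longrightarrow> Q (xs ! i) (xs ! Suc i))" for Q
  proof -
    have "(\<forall>i. R i) \<longleftrightarrow> R 0 \<and> (\<forall>i. R (Suc i))" for R :: "nat \<Rightarrow> bool" by (metis not0_implies_Suc)
    from this[of "\<lambda>i. Suc i < length (x # xs) \<longrightarrow> Q ((x # xs) ! i) ((x # xs) ! Suc i)"] show ?thesis
      by (cases xs) auto
  qed
  from this[of "\<lambda>a b. fst a = nxt m (fst b) \<and> 6/5 * snd b \<le> snd a"] show ?thesis
    unfolding scale_chain_def by auto
qed

text \<open>The classes rotate with period \<open>m\<close>, so two scales of one class are at least
  \<open>m\<close> positions apart and differ by a factor of at least
  \<open>(6/5) ^ m\<close>.\<close>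

lemma scale_chain_sorted:
  assumes "scale_chain m xs" "0 < m" "K \<le> (6/5) ^ m"
  shows "sorted_wrt (\<lambda>a b. fst a = fst b \<longrightarrow> K * snd b \<le> snd a) xs"
  unfolding sorted_wrt_iff_nth_less
proof (intro allI impI)
  have pos: "0 < snd (xs ! i) \<and> fst (xs ! i) < m" if "i < length xs" for i
    using assms(1,2) that by (auto simp: scale_chain_def)
  have *: "(6/5) ^ k * snd (xs ! (i + k)) \<le> snd (xs ! i) \<and> fst (xs ! i) = (fst (xs ! (i + k)) + k) mod m"
    if "i + k < length xs" for i k
    using that
  proof (induction k)
    case 0
    then show ?case using pos[of i] by simp
  next
    case (Suc k)
    have s: "fst (xs ! (i + k)) = nxt m (fst (xs ! Suc (i + k)))" "6/5 * snd (xs ! Suc (i + k)) \<le> snd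
        (xs ! (i + k))"
      using assms(1) Suc.prems by (auto simp: scale_chain_def)
    have "(6/5) ^ Suc k * snd (xs ! (i + Suc k)) = (6/5) ^ k * (6/5 * snd (xs ! Suc (i + k)))" by simp
    also have "\<dots> \<le> (6/5) ^ k * snd (xs ! (i + k))" using s(2) by (intro mult_left_mono) auto
    also have "\<dots> \<le> snd (xs ! i)" using Suc by simp
    finally have 1: "(6/5) ^ Suc k * snd (xs ! (i + Suc k)) \<le> snd (xs ! i)" .
    have "nxt m r = (r + 1) mod m" if "r < m" for r using that by (auto simp: nxt_def)
    then have "fst (xs ! (i + k)) = (fst (xs ! (i + Suc k)) + 1) mod m" using s(1) pos[of "Suc (i + k)"]
        Suc.prems by simp
    then have "(fst (xs ! (i + k)) + k) mod m = (fst (xs ! (i + Suc k)) + Suc k) mod m" by (simp add: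
        mod_simps)
    then show ?case using 1 Suc by simp
  qed
  fix i j assume ij: "i < j" "j < length xs" "fst (xs ! i) = fst (xs ! j)"
  define k where "k = j - i"
  have k: "j = i + k" "0 < k" using ij by (auto simp: k_def)
  have "(fst (xs ! j) + k) mod m = fst (xs ! j) mod m" using *[of i k] k ij pos[of j] by simp
  then have "m dvd k" by (simp add: mod_eq_dvd_iff_nat)
  then have "m \<le> k" using k by (auto dest: dvd_imp_le)
  then have "K \<le> (6/5) ^ k" by (intro order_trans[OF assms(3) power_increasing]) auto
  then have "K * snd (xs ! j) \<le> (6/5) ^ k * snd (xs ! j)" using pos[of j] ij by (intro mult_right_mono) auto
  then show "K * snd (xs ! j) \<le> snd (xs ! i)" using *[of i k] k ij by simp
qed

lemma foldr_min_in: "foldr min xs (a::real) = a \<or> foldr min xs a \<in> set xs"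
  by (induction xs) (auto simp: min_def)

lemma scales_correct:
  shows scales_chain: "scale_chain m (scales m ds)"
    and scales_cover: "t \<in> set ds \<Longrightarrow> 0 < t \<Longrightarrow> \<exists>x\<in>set (scales m ds). snd x < t \<and> t \<le> 3/2 * snd x"
proof -
  let ?F = "foldl (\<lambda>st _. scale_step m ds st) (0, 0, [])"
  \<comment> \<open>The last conjunct shows that \<open>length ds\<close> rounds suffice: after
    \<open>k\<close> rounds at most \<open>length ds - k\<close> distances are still unserved, in
    natural number subtraction. Each round with a candidate removes at least that candidate.\<close>
  define ok where "ok = (\<lambda>k st. case st of (bnd, r, acc) \<Rightarrow> scale_chain m acc \<and>
     (if acc = [] then bnd = 0 \<and> r = 0 else bnd = 3/2 * snd (hd acc) \<and> r = nxt m (fst (hd acc))) \<and>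
     (\<forall>t\<in>set ds. 0 < t \<longrightarrow> t \<le> bnd \<longrightarrow> (\<exists>x\<in>set acc. snd x < t \<and> t \<le> 3/2 * snd x)) \<and>
     card {t \<in> set ds. bnd < t} + k \<le> max k (length ds))"
  have "ok (length xs) (?F xs)" for xs :: "real list"
  proof (induction xs rule: rev_induct)
    case Nil
    have "card {t \<in> set ds. 0 < t} \<le> card (set ds)" by (rule card_mono) auto
    also have "\<dots> \<le> length ds" by (rule card_length)
    finally show ?case by (auto simp: ok_def scale_chain_def)
  next
    case (snoc y xs)
    obtain bnd r acc where st: "?F xs = (bnd, r, acc)" by (metis prod_cases3)
    have st': "?F (xs @ [y]) = scale_step m ds (bnd, r, acc)" by (simp add: st)
    note IH = snoc[unfolded st ok_def prod.case]
    define cand where "cand = filter (\<lambda>t. bnd < t) ds"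
    define a where "a = foldr min cand (hd_or 0 cand)"
    show ?case
    proof (cases "cand = []")
      case True
      then have "\<forall>t\<in>set ds. \<not> bnd < t" by (auto simp: cand_def filter_empty_conv)
      then have "{t \<in> set ds. bnd < t} = {}" by auto
      then have c: "card {t \<in> set ds. bnd < t} + length (xs @ [y]) \<le> max (length (xs @ [y])) (length ds)"
        by (simp only: card.empty)
      have F: "?F (xs @ [y]) = (bnd, r, acc)"
        unfolding st' using True by (simp add: scale_step_def Let_def cand_def[symmetric] isnil_def)
      show ?thesis unfolding F ok_def prod.case using IH c by blast
    next
      case False
      have a: "a \<in> set cand" using foldr_min_in[of cand "hd_or 0 cand"] False by (cases cand) (auto
      simp: a_def hd_or_def)
      have amin: "a \<le> t" if "t \<in> set ds" "bnd < t" for t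
        unfolding a_def by (rule foldr_min_le) (use that in \<open>auto simp: cand_def\<close>)
      have ab: "a \<in> set ds" "bnd < a" using a by (auto simp: cand_def)
      have b0: "0 \<le> bnd" using IH by (cases acc) (auto simp: scale_chain_Cons)
      have step: "?F (xs @ [y]) = (6/5 * a, nxt m r, (r, 4/5 * a) # acc)"
        unfolding st' using False by (simp add: scale_step_def Let_def cand_def[symmetric]
        a_def[symmetric] isnil_def nxt_def)
      have "r < m" if "0 < m" using IH that by (cases acc) (auto simp: scale_chain_Cons nxt_def)
      then have chain: "scale_chain m ((r, 4/5 * a) # acc)"
        using IH ab b0 by (auto simp: scale_chain_Cons split: if_splits)
      have cov: "\<exists>x\<in>set ((r, 4/5 * a) # acc). snd x < t \<and> t \<le> 3/2 * snd x" if "t \<in> set ds" "0 < t" "t \<le>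
      6/5 * a" for t
        using IH that amin[of t] ab b0 by (cases "t \<le> bnd") auto
      have "{t \<in> set ds. 6/5 * a < t} \<subset> {t \<in> set ds. bnd < t}"
      proof (rule psubsetI)
        show "{t \<in> set ds. 6/5 * a < t} \<subseteq> {t \<in> set ds. bnd < t}"
        proof (intro subsetI CollectI conjI)
          fix t assume "t \<in> {t \<in> set ds. 6/5 * a < t}"
          then have "6/5 * a < t" by simp
          then show "bnd < t" using ab b0 by linarith
        qed auto
        have "a \<in> {t \<in> set ds. bnd < t}" "a \<notin> {t \<in> set ds. 6/5 * a < t}" using ab b0 by auto
        then show "{t \<in> set ds. 6/5 * a < t} \<noteq> {t \<in> set ds. bnd < t}" by metis
      qed
      then have "card {t \<in> set ds. 6/5 * a < t} < card {t \<in> set ds. bnd < t}" by (intro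
      psubset_card_mono) auto
      then show ?thesis unfolding step ok_def prod.case using chain cov IH by auto
    qed
  qed
  from this[of ds] obtain bnd r acc where F: "?F ds = (bnd, r, acc)" and ok: "ok (length ds) (bnd, r, acc)"
    by (metis prod_cases3)
  have acc: "scales m ds = acc" by (simp add: scales_def F)
  show "scale_chain m (scales m ds)" using ok by (simp add: ok_def acc)
  have "{t \<in> set ds. bnd < t} = {}" using ok by (simp add: ok_def)
  then show "t \<in> set ds \<Longrightarrow> 0 < t \<Longrightarrow> \<exists>x\<in>set (scales m ds). snd x < t \<and> t \<le> 3/2 * snd x"
    using ok by (force simp: ok_def acc)
qed

context finite_pseudometric
begin

context
  fixes \<beta> :: real and dm :: "(nat \<times> nat \<times> real) list" and L r j :: nat
  assumes \<beta>: "1 \<le> \<beta>" and dm: "d = lookup2 dm" and L: "length vs < 2 ^ L"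
begin

definition good_level :: "nat \<times> real \<times> cover \<Rightarrow> bool" where
  "good_level l \<longleftrightarrow> 0 < fst (snd l) \<and> clustering (fst (snd l)) (nth_or_nil j (snd (snd l)))"

text \<open>Here the smallest scale comes first. If \<mu> is an earlier scale of the class,
  \<open>560 = 28 * 20\<close> gives \<open>28 * \<mu> \<le> \<Delta> / (20 * \<beta>)\<close>, as
  the bump lemmas require.\<close>

definition good_levels :: "(nat \<times> real \<times> cover) list \<Rightarrow> bool" where
  "good_levels levs \<longleftrightarrow> (\<forall>l\<in>set levs. good_level l) \<and>
     sorted_wrt (\<lambda>l l'. fst l = fst l' \<longrightarrow> 560 * \<beta> * fst (snd l) \<le> fst (snd l')) levs"

abbreviation "crd q a levs \<equiv> lookup1 (coord \<beta> vs dm (pow2s L) r j a q levs)"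

abbreviation "cod l \<equiv> code d (2 * fst (snd l)) (pow2s L) (nth_or_nil j (snd (snd l)))"

lemma crd_snoc:
  "v \<in> set vs \<Longrightarrow> crd q a (levs @ [l]) v =
     (if fst l = r then crd q a levs v + bump \<beta> vs d (fst (snd l)) a q (cod l) (crd q a levs) v else crd
         q a levs v)"
  by (simp add: coord_def level_step_def lookup1_tab1[OF distinct_vs] dm)

lemma good_levels_snoc: "good_levels (levs @ [l]) \<longleftrightarrow>
    good_levels levs \<and> good_level l \<and> (\<forall>l'\<in>set levs. fst l' = fst l \<longrightarrow> 28 * fst (snd l') \<le> fst (snd l) /
        (20 * \<beta>))"
  using \<beta> by (auto simp: good_levels_def sorted_wrt_append field_simps)

lemma crd_controlled:
  assumes "good_levels levs" "0 \<le> \<mu>" "\<And>l. l \<in> set levs \<Longrightarrow> fst l = r \<Longrightarrow> fst (snd l) \<le> \<mu>"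
  shows "controlled \<mu> q (crd q a levs)"
  using assms
proof (induction levs arbitrary: \<mu> rule: rev_induct)
  case Nil
  have "controlled \<mu> q (crd q a []) = controlled \<mu> q (\<lambda>_. 0)"
    by (rule controlled_cong) (simp add: coord_def lookup1_tab1[OF distinct_vs])
  then show ?case using Nil controlled_zero by simp
next
  case (snoc l levs)
  show ?case
  proof (cases "fst l = r")
    case False
    have "controlled \<mu> q (crd q a (levs @ [l])) = controlled \<mu> q (crd q a levs)"
      by (rule controlled_cong) (simp add: crd_snoc False)
    then show ?thesis using snoc by (simp add: good_levels_snoc)
  next
    case True
    let ?\<Delta> = "fst (snd l)" and ?\<mu> = "fst (snd l) / (20 * \<beta>) / 28"
    have g: "0 < ?\<Delta>" "clustering ?\<Delta> (nth_or_nil j (snd (snd l)))" using snoc.prems(1) by (auto simp: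
        good_levels_snoc good_level_def)
    have "controlled ?\<mu> q (crd q a levs)"
      using snoc.prems(1) True g(1) \<beta> by (intro snoc.IH) (auto simp: good_levels_snoc)
    from controlled_step[OF \<beta> g(1) refl code_correct(1)[OF g(2) L g(1)] this, of a]
    have "controlled ?\<Delta> q (\<lambda>v. crd q a levs v + bump \<beta> vs d ?\<Delta> a q (cod l) (crd q a levs) v)" by simp
    then have "controlled ?\<Delta> q (crd q a (levs @ [l]))"
      by (subst controlled_cong[where H'="\<lambda>v. crd q a levs v + bump \<beta> vs d ?\<Delta> a q (cod l) (crd q a levs)
      v"])
         (simp_all add: crd_snoc True)
    then show ?thesis by (rule controlled_mono) (use snoc.prems True in auto)
  qed
qed

lemma crd_lip:
  assumes "good_levels levs" "u \<in> set vs" "v \<in> set vs" shows "\<bar>crd q a levs u - crd q a levs v\<bar> \<le> d u v"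
proof -
  have "fst (snd l) \<le> (\<Sum>l\<in>set levs. \<bar>fst (snd l)\<bar>)" if "l \<in> set levs" for l
    using member_le_sum[of l "set levs" "\<lambda>l. \<bar>fst (snd l)\<bar>"] that by auto
  then have "controlled (\<Sum>l\<in>set levs. \<bar>fst (snd l)\<bar>) q (crd q a levs)"
    by (intro crd_controlled assms) (auto intro: sum_nonneg)
  then show ?thesis using assms by (simp add: controlled_def)
qed

end

text \<open>Some bit tells the clusters of \<open>x\<close> and \<open>y\<close> apart, which opens
  the gap at the scale of \<open>l\<close>. The gap makes the sum positive at \<open>x\<close>, so
  \<open>x\<close> is active for every later scale, and by \<open>bump_const\<close> later bumps
  agree at \<open>x\<close> and \<open>y\<close>. Hence the gap is kept without loss.\<close>

lemma crd_separates:
  assumes \<beta>: "1 \<le> \<beta>" and dm: "d = lookup2 dm" and L: "length vs < 2 ^ L"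
    and levs: "good_levels \<beta> j (ys @ l # zs)"
    and xy: "x \<in> set vs" "y \<in> set vs" "fst (snd l) < d x y" "d x y \<le> 3/2 * fst (snd l)"
    and C: "C \<in> set (nth_or_nil j (snd (snd l)))" "{u \<in> set vs. d x u \<le> fst (snd l) / \<beta>} \<subseteq> set C"
  obtains q a where "q \<in> set (pow2s L)"
    "3/4 * (fst (snd l) / \<beta>) \<le> lookup1 (coord \<beta> vs dm (pow2s L) (fst l) j a q (ys @ l # zs)) x -
       lookup1 (coord \<beta> vs dm (pow2s L) (fst l) j a q (ys @ l # zs)) y"
proof -
  let ?\<Delta> = "fst (snd l)" and ?P = "nth_or_nil j (snd (snd l))"
  let ?cps = "code d (2 * ?\<Delta>) (pow2s L) ?P"
  have split: "good_levels \<beta> j (ys @ [l])" using levs \<beta> by (auto simp: good_levels_def[OF \<beta> dm L]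
      sorted_wrt_append)
  then have g: "0 < ?\<Delta>" "clustering ?\<Delta> ?P" by (auto simp: good_levels_snoc[OF \<beta> dm L] good_level_def[OF
      \<beta> dm L])
  note code = code_correct[OF g(2) L g(1)]
  let ?e = "entry ?cps x" and ?e' = "entry ?cps y"
  have e: "?e \<in> set ?cps" "x \<in> set (fst ?e)" "?e' \<in> set ?cps" "y \<in> set (fst ?e')"
    using entry_in[OF code(1)] xy by auto
  have "x \<in> set C" using C(2) xy(1) d_self[OF xy(1)] g(1) \<beta> by auto
  then have eC: "fst ?e = C" using e code(3) C(1) g(2) unfolding clustering_def by blast
  have "y \<notin> set C" using xy(3) \<open>x \<in> set C\<close> C(1) g(2) unfolding clustering_def by fastforce
  then have ne: "fst ?e \<noteq> fst ?e'" using e eC by auto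
  \<comment> \<open>The scale serves distances up to \<open>3/2 * \<Delta>\<close>, within the
    radius \<open>2 * \<Delta>\<close> of adjacency.\<close>
  have "adj d (2 * ?\<Delta>) (fst ?e) (fst ?e')"
    unfolding adj_iff using e xy g(1) d_sym[OF xy(1,2)] by (intro bexI[of _ y] bexI[of _ x]) auto
  then obtain q a where q: "q \<in> set (pow2s L)" "raised vs d ?\<Delta> a q ?e" "\<not> raised vs d ?\<Delta> a q ?e'"
    using separatedD[OF code(2) e(1,3) ne] by metis
  let ?H = "\<lambda>levs. lookup1 (coord \<beta> vs dm (pow2s L) (fst l) j a q levs)"
  define \<eta> where "\<eta> = 3/4 * (?\<Delta> / \<beta>)"
  have \<eta>: "0 < \<eta>" using g(1) \<beta> by (simp add: \<eta>_def)
  have "\<eta> \<le> ?H (ys @ l # zs') x - ?H (ys @ l # zs') y" if "good_levels \<beta> j (ys @ l # zs')" for zs'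
    using that
  proof (induction zs' rule: rev_induct)
    case Nil
    have "controlled (?\<Delta> / (20 * \<beta>) / 28) q (?H ys)"
      by (rule crd_controlled[OF \<beta> dm L]) (use split g(1) \<beta> in \<open>auto simp: good_levels_snoc[OF \<beta> dm L]\<close>)
    from bump_separates[OF \<beta> g(1) refl code(1) this _ xy(1,2) q(2,3)]
    have "\<eta> \<le> (?H ys x + bump \<beta> vs d ?\<Delta> a q ?cps (?H ys) x) - (?H ys y + bump \<beta> vs d ?\<Delta> a q ?cps (?H ys) y)"
      using C(2) eC by (force simp: \<eta>_def)
    then show ?case using crd_snoc[OF \<beta> dm L] xy by simp
  next
    case (snoc l' zs')
    let ?\<Delta>' = "fst (snd l')" and ?levs = "ys @ l # zs'"
    have lv: "good_levels \<beta> j (?levs @ [l'])" using snoc.prems by simp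
    have IH: "\<eta> \<le> ?H ?levs x - ?H ?levs y"
      by (rule snoc.IH) (use lv in \<open>simp only: good_levels_snoc[OF \<beta> dm L]\<close>)
    have sn: "?H (?levs @ [l']) v = (if fst l' = fst l then ?H ?levs v + bump \<beta> vs d ?\<Delta>' a q
        (code d (2 * ?\<Delta>') (pow2s L) (nth_or_nil j (snd (snd l')))) (?H ?levs) v else ?H ?levs v)" if "v
        \<in> set vs" for v
      by (rule crd_snoc[OF \<beta> dm L that])
    show ?case
    proof (cases "fst l' = fst l")
      case False
      then show ?thesis using IH sn[OF xy(1)] sn[OF xy(2)] by simp
    next
      case True
      have g': "0 < ?\<Delta>'" "clustering ?\<Delta>' (nth_or_nil j (snd (snd l')))" and gl: "good_levels \<beta> j ?levs"
        and small: "\<forall>l''\<in>set ?levs. fst l'' = fst l' \<longrightarrow> 28 * fst (snd l'') \<le> ?\<Delta>' / (20 * \<beta>)"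
        using lv unfolding good_levels_snoc[OF \<beta> dm L] good_level_def[OF \<beta> dm L] by auto
      let ?\<mu> = "?\<Delta>' / (20 * \<beta>) / 28"
      have ctrl: "controlled ?\<mu> q (?H ?levs)"
        by (rule crd_controlled[OF \<beta> dm L gl]) (use small True g' \<beta> in auto)
      have "0 < ?H ?levs x" using IH \<eta> ctrl xy by (force simp: controlled_def)
      moreover have "d x y \<le> 2 * ?\<mu>" using small True xy(4) g(1) by auto
      ultimately have "bump \<beta> vs d ?\<Delta>' a q (code d (2 * ?\<Delta>') (pow2s L) (nth_or_nil j (snd (snd l'))))
      (?H ?levs) x =
          bump \<beta> vs d ?\<Delta>' a q (code d (2 * ?\<Delta>') (pow2s L) (nth_or_nil j (snd (snd l')))) (?H ?levs) y"
        by (intro bump_const[OF \<beta> g'(1) refl code_correct(1)[OF g'(2) L g'(1)] ctrl _ xy(1,2)]) auto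
      then show ?thesis using IH sn[OF xy(1)] sn[OF xy(2)] True by simp
    qed
  qed
  from this[OF levs] show thesis using that[OF q(1)] by (simp add: \<eta>_def)
qed

end


section \<open>Shortest path distances\<close>

lemma walk_length_simps [simp]: "walk_length G [a] = 0" "walk_length G (a # b # p) = weight G {a, b} +
    walk_length G (b # p)"
  by (simp_all add: walk_length_def)

lemma walk_length_append: "p \<noteq> [] \<Longrightarrow> walk_length G (p @ q) = walk_length G p + walk_length G (last p # q)"
proof (induction p)
  case (Cons a p)
  then show ?case by (cases p; cases q) auto
qed simp

lemma walk_length_rev: "walk_length G (rev p) = walk_length G p"
proof (induction p rule: induct_list012)
  case (3 a b p)
  have "walk_length G (rev (a # b # p)) = walk_length G (rev (b # p) @ [a])" by simp
  also have "\<dots> = walk_length G (rev (b # p)) + weight G {b, a}" by (subst walk_length_append) auto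
  finally show ?case using 3 by (simp add: insert_commute)
qed simp_all

lemma walk_length_nonneg:
  assumes "\<forall>e\<in>edges G. 0 \<le> weight G e" shows "successively (\<lambda>a b. {a, b} \<in> edges G) p \<Longrightarrow> 0 \<le> walk_length G p"
proof (induction p rule: induct_list012)
  case 1
  show ?case by (simp add: walk_length_def)
qed (use assms in auto)

lemma walks_append:
  assumes "p \<in> walks G u v" "q \<in> walks G v z"
  shows "p @ tl q \<in> walks G u z" "walk_length G (p @ tl q) = walk_length G p + walk_length G q"
proof -
  obtain q' where q: "q = v # q'" using assms(2) by (cases q) (auto simp: walks_def)
  show "p @ tl q \<in> walks G u z"
    using assms by (auto simp: q walks_def successively_append_iff successively_Cons last_append)
  show "walk_length G (p @ tl q) = walk_length G p + walk_length G q"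
    using assms walk_length_append[of p G q'] by (auto simp: q walks_def)
qed

text \<open>Cutting out the closed piece between two visits to a vertex does not lengthen a walk, as
  weights are nonnegative.\<close>

lemma ex_distinct_walk:
  assumes "\<forall>e\<in>edges G. 0 \<le> weight G e" "p \<in> walks G u v"
  shows "\<exists>p'\<in>walks G u v. distinct p' \<and> walk_length G p' \<le> walk_length G p"
  using assms(2)
proof (induction "length p" arbitrary: p rule: less_induct)
  case less
  show ?case
  proof (cases "distinct p")
    case False
    then obtain xs ys zs a where p: "p = xs @ [a] @ ys @ [a] @ zs" using not_distinct_decomp by blast
    let ?p = "xs @ [a] @ zs"
    have suc: "successively (\<lambda>a b. {a, b} \<in> edges G) ((xs @ [a]) @ ys @ a # zs)"
      using less.prems by (simp add: p walks_def)
    have "successively (\<lambda>a b. {a, b} \<in> edges G) (xs @ [a])"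
      using suc unfolding successively_append_iff by blast
    moreover have "successively (\<lambda>a b. {a, b} \<in> edges G) (a # zs)"
      using suc unfolding successively_append_iff by (metis append.assoc successively_append_iff)
    ultimately have "successively (\<lambda>a b. {a, b} \<in> edges G) ?p"
      by (auto simp: successively_append_iff)
    moreover have "hd ?p = hd p" "last ?p = last p" by (cases xs; simp add: p) (cases zs; simp add: p)
    moreover have "hd p = u" "last p = v" "set p \<subseteq> verts G" using less.prems by (simp_all add: walks_def)
    moreover have "set ?p \<subseteq> set p" by (auto simp: p)
    ultimately have "?p \<in> walks G u v" unfolding walks_def mem_Collect_eq
      by (metis append_is_Nil_conv list.distinct(1) order_trans)
    moreover have "walk_length G ?p \<le> walk_length G p"
    proof -
      have s: "successively (\<lambda>a b. {a, b} \<in> edges G) (a # ys @ [a])"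
      proof -
        have "successively (\<lambda>a b. {a, b} \<in> edges G) (xs @ (a # ys @ [a]) @ zs)" using suc by simp
        then show ?thesis unfolding successively_append_iff[of _ xs] successively_append_iff[of _ "a #
        ys @ [a]"] by blast
      qed
      have "walk_length G p = walk_length G ((xs @ [a]) @ (ys @ [a] @ zs))" by (simp add: p)
      also have "\<dots> = walk_length G (xs @ [a]) + walk_length G (a # ys @ [a] @ zs)" by (subst
      walk_length_append) auto
      also have "walk_length G (a # ys @ [a] @ zs) = walk_length G ((a # ys @ [a]) @ zs)" by simp
      also have "\<dots> = walk_length G (a # ys @ [a]) + walk_length G (a # zs)" by (subst
      walk_length_append) auto
      finally have "walk_length G p = walk_length G (xs @ [a]) + (walk_length G (a # ys @ [a]) +
      walk_length G (a # zs))" .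
      moreover have "walk_length G ?p = walk_length G (xs @ [a]) + walk_length G (a # zs)"
        using walk_length_append[of "xs @ [a]" G zs] by simp
      ultimately show ?thesis using walk_length_nonneg[OF assms(1) s] by simp
    qed
    ultimately show ?thesis using less.hyps[of ?p] by (force simp: p)
  qed (use less.prems in auto)
qed

lemma walk_length_le:
  assumes "\<forall>e\<in>edges G. weight G e \<le> M" "0 \<le> M"
  shows "successively (\<lambda>a b. {a, b} \<in> edges G) p \<Longrightarrow> walk_length G p \<le> real (length p) * M"
proof (induction p rule: induct_list012)
  case (3 a b p)
  then have "weight G {a, b} \<le> M" using assms by simp
  then show ?case using 3 by (simp add: algebra_simps)
qed (use assms in \<open>auto simp: walk_length_def\<close>)

section \<open>The shortest path pseudometric of a graph\<close>

locale connected_weighted =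
  fixes G :: wgraph
  assumes wg: "weighted_graph G" and conn: "connected_graph G"
begin

lemma weight_nonneg: "\<forall>e\<in>edges G. 0 \<le> weight G e" and finite_verts: "finite (verts G)"
  using wg by (auto simp: weighted_graph_def)

lemma walks_ne: "u \<in> verts G \<Longrightarrow> v \<in> verts G \<Longrightarrow> walks G u v \<noteq> {}"
  using conn by (simp add: connected_graph_def)

lemma walk_nonneg: "p \<in> walks G u v \<Longrightarrow> 0 \<le> walk_length G p"
  using walk_length_nonneg[OF weight_nonneg] by (simp add: walks_def)

lemma gdist_le: "p \<in> walks G u v \<Longrightarrow> gdist G u v \<le> walk_length G p"
  unfolding gdist_def by (rule cINF_lower) (auto intro!: bdd_belowI2[of _ 0] walk_nonneg)

lemma gdist_ge: "u \<in> verts G \<Longrightarrow> v \<in> verts G \<Longrightarrow> (\<And>p. p \<in> walks G u v \<Longrightarrow> c \<le> walk_length G p) \<Longrightarrow> c \<le> gdist G u v"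
  unfolding gdist_def by (rule cINF_greatest) (auto dest: walks_ne)

lemma gdist_nonneg: "u \<in> verts G \<Longrightarrow> v \<in> verts G \<Longrightarrow> 0 \<le> gdist G u v"
  by (rule gdist_ge) (auto intro: walk_nonneg)

lemma gdist_self: "u \<in> verts G \<Longrightarrow> gdist G u u = 0"
  using gdist_le[of "[u]" u u] gdist_nonneg[of u u] by (simp add: walks_def)

lemma gdist_sym: assumes "u \<in> verts G" "v \<in> verts G" shows "gdist G u v = gdist G v u"
proof -
  have "gdist G u v \<le> gdist G v u" if "u \<in> verts G" "v \<in> verts G" for u v
  proof (rule gdist_ge[OF that(2,1)])
    fix p assume "p \<in> walks G v u"
    then have "rev p \<in> walks G u v" by (auto simp: walks_def hd_rev last_rev insert_commute)
    then show "gdist G u v \<le> walk_length G p" using gdist_le[of "rev p" u v] by (simp add: walk_length_rev)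
  qed
  then show ?thesis using assms by (simp add: antisym)
qed

lemma gdist_tri:
  assumes "u \<in> verts G" "v \<in> verts G" "z \<in> verts G" shows "gdist G u z \<le> gdist G u v + gdist G v z"
proof -
  have "gdist G u z - walk_length G p \<le> gdist G v z" if p: "p \<in> walks G u v" for p
    by (rule gdist_ge[OF assms(2,3)]) (use gdist_le[OF walks_append(1)[OF p]] walks_append(2)[OF p] in
        force)
  then have "gdist G u z - gdist G v z \<le> gdist G u v" by (intro gdist_ge assms) force
  then show ?thesis by simp
qed

lemma gdist_edge: "{u, v} \<in> edges G \<Longrightarrow> u \<in> verts G \<Longrightarrow> v \<in> verts G \<Longrightarrow> gdist G u v \<le> weight G {u, v}"
  using gdist_le[of "[u, v]" u v] by (simp add: walks_def)

end

section \<open>Correctness of the computed distances\<close>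

lemma lookup2_tab2:
  assumes "distinct vs" "u \<in> set vs" "v \<in> set vs" shows "lookup2 (tab2 vs h) u v = h u v"
proof -
  have *: "(\<Sum>x\<leftarrow>vs. if x = y then k x else 0) = k y" if "y \<in> set vs" for y and k :: "nat \<Rightarrow> real"
  proof -
    have "(\<Sum>x\<leftarrow>vs. if x = y then k x else 0) = (\<Sum>x\<in>set vs. if x = y then k x else 0)"
      using assms(1) by (rule sum_list_distinct_conv_sum_set)
    then show ?thesis using that by simp
  qed
  have "lookup2 (tab2 vs h) u v = (\<Sum>x\<leftarrow>vs. (\<Sum>y\<leftarrow>vs. if x = u \<and> y = v then h x y else 0))"
  proof -
    have "sum_list (concat (map f xs)) = (\<Sum>x\<leftarrow>xs. sum_list (f x))" for f :: "nat \<Rightarrow> real list" and xs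
      by (induction xs) auto
    then show ?thesis unfolding lookup2_def tab2_def map_concat map_map o_def fst_conv snd_conv by simp
  qed
  also have "\<dots> = (\<Sum>x\<leftarrow>vs. if x = u then (\<Sum>y\<leftarrow>vs. if y = v then h x y else 0) else 0)"
    by (intro arg_cong[where f=sum_list] map_cong) auto
  also have "\<dots> = h u v" using *[OF assms(2)] *[OF assms(3)] by simp
  finally show ?thesis .
qed

locale presented_graph = connected_weighted +
  fixes vs :: "nat list" and es0 :: "(nat \<times> nat) list" and g :: graph_data
  assumes dvs: "distinct vs" and vs: "set vs = verts G" and es: "set (map (\<lambda>(a, b). {a, b}) es0) = edges G"
    and g: "g = (vs, map (\<lambda>(a, b). [real a, real b, weight G {a, b}]) es0)"
begin

lemma edge_weight_list: "map edge_weight (snd g) = map (\<lambda>(a, b). weight G {a, b}) es0"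
  by (auto simp: g edge_weight_def hd_or_def)

text \<open>A walk without repetitions has at most as many edges as there are vertices, and none of
  them is heavier than the total weight.\<close>

lemma far_ge:
  assumes "u \<in> verts G" "v \<in> verts G" shows "gdist G u v \<le> far g"
proof -
  obtain p where "p \<in> walks G u v" "distinct p"
    using ex_distinct_walk[OF weight_nonneg] walks_ne[OF assms] by blast
  define M where "M = sum_list (map edge_weight (snd g))"
  have M: "M = (\<Sum>(a, b)\<leftarrow>es0. weight G {a, b})" by (simp only: M_def edge_weight_list)
  have nn: "0 \<le> weight G {a, b}" if "(a, b) \<in> set es0" for a b
    using that es weight_nonneg by force
  have le: "\<forall>e\<in>edges G. weight G e \<le> M"
  proof
    fix e assume "e \<in> edges G"
    then obtain a b where ab: "(a, b) \<in> set es0" "e = {a, b}" unfolding es[symmetric] by auto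
    have "(\<lambda>(a, b). weight G {a, b}) (a, b) \<le> M" unfolding M
      by (rule member_le_sum_list) (use ab nn in auto)
    then show "weight G e \<le> M" using ab by simp
  qed
  have "0 \<le> M" unfolding M by (rule sum_list_nonneg) (use nn in auto)
  have "length p = card (set p)" using \<open>distinct p\<close> by (simp add: distinct_card)
  also have "\<dots> \<le> card (verts G)" using \<open>p \<in> walks G u v\<close> finite_verts by (intro card_mono) (auto simp:
      walks_def)
  finally have "length p \<le> length vs" using distinct_card[OF dvs, unfolded vs] by simp
  have "gdist G u v \<le> real (length p) * M"
    using gdist_le[OF \<open>p \<in> walks G u v\<close>] walk_length_le[OF le \<open>0 \<le> M\<close>, of p] \<open>p \<in> walks G u v\<close>
    by (auto simp: walks_def)
  also have "\<dots> \<le> real (length vs) * M" using \<open>length p \<le> length vs\<close> \<open>0 \<le> M\<close> by (intro mult_right_mono) auto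
  finally show ?thesis by (simp add: far_def M_def g)
qed

lemma hop_ge:
  assumes "u \<in> verts G" "v \<in> verts G" shows "gdist G u v \<le> hop g u v"
  unfolding hop_def foldr_min_ge_iff
proof (intro conjI ballI)
  fix x assume "x \<in> set (map edge_weight (filter (\<lambda>e. joins e u v \<or> joins e v u) (snd g)))"
  then obtain a b where ab: "(a, b) \<in> set es0" "x = weight G {a, b}" "{a, b} = {u, v}"
    by (auto simp: g joins_def edge_weight_def hd_or_def insert_commute)
  moreover have "{a, b} \<in> edges G" using ab(1) unfolding es[symmetric] by force
  ultimately show "gdist G u v \<le> x" using gdist_edge[of u v] assms by auto
qed (rule far_ge[OF assms])

lemma hop_le: assumes "{u, v} \<in> edges G" shows "hop g u v \<le> weight G {u, v}"
proof -
  obtain a b where ab: "(a, b) \<in> set es0" "{u, v} = {a, b}" using assms unfolding es[symmetric] by auto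
  let ?e = "[real a, real b, weight G {a, b}]"
  have "?e \<in> set (snd g)" using ab by (force simp: g)
  moreover have "joins ?e u v \<or> joins ?e v u" using ab(2) by (auto simp: joins_def hd_or_def
      doubleton_eq_iff)
  moreover have "edge_weight ?e = weight G {u, v}" using ab(2) by (simp add: edge_weight_def hd_or_def)
  ultimately show ?thesis unfolding hop_def by (intro foldr_min_le(2)) force
qed

lemma dists_correct:
  assumes "u \<in> verts G" "v \<in> verts G" shows "lookup2 (dists g) u v = gdist G u v"
proof -
  define D where "D k = (relax g ^^ k) (tab2 vs (\<lambda>u v. if u = v then 0 else far g))" for k
  have "foldl (\<lambda>a _. f a) a xs = (f ^^ length xs) a" for f :: "'x \<Rightarrow> 'x" and a and xs :: "nat list"
    by (induction xs arbitrary: a) (auto simp: funpow_swap1)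
  note fold = this
  have fg: "fst g = vs" by (simp add: g)
  have D: "dists g = D (length vs)" unfolding dists_def D_def fg by (rule fold)
  have step: "lookup2 (D (Suc k)) u v = foldr min (map (\<lambda>z. hop g u z + lookup2 (D k) z v) vs) (lookup2
      (D k) u v)"
    if "u \<in> verts G" "v \<in> verts G" for k u v
    unfolding D_def funpow.simps o_apply relax_def fg by (intro lookup2_tab2 dvs) (simp_all add: vs that)
  have zero: "lookup2 (D 0) u v = (if u = v then 0 else far g)" if "u \<in> verts G" "v \<in> verts G" for u v
    unfolding D_def funpow_0 by (intro lookup2_tab2 dvs) (simp_all add: vs that)
  have lower: "gdist G u v \<le> lookup2 (D k) u v" if "u \<in> verts G" "v \<in> verts G" for k u v
    using that
  proof (induction k arbitrary: u v)
    case 0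
    then show ?case using far_ge gdist_self by (simp add: zero)
  next
    case (Suc k)
    have "gdist G u v \<le> hop g u z + lookup2 (D k) z v" if "z \<in> verts G" for z
      using gdist_tri[OF Suc.prems(1) that Suc.prems(2)] hop_ge[OF Suc.prems(1) that] Suc.IH[OF that
      Suc.prems(2)] by linarith
    then show ?case using Suc by (simp add: step foldr_min_ge_iff vs)
  qed
  \<comment> \<open>\<open>k\<close> rounds handle walks with \<open>k\<close> edges, that is,
    \<open>Suc k\<close> vertices.\<close>
  have upper: "lookup2 (D k) u v \<le> walk_length G p" if "p \<in> walks G u v" "length p \<le> Suc k" for k u v p
    using that
  proof (induction k arbitrary: u p)
    case 0
    then have "p = [u]" "u = v" "u \<in> verts G" by (cases p; auto simp: walks_def)+
    then show ?case by (simp add: zero)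
  next
    case (Suc k)
    have uv: "u \<in> verts G" "v \<in> verts G" using Suc.prems(1) by (auto simp: walks_def)
    show ?case
    proof (cases "length p \<le> Suc k")
      case True
      have "lookup2 (D (Suc k)) u v \<le> lookup2 (D k) u v" unfolding step[OF uv] by (rule foldr_min_le)
      then show ?thesis using Suc.IH[OF Suc.prems(1) True] by linarith
    next
      case False
      then obtain z p' where p: "p = u # z # p'" using Suc.prems by (cases p; cases "tl p") (auto simp:
      walks_def)
      have z: "z # p' \<in> walks G z v" "z \<in> verts G" "{u, z} \<in> edges G" using Suc.prems(1) by (auto simp:
      p walks_def)
      have "lookup2 (D (Suc k)) u v \<le> hop g u z + lookup2 (D k) z v"
        unfolding step[OF uv] by (rule foldr_min_le(2)) (use z vs in auto)
      then show ?thesis using Suc.IH[OF z(1)] hop_le[OF z(3)] Suc.prems(2) by (simp add: p)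
    qed
  qed
  have "lookup2 (D (length vs)) u v \<le> gdist G u v"
  proof (rule gdist_ge[OF assms])
    fix p assume "p \<in> walks G u v"
    then obtain p' where p': "p' \<in> walks G u v" "distinct p'" "walk_length G p' \<le> walk_length G p"
      using ex_distinct_walk[OF weight_nonneg] by blast
    have "length p' = card (set p')" using p'(2) by (simp add: distinct_card)
    also have "\<dots> \<le> card (set vs)" using p'(1) finite_verts by (intro card_mono) (auto simp: walks_def vs)
    also have "\<dots> = length vs" using dvs by (rule distinct_card)
    finally show "lookup2 (D (length vs)) u v \<le> walk_length G p" using upper[OF p'(1), of "length vs"]
        p'(3) by simp
  qed
  then show ?thesis using lower[OF assms, of "length vs"] by (simp add: D)
qed

sublocale finite_pseudometric vs "lookup2 (dists g)"
proof (unfold_locales, goal_cases)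
  case (4 u v z)
  then show ?case using gdist_tri by (simp add: vs dists_correct)
qed (use dvs gdist_self gdist_sym gdist_nonneg in \<open>auto simp: vs dists_correct\<close>)

end


section \<open>Distortion and dimension\<close>

lemma nth_or_nil_nth: "j < length xs \<Longrightarrow> nth_or_nil j xs = xs ! j"
proof -
  assume j: "j < length xs"
  have "(tl ^^ j) xs = drop j xs" for j by (induction j) (simp_all add: drop_Suc tl_drop)
  then show ?thesis using j by (simp add: nth_or_nil_def hd_or_def Cons_nth_drop_Suc[symmetric])
qed

lemma set_coords: "set (coords \<beta> m \<tau> vs dm ps levs) = {coord \<beta> vs dm ps r j a q levs | r j a q. r < m \<and>
    j < \<tau> \<and> q \<in> set ps}"
proof (intro equalityI subsetI)
  fix H assume "H \<in> {coord \<beta> vs dm ps r j a q levs | r j a q. r < m \<and> j < \<tau> \<and> q \<in> set ps}"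
  then obtain r j a q where "H = coord \<beta> vs dm ps r j a q levs" "r < m" "j < \<tau>" "q \<in> set ps" by blast
  then show "H \<in> set (coords \<beta> m \<tau> vs dm ps levs)"
    by (cases a) (simp_all add: coords_def, (rule bexI[of _ r], rule bexI[of _ j], auto)+)
qed (auto simp: coords_def; blast)

lemma length_coords: "length (coords \<beta> m \<tau> vs dm ps levs) = m * (\<tau> * (2 * length ps))"
  by (simp add: coords_def length_concat o_def sum_list_triv)

lemma linf_dist_le: "0 \<le> t \<Longrightarrow> (\<And>i. i < k \<Longrightarrow> \<bar>a i - b i\<bar> \<le> t) \<Longrightarrow> linf_dist k a b \<le> t"
  unfolding linf_dist_def by (subst Max_le_iff) auto

lemma linf_dist_ge: "0 \<le> linf_dist k a b" "i < k \<Longrightarrow> \<bar>a i - b i\<bar> \<le> linf_dist k a b"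
  unfolding linf_dist_def by (auto intro!: Max_ge)

context presented_graph
begin

definition distances :: "real list" where
  "distances = map (\<lambda>e. snd (snd e)) (dists g)"

text \<open>The content of \<open>represents_cover\<close> and of the cover property for the decoded
  lists, on which the algorithm works.\<close>

definition covered :: "real \<Rightarrow> nat \<Rightarrow> real \<Rightarrow> cover \<Rightarrow> bool" where
  "covered \<beta> \<tau> \<Delta> Ps \<longleftrightarrow> (\<forall>P\<in>set Ps. distinct P \<and> (\<forall>C\<in>set P. distinct C)) \<and> (\<forall>P\<in>set Ps. inj_on set (set P)) \<and>
     sparse_partition_cover G \<beta> \<tau> \<Delta> (map (\<lambda>P. set ` set P) Ps)"

lemma gdist_in_distances:
  assumes "u \<in> verts G" "v \<in> verts G" shows "gdist G u v \<in> set distances"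
proof -
  have "\<exists>h. foldl (\<lambda>dm _. relax g dm) (tab2 (fst g) k) xs = tab2 (fst g) h" for k and xs :: "nat list"
    by (induction xs rule: rev_induct) (auto simp: relax_def)
  then obtain h where h: "dists g = tab2 vs h" unfolding dists_def by (auto simp: g)
  then have "gdist G u v = h u v" using dists_correct[OF assms] lookup2_tab2[OF dvs] assms vs by simp
  then show ?thesis using assms by (force simp: distances_def h tab2_def vs)
qed

lemma covered_clustering:
  assumes cov: "covered \<beta> \<tau> \<Delta> Ps" and j: "j < \<tau>" shows "clustering \<Delta> (nth_or_nil j Ps)"
proof -
  have len: "length Ps = \<tau>" using cov by (auto simp: covered_def sparse_partition_cover_def)
  define P where "P = nth_or_nil j Ps"
  have "P \<in> set Ps" using j len by (simp add: P_def nth_or_nil_nth)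
  then have P: "distinct P" "\<And>C. C \<in> set P \<Longrightarrow> distinct C" "inj_on set (set P)" "partition_on (verts G)
      (set ` set P)"
    "\<And>C x y. C \<in> set P \<Longrightarrow> x \<in> set C \<Longrightarrow> y \<in> set C \<Longrightarrow> gdist G x y \<le> \<Delta>"
    using cov by (auto simp: covered_def sparse_partition_cover_def)
  have sub: "x \<in> verts G" if "C \<in> set P" "x \<in> set C" for C x
    using partition_onD1[OF P(4)] that by auto
  show ?thesis unfolding P_def[symmetric] clustering_def
  proof (intro conjI ballI impI)
    fix C x y assume "C \<in> set P" "x \<in> set C" "y \<in> set C"
    then show "lookup2 (dists g) x y \<le> \<Delta>" using P(5) sub dists_correct by simp
  next
    fix C assume "C \<in> set P"
    then show "C \<noteq> []" using partition_onD3[OF P(4)] by (metis image_eqI list.set(1))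
  next
    fix v assume "v \<in> set vs"
    then show "\<exists>C\<in>set P. v \<in> set C" using partition_onD1[OF P(4)] by (auto simp: vs)
  next
    fix C D v assume CD: "C \<in> set P" "D \<in> set P" "v \<in> set C" "v \<in> set D"
    then have "set C = set D" using partition_onD2[OF P(4)] by (auto simp: disjoint_def)
    then show "C = D" using CD P(3) by (auto dest: inj_onD)
  qed (use P sub vs in auto)
qed

text \<open>Clusters are nonempty and disjoint, so their heads are distinct vertices and bound the
  number of clusters. Hence every cover that the scheme may return is an input of polynomial
  size.\<close>

lemma covered_breadth:
  assumes "covered \<beta> \<tau> \<Delta> Ps" shows "br Ps \<le> length vs + \<tau>"
proof -
  have len: "length Ps = \<tau>" using assms by (auto simp: covered_def sparse_partition_cover_def)
  have "br P \<le> length vs" if PP: "P \<in> set Ps" for P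
  proof -
    obtain j where "j < \<tau>" "P = Ps ! j" using PP len by (auto simp: in_set_conv_nth)
    then have "j < \<tau>" "P = nth_or_nil j Ps" using nth_or_nil_nth[of j Ps] len by auto
    then have P: "clustering \<Delta> P" using covered_clustering[OF assms] by simp
    have hd: "hd C \<in> set C" if "C \<in> set P" for C using P that by (auto simp: clustering_def)
    have "inj_on hd (set P)" using P hd unfolding clustering_def inj_on_def by metis
    moreover have "hd ` set P \<subseteq> set vs" using P hd unfolding clustering_def by blast
    ultimately have "card (set P) \<le> card (set vs)" by (rule card_inj_on_le) simp
    then have "length P \<le> length vs" using P dvs by (simp add: clustering_def distinct_card)
    moreover have "length C \<le> length vs" if "C \<in> set P" for C
    proof -
      have "card (set C) \<le> card (set vs)" using P that by (intro card_mono) (auto simp: clustering_def)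
      then show ?thesis using P that dvs by (simp add: clustering_def distinct_card)
    qed
    ultimately show ?thesis by simp
  qed
  then show ?thesis using len by (simp del: enc_list_def add: enc_list_def[of Ps]) (meson trans_le_add1)
qed

text \<open>The first alternative for \<open>m\<close> serves the case \<open>\<beta> < 1\<close>,
  where the only distance is 0 and dimension 0 is enough.\<close>

lemma embed_correct:
  assumes \<beta>: "m = 0 \<and> card (verts G) = 1 \<or> 1 \<le> \<beta> \<and> 560 * \<beta> \<le> (6/5) ^ m" and "0 < \<beta>" and \<epsilon>: "0 < \<epsilon>"
    and levs: "map (\<lambda>l. (fst l, fst (snd l))) levs = rev (scales m distances)"
    and cov: "\<And>l. l \<in> set levs \<Longrightarrow> covered \<beta> \<tau> (fst (snd l)) (snd (snd l))"
  obtains L f where "2 ^ L \<le> card (verts G)"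
    "represents_embedding (enc (embed \<beta> m \<tau> (g, levs))) G (m * (\<tau> * (2 * Suc L))) f"
    "has_distortion G (m * (\<tau> * (2 * Suc L))) f ((1 + \<epsilon>) * (2 * \<beta>))"
proof -
  have "vs \<noteq> []" using wg vs by (auto simp: weighted_graph_def)
  then obtain L where L: "powers vs = pow2s (Suc L)" "length vs < 2 ^ Suc L" "2 ^ L \<le> length vs" using
      powers_eq by metis
  define cs where "cs = coords \<beta> m \<tau> vs (dists g) (powers vs) levs"
  define f where "f = (\<lambda>v i. lookup1 (cs ! i) v)"
  have k: "length cs = m * (\<tau> * (2 * Suc L))" by (simp add: cs_def length_coords L pow2s_def)
  show thesis
  proof (rule that)
    show "2 ^ L \<le> card (verts G)" using L(3) distinct_card[OF dvs] vs by simp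
    have "map (\<lambda>i. Num (f v i)) [0..<length cs] = map (\<lambda>H. Num (lookup1 H v)) cs" for v
      using arg_cong[OF map_nth[of cs], of "map (\<lambda>H. Num (lookup1 H v))"] by (simp add: f_def o_def)
    moreover have "embed \<beta> m \<tau> (g, levs) = map (\<lambda>v. (v, map (\<lambda>H. lookup1 H v) cs)) vs"
      by (simp add: embed_def cs_def g)
    ultimately show "represents_embedding (enc (embed \<beta> m \<tau> (g, levs))) G (m * (\<tau> * (2 * Suc L))) f"
      unfolding represents_embedding_def k[symmetric]
      by (intro exI[of _ vs]) (simp add: dvs vs vertex_val_def o_def)
    show "has_distortion G (m * (\<tau> * (2 * Suc L))) f ((1 + \<epsilon>) * (2 * \<beta>))"
      unfolding has_distortion_def k[symmetric]
    proof (rule exI[of _ "(1 + \<epsilon>) * (2 * \<beta>)"], rule exI[of _ 1], intro conjI ballI)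
      show "0 < (1 + \<epsilon>) * (2 * \<beta>)" using \<epsilon> \<open>0 < \<beta>\<close> by simp
      fix x y assume xy: "x \<in> verts G" "y \<in> verts G"
      have good: "good_levels \<beta> j levs" if "1 \<le> \<beta>" "0 < m" "560 * \<beta> \<le> (6/5) ^ m" "j < \<tau>" for j
        unfolding good_levels_def[OF that(1) refl L(2)]
      proof (intro conjI ballI)
        fix l assume l: "l \<in> set levs"
        have "(fst l, fst (snd l)) \<in> set (rev (scales m distances))" unfolding levs[symmetric] using l
        by force
        then have "0 < fst (snd l)" using scales_chain[of m distances] by (auto simp: scale_chain_def)
        then show "good_level j l"
          unfolding good_level_def[OF that(1) refl L(2)] using covered_clustering[OF cov[OF l] that(4)]
          by simp
      next
        have "sorted_wrt (\<lambda>a b. fst b = fst a \<longrightarrow> 560 * \<beta> * snd a \<le> snd b) (map (\<lambda>l. (fst l, fst (snd l)))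
        levs)"
          unfolding levs sorted_wrt_rev using scale_chain_sorted[OF scales_chain that(2,3)] by simp
        then show "sorted_wrt (\<lambda>l l'. fst l = fst l' \<longrightarrow> 560 * \<beta> * fst (snd l) \<le> fst (snd l')) levs"
          by (simp add: sorted_wrt_map eq_commute)
      qed
      show "linf_dist (length cs) (f x) (f y) \<le> 1 * gdist G x y"
      proof (rule linf_dist_le)
        fix i assume i: "i < length cs"
        then have "cs ! i \<in> set cs" by simp
        then obtain r j a q where c: "cs ! i = coord \<beta> vs (dists g) (powers vs) r j a q levs" "r < m" "j
        < \<tau>"
          unfolding cs_def set_coords by blast
        have "1 \<le> \<beta>" "560 * \<beta> \<le> (6/5) ^ m" using \<beta> c(2) by auto
        from crd_lip[OF this(1) refl L(2) good[OF this(1) _ this(2) c(3)]]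
        show "\<bar>f x i - f y i\<bar> \<le> 1 * gdist G x y"
          using c xy by (simp add: f_def L(1) vs dists_correct)
      qed (use gdist_nonneg xy in simp)
      show "1 / ((1 + \<epsilon>) * (2 * \<beta>)) * gdist G x y \<le> linf_dist (length cs) (f x) (f y)"
      proof (cases "gdist G x y = 0")
        case True
        then show ?thesis using linf_dist_ge(1) by simp
      next
        case False
        then have pos: "0 < gdist G x y" using gdist_nonneg[OF xy] by simp
        have "x \<noteq> y" using False gdist_self xy by auto
        then have "card (verts G) \<noteq> 1" using xy by (auto simp: card_1_singleton_iff)
        then have \<beta>': "1 \<le> \<beta>" "560 * \<beta> \<le> (6/5) ^ m" using \<beta> by auto
        have "0 < m" using \<beta>' by (cases m) auto
        obtain s where s: "s \<in> set (scales m distances)" "snd s < gdist G x y" "gdist G x y \<le> 3/2 * snd s"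
          using scales_cover[OF gdist_in_distances[OF xy] pos] by blast
        have "s \<in> set (map (\<lambda>l. (fst l, fst (snd l))) levs)" unfolding levs using s(1) by simp
        then obtain l where l: "l \<in> set levs" "s = (fst l, fst (snd l))" by auto
        then obtain ys zs where split: "levs = ys @ l # zs" by (meson split_list)
        have r: "fst l < m" using s(1) l(2) scales_chain[of m distances] \<open>0 < m\<close> by (auto simp:
        scale_chain_def)
        let ?\<Delta> = "fst (snd l)" and ?Ps = "snd (snd l)"
        have len: "length ?Ps = \<tau>" using cov[OF l(1)] by (auto simp: covered_def sparse_partition_cover_def)
        obtain P C where P: "P \<in> set ?Ps" "C \<in> set P" "gball G x (?\<Delta> / \<beta>) \<subseteq> set C"
          using cov[OF l(1)] xy(1) by (fastforce simp: covered_def sparse_partition_cover_def)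
        then obtain j where j: "j < \<tau>" "P = nth_or_nil j ?Ps" using len nth_or_nil_nth by (metis
        in_set_conv_nth)
        have sub: "{u \<in> set vs. lookup2 (dists g) x u \<le> ?\<Delta> / \<beta>} \<subseteq> set C"
          using P(3) xy by (auto simp: gball_def vs dists_correct)
        obtain q a where q: "q \<in> set (pow2s (Suc L))"
          "3/4 * (?\<Delta> / \<beta>) \<le> lookup1 (coord \<beta> vs (dists g) (pow2s (Suc L)) (fst l) j a q levs) x -
            lookup1 (coord \<beta> vs (dists g) (pow2s (Suc L)) (fst l) j a q levs) y"
          using crd_separates[OF \<beta>'(1) refl L(2), of j ys l zs x y C] good[OF \<beta>'(1) \<open>0 < m\<close> \<beta>'(2) j(1)]
          xy s l(2) P(2) j(2) sub
          unfolding split by (auto simp: vs dists_correct)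
        have "coord \<beta> vs (dists g) (pow2s (Suc L)) (fst l) j a q levs \<in> set cs"
          unfolding cs_def set_coords L(1) using r j(1) q(1) by blast
        then obtain i where i: "i < length cs" "cs ! i = coord \<beta> vs (dists g) (pow2s (Suc L)) (fst l) j
        a q levs"
          by (metis in_set_conv_nth)
        have "1 / ((1 + \<epsilon>) * (2 * \<beta>)) * gdist G x y \<le> 1 / (2 * \<beta>) * gdist G x y"
          using \<epsilon> \<beta>' pos by (intro mult_right_mono frac_le) (auto simp: algebra_simps)
        \<comment> \<open>Here the factor 2 arises: \<open>3/2\<close> is the range of distances
          served by one scale and \<open>3/4\<close> the part of the padding that is kept.\<close>
        also have "\<dots> \<le> 1 / (2 * \<beta>) * (3/2 * ?\<Delta>)"
          using s l(2) \<beta>' by (intro mult_left_mono) auto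
        also have "\<dots> = 3/4 * (?\<Delta> / \<beta>)" by simp
        also have "\<dots> \<le> \<bar>f x i - f y i\<bar>" using q(2) i(2) by (simp add: f_def)
        also have "\<dots> \<le> linf_dist (length cs) (f x) (f y)" by (rule linf_dist_ge(2)[OF i(1)])
        finally show ?thesis .
      qed
    qed (simp)+
  qed
qed

end

text \<open>The constant is \<open>2 * 62 * 2\<close>: two bits,
  \<open>m \<le> 62 * ln (\<beta> / e)\<close> and
  \<open>Suc L \<le> 2 * ln (n * \<beta> / e)\<close>. The cap \<open>e \<le> 1/2\<close> keeps both
  logarithms away from 0, so that they absorb additive constants.\<close>

lemma dimension_bound:
  assumes "1 \<le> \<beta>" "0 < \<epsilon>" "2 ^ L \<le> (n::nat)"
    and m: "m = nat \<lceil>ln (560 * \<beta>) / ln (6/5)\<rceil>"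
  shows "real (m * (\<tau> * (2 * Suc L))) \<le> 248 * dim_bound \<beta> \<tau> \<epsilon> n" "560 * \<beta> \<le> (6/5) ^ m"
proof -
  define e where "e = min \<epsilon> (1/2)"
  have e: "0 < e" "e \<le> 1/2" using assms by (auto simp: e_def)
  have l65: "1/6 \<le> ln (6/5 :: real)" using ln_ge_iff[of "6/5" "1/6"] ln_le_minus_one[of "5/6::real"] by
      (simp add: ln_div)
  have l2: "1/2 \<le> ln (2::real)" using ln_le_minus_one[of "1/2::real"] by (simp add: ln_div)
  \<comment> \<open>\<open>560 \<le> 2 ^ 10\<close>, so the constant becomes a factor 10 of the
    logarithm.\<close>
  have "560 * \<beta> \<le> (2 * \<beta>) ^ 10"
  proof -
    have "560 * \<beta> \<le> 1024 * \<beta> ^ 1" using assms by simp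
    also have "\<dots> \<le> 1024 * \<beta> ^ 10" using assms power_increasing[of 1 10 \<beta>] by (intro mult_left_mono) auto
    finally show ?thesis by (simp add: power_mult_distrib)
  qed
  then have "ln (560 * \<beta>) \<le> ln ((2 * \<beta>) ^ 10)" using assms by (subst ln_le_cancel_iff) auto
  also have "\<dots> = 10 * ln (2 * \<beta>)" using assms by (subst ln_realpow) auto
  finally have l560: "ln (560 * \<beta>) \<le> 10 * ln (2 * \<beta>)" .
  have pos: "0 \<le> ln (560 * \<beta>)" using assms by simp
  have l2b: "1/2 \<le> ln (2 * \<beta>)" 
  proof -
    have "ln (2 * \<beta>) = ln 2 + ln \<beta>" using assms by (subst ln_mult) auto
    moreover have "0 \<le> ln \<beta>" by (rule ln_ge_zero[OF assms(1)])
    ultimately show ?thesis using l2 by linarith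
  qed
  have "real m \<le> ln (560 * \<beta>) / ln (6/5) + 1"
  proof -
    let ?q = "ln (560 * \<beta>) / ln (6/5)"
    have "0 \<le> ?q" using pos l65 by (intro divide_nonneg_nonneg) auto
    then have "0 \<le> \<lceil>?q\<rceil>" using ceiling_mono[of 0 ?q] by simp
    then show ?thesis unfolding m using of_int_ceiling_le_add_one[of ?q] by simp
  qed
  also have "ln (560 * \<beta>) / ln (6/5) \<le> 10 * ln (2 * \<beta>) / (1/6)"
    using l560 l65 pos by (intro frac_le) auto
  \<comment> \<open>60 is \<open>10 / (1/6)\<close>, and the 1 from rounding up is at most
    \<open>2 * ln (2 * \<beta>)\<close>.\<close>
  finally have "real m \<le> 62 * ln (2 * \<beta>)" using l2b by simp
  also have "ln (2 * \<beta>) \<le> ln (\<beta> / e)" using e assms by (subst ln_le_cancel_iff) (auto simp: field_simps)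
  finally have m': "real m \<le> 62 * ln (\<beta> / e)" by simp
  have "0 < n" using assms(3) by (metis gr0I not_one_le_zero power_not_zero le_zero_eq zero_neq_numeral)
  have "real (2 ^ L) \<le> real n" using assms(3) by (simp only: of_nat_le_iff)
  then have "2 ^ Suc L \<le> 2 * real n" by simp
  also have "\<dots> \<le> real n * \<beta> / e"
    using e assms \<open>0 < n\<close> mult_mono[of 2 "1 / e" 1 \<beta>] by (simp add: field_simps)
  finally have "2 ^ Suc L \<le> real n * \<beta> / e" .
  then have "ln (2 ^ Suc L) \<le> ln (real n * \<beta> / e)" using e assms \<open>0 < n\<close> by (subst ln_le_cancel_iff) auto
  then have "real (Suc L) * ln 2 \<le> ln (real n * \<beta> / e)" by (simp only: ln_realpow zero_less_numeral)
  then have "real (Suc L) * (1/2) \<le> ln (real n * \<beta> / e)"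
    using l2 by (intro order_trans[OF mult_left_mono[of "1/2" "ln 2" "real (Suc L)"]]) auto
  then have L': "real (Suc L) \<le> 2 * ln (real n * \<beta> / e)" by simp
  have "real (m * (\<tau> * (2 * Suc L))) = (real \<tau> * 2) * (real m * real (Suc L))" by (simp add: algebra_simps)
  also have "\<dots> \<le> (real \<tau> * 2) * (62 * ln (\<beta> / e) * (2 * ln (real n * \<beta> / e)))"
    using m' L' by (intro mult_left_mono mult_mono) auto
  also have "\<dots> = 1 * (248 * (real \<tau> * ln (\<beta> / e) * ln (real n * \<beta> / e)))" by simp
  also have "\<dots> \<le> (1 / e) * (248 * (real \<tau> * ln (\<beta> / e) * ln (real n * \<beta> / e)))"
  proof (rule mult_right_mono)
    show "0 \<le> 248 * (real \<tau> * ln (\<beta> / e) * ln (real n * \<beta> / e))"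
      using order_trans[OF _ m', of 0] order_trans[OF _ L', of 0] by (intro mult_nonneg_nonneg) auto
  qed (use e in \<open>auto simp: field_simps\<close>)
  finally show "real (m * (\<tau> * (2 * Suc L))) \<le> 248 * dim_bound \<beta> \<tau> \<epsilon> n"
    by (simp add: dim_bound_def Let_def e_def[symmetric] mult.assoc)
  have "ln (560 * \<beta>) / ln (6/5) \<le> real m" unfolding m by (rule real_nat_ceiling_ge)
  then have "ln (560 * \<beta>) \<le> real m * ln (6/5)" using l65 by (simp add: field_simps)
  also have "\<dots> = ln ((6/5) ^ m)" by (simp add: ln_realpow)
  finally show "560 * \<beta> \<le> (6/5) ^ m" using assms by (subst (asm) ln_le_cancel_iff) auto
qed


section \<open>The randomized program\<close>

text \<open>A body for \<open>loop_prog\<close> whose items are a residue class with a scale. Two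
  bindings put the graph and the scale in front of the environment, in the order in which
  \<open>p\<close> expects its inputs, and \<open>close_prog 2\<close> hides the rest. The first
  binding shifts the loop argument to variable 1.\<close>

definition cover_prog :: "prog \<Rightarrow> prog" where
  "cover_prog p =
     (let item = Unary Head (Unary Tail (Unary Head (Unary Tail (Var 0)))); scale = Unary Head (Unary
         Tail item) in
      Binary Prepend
        (Binary Prepend (Unary Head item)
          (Binary Prepend
            (Binary Prepend scale
              (Binary Prepend (Bind scale (Bind (Unary Head (Var 1)) (close_prog 2 p))) Empty))
            Empty))
        (Unary Head (Unary Head (Unary Tail (Var 0)))))"

lemma cw_cover_prog:
  assumes "cw p [X, D] Q T"
  shows "cw (cover_prog p) [Lst [X, Lst [Lst a, Lst [R, D]]]]
    (\<lambda>v. \<exists>y. Q y \<and> v = Lst (Lst [R, Lst [D, y]] # a)) (T + 100)"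
proof -
  let ?env = "[Lst [X, Lst [Lst a, Lst [R, D]]]]"
  let ?item = "Unary Head (Unary Tail (Unary Head (Unary Tail (Var 0))))"
  let ?scale = "Unary Head (Unary Tail ?item)"
  let ?y = "Bind ?scale (Bind (Unary Head (Var 1)) (close_prog 2 p))"
  have item: "cw ?item ?env (\<lambda>v. v = Lst [R, D]) 5"
    by (rule cw_mono[OF cw_Unary'[OF cw_Unary'[OF cw_Unary'[OF cw_Unary'[OF cw_Var']]]]]) auto
  have scale: "cw ?scale ?env (\<lambda>v. v = D) 7"
    by (rule cw_mono[OF cw_Unary'[OF cw_Unary'[OF item]]]) auto
  have res: "cw (Unary Head ?item) ?env (\<lambda>v. v = R) 6"
    by (rule cw_mono[OF cw_Unary'[OF item]]) auto
  have acc: "cw (Unary Head (Unary Head (Unary Tail (Var 0)))) ?env (\<lambda>v. v = Lst a) 4"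
    by (rule cw_mono[OF cw_Unary'[OF cw_Unary'[OF cw_Unary'[OF cw_Var']]]]) auto
  have g: "cw (Unary Head (Var 1)) (D # ?env) (\<lambda>v. v = X) 2"
    by (rule cw_mono[OF cw_Unary'[OF cw_Var']]) auto
  have y: "cw ?y ?env Q (7 + (2 + T + 1) + 1)"
  proof (rule cw_Bind[OF scale])
    fix v assume "v = D"
    then show "cw (Bind (Unary Head (Var 1)) (close_prog 2 p)) (v # ?env) Q (2 + T + 1)"
      using cw_close[OF assms, of 2 ?env] by (intro cw_Bind[of _ _ "\<lambda>v. v = X"]) (use g in auto)
  qed
  have 1: "cw (Binary Prepend ?y Empty) ?env
      (\<lambda>v. \<exists>y. Q y \<and> v = Lst [y]) (7 + (2 + T + 1) + 1 + 1 + 1)"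
    by (rule cw_Binary[OF y]) (rule cw_Empty, auto)
  note 2 = cw_Binary_right[OF scale 1, where R="\<lambda>v. \<exists>y. Q y \<and> v = Lst [D, y]" and f=Prepend]
  have 2: "cw (Binary Prepend ?scale (Binary Prepend ?y Empty)) ?env
      (\<lambda>v. \<exists>y. Q y \<and> v = Lst [D, y]) (T + 25)"
    by (rule cw_mono[OF 2]) auto
  have 3: "cw (Binary Prepend (Binary Prepend ?scale (Binary Prepend ?y Empty)) Empty) ?env
      (\<lambda>v. \<exists>y. Q y \<and> v = Lst [Lst [D, y]]) (T + 25 + 1 + 1)"
    by (rule cw_Binary[OF 2]) (rule cw_Empty, auto)
  note 4 = cw_Binary_right[OF res 3, where R="\<lambda>v. \<exists>y. Q y \<and> v = Lst [R, Lst [D, y]]" and f=Prepend]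
  have 4: "cw (Binary Prepend (Unary Head ?item) (Binary Prepend (Binary Prepend ?scale (Binary Prepend
      ?y Empty)) Empty)) ?env
      (\<lambda>v. \<exists>y. Q y \<and> v = Lst [R, Lst [D, y]]) (T + 40)"
    by (rule cw_mono[OF 4]) auto
  show ?thesis unfolding cover_prog_def Let_def
    by (rule cw_mono[OF cw_Binary[OF 4]]) (auto intro: cw_mono[OF acc])
qed

text \<open>The breadth of a list of numbers is its length, so \<open>polybd\<close> over such lists expresses polynomial
  bounds in the number of vertices.\<close>

lemma pb_power_form:
  assumes "polybd (\<lambda>vs :: nat list. T (length vs))"
  obtains c where "\<And>n. 1 \<le> n \<Longrightarrow> T n \<le> c * n ^ c"
proof -
  obtain k where k: "\<And>vs :: nat list. T (length vs) \<le> (length vs + 2) ^ k"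
    using assms unfolding polybd_def br_nat_list by blast
  show thesis
  proof (rule that[of "3 ^ k"])
    fix n :: nat assume "1 \<le> n"
    have "T n \<le> (n + 2) ^ k" using k[of "replicate n 0"] by simp
    also have "\<dots> \<le> (3 * n) ^ k" using \<open>1 \<le> n\<close> by (intro power_mono) auto
    also have "\<dots> = 3 ^ k * n ^ k" by (simp add: power_mult_distrib)
    also have "\<dots> \<le> 3 ^ k * n ^ (3 ^ k)"
    proof (intro mult_left_mono power_increasing)
      show "k \<le> 3 ^ k" by (rule less_imp_le, rule less_exp[THEN less_le_trans]) (simp add: power_mono)
    qed (use \<open>1 \<le> n\<close> in auto)
    finally show "T n \<le> 3 ^ k * n ^ (3 ^ k)" .
  qed
qed

text \<open>Randomness is confined to the loop that collects the covers. Whatever covers result,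
  their breadth is polynomial in the number of vertices, so the deterministic second phase has one
  time bound for all outcomes, and \<open>ok\<close> gives correctness for each of them.\<close>

lemma embedding_program:
  assumes scheme: "\<And>G \<Delta> x. G \<in> \<F> \<Longrightarrow> 0 < \<Delta> \<Longrightarrow> represents_graph x G \<Longrightarrow>
      computes_within p [x, Num \<Delta>] (\<lambda>y. \<exists>\<P>. represents_cover y \<P> \<and> sparse_partition_cover G \<beta> \<tau> \<Delta> \<P>)
        (c * card (verts G) ^ c)"
    and fam: "graph_family \<F>"
    and ok: "\<And>G L levs vs es0 g. G \<in> \<F> \<Longrightarrow> presented_graph G vs es0 g \<Longrightarrow>
        map (\<lambda>l. (fst l, fst (snd l))) levs = rev (scales m (presented_graph.distances g)) \<Longrightarrow>
        (\<And>l. l \<in> set levs \<Longrightarrow> presented_graph.covered G \<beta> \<tau> (fst (snd l)) (snd (snd l))) \<Longrightarrow>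
        Q G (enc (embed \<beta> m \<tau> (g, levs)))"
  shows "\<exists>p c. \<forall>G\<in>\<F>. \<forall>x. represents_graph x G \<longrightarrow> computes_within p [x] (Q G) (c * card (verts G) ^ c)"
proof -
  define sc :: "graph_data \<Rightarrow> (nat \<times> real) list" where "sc = (\<lambda>g. scales m (map (\<lambda>e. snd (snd e)) (dists
      g)))"
  have "ptime sc" unfolding sc_def by (intro pc_scales pc_map pc_dists pc_intros)
  then have "ptime (\<lambda>g. [enc (sc g), Lst [], enc g])"
    using pc_enc[THEN iffD2, OF \<open>ptime sc\<close>] pc_enc[THEN iffD2, OF pc_id] by (intro pc_Cons pc_const)
  then obtain q0 T0 where q0: "polybd T0" "\<And>g. cw q0 [enc g] (\<lambda>v. v = Lst [enc (sc g), Lst [], enc g])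
      (T0 g)"
    by (rule pcE) auto
  obtain q1 T1 where q1: "polybd T1" "\<And>z. cw q1 [enc z] (\<lambda>v. v = enc (embed \<beta> m \<tau> z)) (T1 z)"
    using pcE[OF pc_embed] by metis
  obtain T0' where T0': "\<And>R :: nat list \<Rightarrow> nat. polybd R \<Longrightarrow> polybd (\<lambda>x. T0' (R x))" "\<And>n z. br z \<le> n \<Longrightarrow> T0 z
      \<le> T0' n"
    using pb_pairE[OF q0(1)] by metis
  obtain T1' where T1': "\<And>R :: nat list \<Rightarrow> nat. polybd R \<Longrightarrow> polybd (\<lambda>x. T1' (R x))" "\<And>n z. br z \<le> n \<Longrightarrow> T1 z
      \<le> T1' n"
    using pb_pairE[OF q1(1)] by metis
  obtain S' where S': "\<And>R :: nat list \<Rightarrow> nat. polybd R \<Longrightarrow> polybd (\<lambda>x. S' (R x))" "\<And>n z. br z \<le> n \<Longrightarrow> br (sc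
      z) \<le> S' n"
    using pb_pairE[OF pc_pb[OF \<open>ptime sc\<close>]] by metis
  \<comment> \<open>Bounds the breadth of the encoded graph: \<open>n\<close> vertices, at most
    \<open>n * n\<close> edges, three numbers per edge.\<close>
  define R where "R = (\<lambda>n::nat. n * n + n + 3)"
  define R1 where "R1 = (\<lambda>n. R n + S' (R n) + \<tau> + 2)"
  define T where "T = (\<lambda>n. (T0' (R n) + (S' (R n) + 1) * (c * n ^ c + 150) + 2) + (5 + T1' (R1 n) + 1) + 1)"
  have pbn: "polybd (\<lambda>vs :: nat list. length vs)" using pb_br[where 'a="nat list"] by (simp add:
      br_nat_list del: enc_list_def)
  have pbR: "polybd (\<lambda>vs :: nat list. R (length vs))" unfolding R_def by (intro pb_intros pbn)
  have "polybd (\<lambda>vs :: nat list. T (length vs))"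
    unfolding T_def R1_def by (intro pb_intros pb_power T0' T1' S' pbR pbn)
  then obtain c' where c': "\<And>n. 1 \<le> n \<Longrightarrow> T n \<le> c' * n ^ c'" using pb_power_form by metis
  let ?p = "Bind (loop_prog (cover_prog p) q0) (Bind (Binary Prepend (Var 1) (Binary Prepend (Var 0)
      Empty)) (close_prog 1 q1))"
  have "computes_within ?p [x] (Q G) (c' * card (verts G) ^ c')" if G: "G \<in> \<F>" and x: "represents_graph
      x G" for G x
  proof -
    obtain vs es0 where V: "distinct vs" "set vs = verts G" and E: "distinct (map (\<lambda>(a, b). {a, b}) es0)"
      "set (map (\<lambda>(a, b). {a, b}) es0) = edges G"
      and xeq: "x = Lst [Lst (map vertex_val vs), Lst (map (\<lambda>(a, b). Lst [vertex_val a, vertex_val b,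
      Num (weight G {a, b})]) es0)]"
      using x unfolding represents_graph_def by blast
    define g :: graph_data where "g = (vs, map (\<lambda>(a, b). [real a, real b, weight G {a, b}]) es0)"
    have xg: "x = enc g" unfolding xeq g_def by (auto simp: vertex_val_def)
    interpret presented_graph G vs es0 g
      by unfold_locales (use fam G V E in \<open>auto simp: graph_family_def g_def\<close>)
    have n: "length vs = card (verts G)" using distinct_card[OF V(1)] V(2) by simp
    have n1: "1 \<le> length vs" using wg V(2) unfolding weighted_graph_def by (cases vs) auto
    have le: "length es0 \<le> length vs * length vs"
    proof -
      have "length es0 = card (set (map (\<lambda>(a, b). {a, b}) es0))" using distinct_card[OF E(1)] by simp
      also have "\<dots> \<le> card ((\<lambda>(a, b). {a, b}) ` (verts G \<times> verts G))"
        unfolding E(2) using finite_verts wg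
        by (intro card_mono) (auto simp: weighted_graph_def)
      also have "\<dots> \<le> card (verts G \<times> verts G)" using finite_verts by (intro card_image_le) auto
      finally show ?thesis by (simp add: n card_cartesian_product)
    qed
    have brg: "br g \<le> R (length vs)" using le by (auto simp: g_def R_def)
    have dist: "map (\<lambda>e. snd (snd e)) (dists g) = distances" by (simp add: distances_def)
    \<comment> \<open>Prepending reverses the decreasing list of scales, so \<open>coord\<close>
      meets the smallest scale first.\<close>
    define J where "J = (\<lambda>k v. \<exists>levs. v = enc levs \<and> map (\<lambda>l. (fst l, fst (snd l))) levs = rev (take k
        (sc g)) \<and>
       (\<forall>l\<in>set levs. covered \<beta> \<tau> (fst (snd l)) (snd (snd l))))"
    have loop: "cw (loop_prog (cover_prog p) q0) [x] (J (length (map enc (sc g))))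
        (T0 g + (length (map enc (sc g)) + 1) * (c * card (verts G) ^ c + 100 + 50) + 2)"
    proof (rule cw_loop)
      show "cw q0 [x] (\<lambda>v. v = Lst [Lst (map enc (sc g)), Lst [], x]) (T0 g)" using q0(2)[of g] by (simp
      add: xg)
      show "J 0 (Lst [])" by (auto simp: J_def)
      fix k a assume k: "k < length (map enc (sc g))" and "J k a"
      then obtain levs where levs: "a = enc levs" "map (\<lambda>l. (fst l, fst (snd l))) levs = rev (take k (sc
      g))"
        "\<forall>l\<in>set levs. covered \<beta> \<tau> (fst (snd l)) (snd (snd l))" unfolding J_def by blast
      obtain r \<Delta> where item: "sc g ! k = (r, \<Delta>)" by (cases "sc g ! k")
      have "(r, \<Delta>) \<in> set (sc g)" using item k by (metis length_map nth_mem)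
      then have "0 < \<Delta>" using scales_chain[of m distances] by (auto simp: sc_def dist scale_chain_def)
      have "cw (cover_prog p) [Lst [x, Lst [Lst (map enc levs), Lst [Num (real r), Num \<Delta>]]]]
         (\<lambda>v. \<exists>y. (\<exists>\<P>. represents_cover y \<P> \<and> sparse_partition_cover G \<beta> \<tau> \<Delta> \<P>) \<and>
           v = Lst (Lst [Num (real r), Lst [Num \<Delta>, y]] # map enc levs)) (c * card (verts G) ^ c + 100)"
        by (rule cw_cover_prog[OF scheme[OF G \<open>0 < \<Delta>\<close> x]])
      moreover have "Lst [x, Lst [a, map enc (sc g) ! k]] = Lst [x, Lst [Lst (map enc levs), Lst [Num
      (real r), Num \<Delta>]]]"
        using k item levs(1) by simp
      ultimately show "cw (cover_prog p) [Lst [x, Lst [a, map enc (sc g) ! k]]] (J (Suc k)) (c * card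
      (verts G) ^ c + 100)"
      proof (simp only:, elim cw_mono)
        fix v assume "\<exists>y. (\<exists>\<P>. represents_cover y \<P> \<and> sparse_partition_cover G \<beta> \<tau> \<Delta> \<P>) \<and>
           v = Lst (Lst [Num (real r), Lst [Num \<Delta>, y]] # map enc levs)"
        then obtain y Ps where y: "covered \<beta> \<tau> \<Delta> Ps" "y = Lst (map (\<lambda>P. Lst (map (\<lambda>C. Lst (map
        vertex_val C)) P)) Ps)"
          "v = Lst (Lst [Num (real r), Lst [Num \<Delta>, y]] # map enc levs)"
          unfolding represents_cover_def covered_def by blast
        have "vertex_val = (enc :: nat \<Rightarrow> val)" by (auto simp: vertex_val_def fun_eq_iff)
        then have "y = enc Ps" using y(2) by simp
        then show "J (Suc k) v" unfolding J_def using y levs k item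
          by (intro exI[of _ "(r, \<Delta>, Ps) # levs"]) (auto simp: take_Suc_conv_app_nth)
      qed simp
    qed
    have "computes_within ?p [x] (Q G) (T (length vs))"
    proof -
      have "br (sc g) \<le> S' (R (length vs))" by (rule S'(2)[OF brg])
      then have lsc: "length (sc g) \<le> S' (R (length vs))" using br_le_list(1)[of "sc g"] by linarith
      have loop': "cw (loop_prog (cover_prog p) q0) [x] (J (length (sc g)))
          (T0' (R (length vs)) + (S' (R (length vs)) + 1) * (c * length vs ^ c + 150) + 2)"
        using loop
      proof (rule cw_mono)
        have "T0 g \<le> T0' (R (length vs))" by (rule T0'(2)[OF brg])
        moreover have "(length (map enc (sc g)) + 1) * (c * card (verts G) ^ c + 100 + 50) \<le> (S' (R
        (length vs)) + 1) * (c * length vs ^ c + 150)"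
          using lsc by (intro mult_mono) (auto simp: n)
        ultimately show "T0 g + (length (map enc (sc g)) + 1) * (c * card (verts G) ^ c + 100 + 50) + 2
            \<le> T0' (R (length vs)) + (S' (R (length vs)) + 1) * (c * length vs ^ c + 150) + 2" by linarith
      qed simp
      have post: "cw (Bind (Binary Prepend (Var 1) (Binary Prepend (Var 0) Empty)) (close_prog 1 q1))
      [v, x] (Q G)
          (5 + T1' (R1 (length vs)) + 1)" if J: "J (length (sc g)) v" for v
      proof -
        obtain levs where v: "v = enc levs" and levs: "map (\<lambda>l. (fst l, fst (snd l))) levs = rev (sc g)"
          "\<And>l. l \<in> set levs \<Longrightarrow> covered \<beta> \<tau> (fst (snd l)) (snd (snd l))" using J unfolding J_def
          take_all[OF order_refl] by blast
        have len: "length levs = length (sc g)" using arg_cong[OF levs(1), of length] by simp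
        have brP: "br (snd (snd l)) \<le> R (length vs) + \<tau>" if "l \<in> set levs" for l
          by (rule order_trans[OF covered_breadth[OF levs(2)[OF that]]]) (simp add: R_def)
        have brl: "br levs \<le> R1 (length vs)"
        proof (rule br_list_le[THEN iffD2], intro conjI ballI)
          show "length levs \<le> R1 (length vs)" using len lsc by (simp add: R1_def)
          fix l assume "l \<in> set levs"
          from brP[OF this] show "br l \<le> R1 (length vs)" by (auto simp: R1_def simp del: enc_list_def)
        qed
        have "br (g, levs) \<le> R1 (length vs)" using brl brg by (auto simp: R1_def simp del: enc_list_def)
        then have T1: "T1 (g, levs) \<le> T1' (R1 (length vs))" by (rule T1'(2))
        have ok': "Q G (enc (embed \<beta> m \<tau> (g, levs)))"
          by (rule ok[OF G presented_graph_axioms]) (use levs in \<open>auto simp: sc_def dist\<close>)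
        have pair: "cw (Binary Prepend (Var 1) (Binary Prepend (Var 0) Empty)) [v, x] (\<lambda>u. u = enc (g,
        levs)) 5"
          by (rule cw_mono[OF cw_Binary'[OF cw_Var' cw_Binary'[OF cw_Var' cw_Empty]]]) (auto simp: v xg)
        show ?thesis
        proof (rule cw_Bind[OF pair])
          fix u assume "u = enc (g, levs)"
          then have "cw (close_prog 1 q1) (u # [v, x]) (\<lambda>v. v = enc (embed \<beta> m \<tau> (g, levs))) (T1 (g, levs))"
            using cw_close[OF q1(2)[of "(g, levs)"], of 1 "[v, x]"] by simp
          then show "cw (close_prog 1 q1) (u # [v, x]) (Q G) (T1' (R1 (length vs)))"
            by (rule cw_mono) (use ok' T1 in auto)
        qed
      qed
      show ?thesis unfolding T_def by (rule cw_Bind[OF loop' post])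
    qed
    then show ?thesis by (rule cw_mono) (use c'[OF n1] n in auto)
  qed
  then show ?thesis by blast
qed


lemma ex_represents_graph:
  assumes "weighted_graph G" shows "\<exists>x. represents_graph x G"
proof -
  have fin: "finite (verts G)" using assms by (simp add: weighted_graph_def)
  have "edges G \<subseteq> Pow (verts G)" using assms by (fastforce simp: weighted_graph_def)
  then have "finite (edges G)" using fin by (simp add: finite_subset)
  then obtain es where es: "set es = edges G" "distinct es" using finite_distinct_list by blast
  obtain vs where vs: "set vs = verts G" "distinct vs" using finite_distinct_list[OF fin] by blast
  have "\<forall>e\<in>edges G. \<exists>p. e = {fst p, snd p}" using assms by (fastforce simp: weighted_graph_def)
  then obtain h where h: "\<And>e. e \<in> edges G \<Longrightarrow> e = {fst (h e), snd (h e)}" by metis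
  have "map (\<lambda>(a, b). {a, b}) (map h es) = es"
    using h es(1) by (auto simp: case_prod_unfold intro!: map_idI)
  then show ?thesis unfolding represents_graph_def using vs es by metis
qed

text \<open>With all weights equal to \<open>1 / \<beta> > 1\<close>, a padded cluster of diameter \<open>1\<close> would contain both
  ends of an edge.\<close>

lemma single_vertex_if_small_beta:
  assumes fam: "graph_family \<F>" and rew: "closed_under_reweighting \<F>" and "0 < \<beta>" "\<beta> < 1"
    and scheme: "admits_sparse_partition_cover_scheme \<F> \<beta> \<tau>" and G: "G \<in> \<F>"
  shows "card (verts G) = 1"
proof (rule ccontr)
  assume n: "card (verts G) \<noteq> 1"
  have wg: "weighted_graph G" "connected_graph G" using fam G by (auto simp: graph_family_def)
  obtain u where u: "u \<in> verts G" using wg by (auto simp: weighted_graph_def)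
  have "verts G \<noteq> {u}" using n by auto
  then obtain v where v: "v \<in> verts G" "u \<noteq> v" using u by blast
  obtain p where p: "p \<in> walks G u v" using wg u v by (auto simp: connected_graph_def)
  then obtain z p' where "p = u # z # p'" using v(2) by (cases p; cases "tl p") (auto simp: walks_def)
  then have z: "{u, z} \<in> edges G" "z \<in> verts G" using p by (auto simp: walks_def)
  have "u \<noteq> z" using z(1) wg by (fastforce simp: weighted_graph_def)
  define G' where "G' = G\<lparr>weight := \<lambda>_. 1 / \<beta>\<rparr>"
  have G': "G' \<in> \<F>" using rew G \<open>0 < \<beta>\<close> by (auto simp: closed_under_reweighting_def G'_def)
  interpret connected_weighted G' using fam G' by unfold_locales (auto simp: graph_family_def)
  have uz: "{u, z} \<in> edges G'" "u \<in> verts G'" "z \<in> verts G'" "weight G' e = 1 / \<beta>" for e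
    using z u by (auto simp: G'_def)
  obtain x where x: "represents_graph x G'" using ex_represents_graph[OF wg(1)] ex_represents_graph[of
      G'] fam G'
    by (auto simp: graph_family_def)
  obtain p c where "computes_within p [x, Num 1]
          (\<lambda>y. \<exists>\<P>. represents_cover y \<P> \<and> sparse_partition_cover G' \<beta> \<tau> 1 \<P>)
          (c * card (verts G') ^ c)"
    using scheme G' x unfolding admits_sparse_partition_cover_scheme_def by (meson zero_less_one)
  then have ll: "lossless_spmf (run p [x, Num 1])"
    and all: "\<forall>(v, s)\<in>set_spmf (run p [x, Num 1]). \<exists>\<P>. represents_cover v \<P> \<and> sparse_partition_cover G'
        \<beta> \<tau> 1 \<P>"
    by (auto simp: computes_within_def)
  \<comment> \<open>A program that halts almost surely has at least one possible result, so a cover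
    exists.\<close>
  have "set_spmf (run p [x, Num 1]) \<noteq> {}" using ll unfolding lossless_iff_set_pmf_None
    by (metis all_not_in_conv in_set_spmf not_None_eq set_pmf_not_empty)
  then obtain \<P> where "sparse_partition_cover G' \<beta> \<tau> 1 \<P>" using all by fast
  then obtain C where C: "gball G' u (1 / \<beta>) \<subseteq> C" "\<And>x y. x \<in> C \<Longrightarrow> y \<in> C \<Longrightarrow> gdist G' x y \<le> 1"
    using uz(2) unfolding sparse_partition_cover_def by meson
  have "u \<in> gball G' u (1 / \<beta>)" "z \<in> gball G' u (1 / \<beta>)"
    using uz gdist_self[of u] gdist_edge[of u z] \<open>0 < \<beta>\<close> by (auto simp: gball_def)
  then have "gdist G' u z \<le> 1" using C by blast
  moreover have "1 / \<beta> \<le> gdist G' u z"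
  proof (rule gdist_ge[OF uz(2,3)])
    fix q assume q: "q \<in> walks G' u z"
    then obtain a q' where q': "q = u # a # q'" using \<open>u \<noteq> z\<close> by (cases q; cases "tl q") (auto simp:
        walks_def)
    have "0 \<le> walk_length G' (a # q')"
      using walk_length_nonneg[OF weight_nonneg] q by (auto simp: q' walks_def)
    then show "1 / \<beta> \<le> walk_length G' q" using uz(4) by (simp add: q')
  qed
  moreover have "1 < 1 / \<beta>" using assms by simp
  ultimately show False by simp
qed

theorem theorem5p1:
  shows "\<exists>A>0. \<forall>(\<F> :: wgraph set) (\<beta> :: real) (\<tau> :: nat).
    graph_family \<F> \<longrightarrow> closed_under_reweighting \<F> \<longrightarrow> 0 < \<beta> \<longrightarrow>
    admits_sparse_partition_cover_scheme \<F> \<beta> \<tau> \<longrightarrow>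
    (\<forall>\<epsilon>>0. admits_efficient_embeddings \<F> ((1 + \<epsilon>) * (2 * \<beta>)) (\<lambda>n. A * dim_bound \<beta> \<tau> \<epsilon> n))"
proof (intro exI[of _ 248] conjI allI impI)
  fix \<F> :: "wgraph set" and \<beta> :: real and \<tau> :: nat and \<epsilon> :: real
  assume fam: "graph_family \<F>" and rew: "closed_under_reweighting \<F>" and \<beta>: "0 < \<beta>"
    and scheme: "admits_sparse_partition_cover_scheme \<F> \<beta> \<tau>" and \<epsilon>: "0 < \<epsilon>"
  \<comment> \<open>For \<open>1 \<le> \<beta>\<close> this is the least exponent with
    \<open>560 * \<beta> \<le> (6/5) ^ m\<close>. For \<open>\<beta> < 1\<close> every graph of the
    family is a single vertex and dimension 0 suffices.\<close>
  define m where "m = (if \<beta> < 1 then 0 else nat \<lceil>ln (560 * \<beta>) / ln (6/5)\<rceil>)"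
  obtain p c where p: "\<And>G \<Delta> x. G \<in> \<F> \<Longrightarrow> 0 < \<Delta> \<Longrightarrow> represents_graph x G \<Longrightarrow>
      computes_within p [x, Num \<Delta>] (\<lambda>y. \<exists>\<P>. represents_cover y \<P> \<and> sparse_partition_cover G \<beta> \<tau> \<Delta> \<P>)
        (c * card (verts G) ^ c)"
    using scheme unfolding admits_sparse_partition_cover_scheme_def by blast
  show "admits_efficient_embeddings \<F> ((1 + \<epsilon>) * (2 * \<beta>)) (\<lambda>n. 248 * dim_bound \<beta> \<tau> \<epsilon> n)"
    unfolding admits_efficient_embeddings_def
  proof (rule embedding_program[OF p fam])
    fix G L vs es0 g and levs :: "(nat \<times> real \<times> cover) list"
    assume G: "G \<in> \<F>" and "presented_graph G vs es0 g"
      and levs: "map (\<lambda>l. (fst l, fst (snd l))) levs = rev (scales m (presented_graph.distances g))"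
      and cov: "\<And>l. l \<in> set levs \<Longrightarrow> presented_graph.covered G \<beta> \<tau> (fst (snd l)) (snd (snd l))"
    interpret presented_graph G vs es0 g by fact
    have n: "1 \<le> card (verts G)" using wg by (simp add: weighted_graph_def card_gt_0_iff Suc_le_eq)
    have m: "m = 0 \<and> card (verts G) = 1 \<or> 1 \<le> \<beta> \<and> 560 * \<beta> \<le> (6/5) ^ m"
    proof (cases "\<beta> < 1")
      case True
      then show ?thesis using single_vertex_if_small_beta[OF fam rew \<beta> True scheme G] by (simp add: m_def)
    next
      case False
      then show ?thesis using dimension_bound(2)[of \<beta> \<epsilon> 0 "card (verts G)" m] \<epsilon> n by (simp add: m_def)
    qed
    obtain L f where L: "2 ^ L \<le> card (verts G)"
      "represents_embedding (enc (embed \<beta> m \<tau> (g, levs))) G (m * (\<tau> * (2 * Suc L))) f"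
      "has_distortion G (m * (\<tau> * (2 * Suc L))) f ((1 + \<epsilon>) * (2 * \<beta>))"
      using embed_correct[OF m \<beta> \<epsilon> levs cov] by blast
    have "real (m * (\<tau> * (2 * Suc L))) \<le> 248 * dim_bound \<beta> \<tau> \<epsilon> (card (verts G))"
    proof (cases "\<beta> < 1")
      case True
      then have "card (verts G) = 1" using single_vertex_if_small_beta[OF fam rew \<beta> True scheme G] by simp
      \<comment> \<open>The left side is 0. For one vertex the two logarithms in
        \<open>dim_bound\<close> coincide, so the right side is nonnegative even if they are
        negative.\<close>
      then show ?thesis using True \<epsilon> by (auto simp: m_def dim_bound_def Let_def mult.assoc intro!:
      mult_nonneg_nonneg divide_nonneg_nonneg)
    next
      case False
      then show ?thesis using \<epsilon> L(1) by (intro dimension_bound(1)) (auto simp: m_def)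
    qed
    then show "\<exists>k f. represents_embedding (enc (embed \<beta> m \<tau> (g, levs))) G k f \<and>
        has_distortion G k f ((1 + \<epsilon>) * (2 * \<beta>)) \<and> real k \<le> 248 * dim_bound \<beta> \<tau> \<epsilon> (card (verts G))"
      using L(2,3) by blast
  qed
qed simp


end
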